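(* Let $\ell\ge5$ be odd, let $\Phi$ be a root system of type $D_\ell$, and let $\omega\in W_{A_\circ}=\{1,\omega_1,\omega_{\ell-1},\omega_\ell\}$. Then for every $q\in\mathbb{Z}_{>0}$: - if $\omega=1$ and $q\notin2\mathbb{Z}$: $\chi_{\Phi,q}(\omega) = (q-1)(q-3)\cdots(q-(2\ell-3))\,(q-(\ell-1))$; - if $\omega=1$ and $q\in2\mathbb{Z}$: $\chi_{\Phi,q}(\omega) = (q-2)(q-4)\cdots(q-2(\ell-2))\,\bigl(q^2-2(\ell-1)q+\tfrac{\ell(\ell-1)}{2}\bigr)$; - if $\omega=\omega_1$ and $q\notin2\mathbb{Z}$: $\chi_{\Phi,q}(\omega)=0$; - if $\omega=\omega_1$ and $q\in2\mathbb{Z}$: $\chi_{\Phi,q}(\omega) = (q-2)(q-4)\cdots(q-2(\ell-2))$; - if $\omega\in\{\omega_{\ell-1},\omega_\ell\}$ and $q\notin4\mathbb{Z}$: $\chi_{\Phi,q}(\omega)=0$; - if $\omega\in\{\omega_{\ell-1},\omega_\ell\}$ and $q\in4\mathbb{Z}$: $\chi_{\Phi,q}(\omega) = 2\prod_{i=1}^{(\ell-3)/2}(q-4i) = 2(q-4)(q-8)\cdots(q-2(\ell-3))$.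
   Context: Let $\Phi = \{\pm e_i\pm e_k : i<k\}\subset E=\mathbb{R}^\ell$, with simple roots $\alpha_i=e_i-e_{i+1}$ ($1\le i\le\ell-1$), $\alpha_\ell=e_{\ell-1}+e_\ell$, Weyl group $W$ and the standard inner product $(\cdot,\cdot)$. The coweight lattice is $Z := \{x\in E : (\alpha,x)\in\mathbb{Z}\ \forall\alpha\in\Phi\}$. For $q\in\mathbb{Z}_{>0}$, $M(\Phi;q) := \{x+qZ\in Z/qZ : (\beta,x)\not\equiv0\pmod q\ \forall\beta\in\Phi\}$; $W$ acts on it via $w(x+qZ)=w(x)+qZ$, and $\chi_{\Phi,q}(w) := \#\{t\in M(\Phi;q) : w(t)=t\}$. Let $\tilde\alpha=\sum_{i=1}^\ell n_i\alpha_i$ be the highest root, $n_0:=1$, $J:=\{i\in\{0,\dots,\ell\}: n_i=1\}$ (here $J=\{0,1,\ell-1,\ell\}$). Let $w_0$ be the longest element of $W$; for $j\in J\setminus\{0\}$ let $w_j$ be the longest element of the subgroup generated by the simple reflections $s_{\alpha_i}$, $i\ne j$; put $\omega_j := w_jw_0$ and $\omega_0:=1$. Let $A_\circ=\{x\in E : (\alpha_i,x)>0\ \forall i,\ (\tilde\alpha,x)<1\}$; $W_{A_\circ}$ is the subgroup of $w\in W$ mapping the image of $A_\circ$ in $E/Z$ to itself, and $W_{A_\circ}=\{\omega_j : j\in J\}$. *)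

theory Defs
  imports "HOL-Analysis.Analysis"
begin

text \<open>
  The Euclidean space \<open>E\<close> of dimension \<open>l\<close> is a type of class \<open>euclidean_space\<close>; the map \<open>e\<close>
  enumerates its standard orthonormal basis as \<open>e 1, \<dots>, e l\<close>.
\<close>

definition roots_D :: "nat \<Rightarrow> (nat \<Rightarrow> 'a::euclidean_space) \<Rightarrow> 'a set" where
  "roots_D l e = {a *\<^sub>R e i + b *\<^sub>R e k | a b i k.
     a \<in> {1, -1} \<and> b \<in> {1, -1} \<and> 1 \<le> i \<and> i < k \<and> k \<le> l}"

definition simple_root :: "nat \<Rightarrow> (nat \<Rightarrow> 'a::euclidean_space) \<Rightarrow> nat \<Rightarrow> 'a" where
  "simple_root l e i = (if i < l then e i - e (i + 1) else e (l - 1) + e l)"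

definition root_refl :: "'a::euclidean_space \<Rightarrow> 'a \<Rightarrow> 'a" where
  "root_refl \<alpha> x = x - (2 * (\<alpha> \<bullet> x) / (\<alpha> \<bullet> \<alpha>)) *\<^sub>R \<alpha>"

definition products :: "('a \<Rightarrow> 'a) set \<Rightarrow> nat \<Rightarrow> ('a \<Rightarrow> 'a) set" where
  "products S n = {foldr (\<circ>) ss id | ss. length ss = n \<and> set ss \<subseteq> S}"

text \<open>
  Below, \<open>gen S\<close> is only used for sets \<open>S\<close> of reflections. These are involutions, so the finite
  products of elements of \<open>S\<close> form the group generated by \<open>S\<close>.
\<close>

definition gen :: "('a \<Rightarrow> 'a) set \<Rightarrow> ('a \<Rightarrow> 'a) set" where
  "gen S = (\<Union>n. products S n)"

definition weyl :: "nat \<Rightarrow> (nat \<Rightarrow> 'a::euclidean_space) \<Rightarrow> ('a \<Rightarrow> 'a) set" where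
  "weyl l e = gen (root_refl ` roots_D l e)"

definition weyl_length :: "nat \<Rightarrow> (nat \<Rightarrow> 'a::euclidean_space) \<Rightarrow> ('a \<Rightarrow> 'a) \<Rightarrow> nat" where
  "weyl_length l e w = (LEAST n. w \<in> products ((\<lambda>i. root_refl (simple_root l e i)) ` {1..l}) n)"

definition longest :: "nat \<Rightarrow> (nat \<Rightarrow> 'a::euclidean_space) \<Rightarrow> ('a \<Rightarrow> 'a) set \<Rightarrow> 'a \<Rightarrow> 'a" where
  "longest l e G = (THE w. w \<in> G \<and> (\<forall>v\<in>G. weyl_length l e v \<le> weyl_length l e w))"

definition omega :: "nat \<Rightarrow> (nat \<Rightarrow> 'a::euclidean_space) \<Rightarrow> nat \<Rightarrow> 'a \<Rightarrow> 'a" where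
  "omega l e j =
     longest l e (gen ((\<lambda>i. root_refl (simple_root l e i)) ` ({1..l} - {j}))) \<circ> longest l e (weyl l e)"

text \<open>The highest root is the greatest element of the root poset.\<close>

definition highest_root :: "nat \<Rightarrow> (nat \<Rightarrow> 'a::euclidean_space) \<Rightarrow> 'a" where
  "highest_root l e = (THE \<beta>. \<beta> \<in> roots_D l e \<and>
     (\<forall>\<gamma>\<in>roots_D l e. \<exists>c :: nat \<Rightarrow> nat. \<beta> - \<gamma> = (\<Sum>i=1..l. real (c i) *\<^sub>R simple_root l e i)))"

definition coweight_lattice :: "nat \<Rightarrow> (nat \<Rightarrow> 'a::euclidean_space) \<Rightarrow> 'a set" where
  "coweight_lattice l e = {x. \<forall>\<alpha>\<in>roots_D l e. \<alpha> \<bullet> x \<in> \<int>}"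

definition coset :: "'a::ab_group_add set \<Rightarrow> 'a \<Rightarrow> 'a set" where
  "coset L x = {x + z | z. z \<in> L}"

definition alcove :: "nat \<Rightarrow> (nat \<Rightarrow> 'a::euclidean_space) \<Rightarrow> 'a set" where
  "alcove l e = {x. (\<forall>i\<in>{1..l}. simple_root l e i \<bullet> x > 0) \<and> highest_root l e \<bullet> x < 1}"

text \<open>
  Elements of \<open>E/Z\<close> and \<open>Z/qZ\<close> are cosets, i.e. subsets of \<open>E\<close>. Every \<open>w\<close> in the Weyl group is
  linear and maps \<open>Z\<close> onto itself, so the direct image of \<open>x + qZ\<close> under \<open>w\<close> is \<open>w(x) + qZ\<close>
  (and likewise modulo \<open>Z\<close>); the action on the quotients is therefore \<open>t \<mapsto> w ` t\<close>.
\<close>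

definition alcove_stabilizer :: "nat \<Rightarrow> (nat \<Rightarrow> 'a::euclidean_space) \<Rightarrow> ('a \<Rightarrow> 'a) set" where
  "alcove_stabilizer l e =
     {w \<in> weyl l e. (\<lambda>t. w ` t) ` (coset (coweight_lattice l e) ` alcove l e)
                     = coset (coweight_lattice l e) ` alcove l e}"

definition M_compl :: "nat \<Rightarrow> (nat \<Rightarrow> 'a::euclidean_space) \<Rightarrow> nat \<Rightarrow> 'a set set" where
  "M_compl l e q =
     {coset ((\<lambda>z. real q *\<^sub>R z) ` coweight_lattice l e) x | x. x \<in> coweight_lattice l e \<and>
        (\<forall>\<beta>\<in>roots_D l e. \<not> (\<exists>k::int. \<beta> \<bullet> x = real q * of_int k))}"

definition chi :: "nat \<Rightarrow> (nat \<Rightarrow> 'a::euclidean_space) \<Rightarrow> nat \<Rightarrow> ('a \<Rightarrow> 'a) \<Rightarrow> nat" where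
  "chi l e q w = card {t \<in> M_compl l e q. w ` t = t}"

end

theory Submission
  imports Defs
begin

text \<open>
  The proof has two parts: a description of the elements \<open>\<omega>\<^sub>j\<close> in coordinates, and a
  count of residue vectors modulo \<open>2q\<close>.

  The Weyl group of type \<open>D\<^sub>l\<close> is the group of signed permutations of the coordinates with an even
  number of signs, and the length of an element is the number of positive roots that it makes negative
  (\<open>weyl_eq\<close>, \<open>weyl_length_eq\<close>).  For a dominant vector \<open>\<theta>\<close> the same descent argument shows that
  the stabilizer of \<open>\<theta>\<close> is generated by the simple reflections that fix \<open>\<theta>\<close>; its longest element
  is any involution in it that sends \<open>\<rho>\<close> to \<open>- \<rho> + c \<theta>\<close> (\<open>longest_stabilizer\<close>).  Taking \<open>\<theta> = 0\<close>
  and multiples of the fundamental coweights of the nodes \<open>1\<close>, \<open>l - 1\<close>, \<open>l\<close> gives all longest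
  elements, hence the \<open>\<omega>\<^sub>j\<close>, as explicit coordinate maps.  For odd \<open>l\<close> they form, with the identity, a
  cyclic group of order four generated by \<open>\<omega>\<^sub>l\<close>.

  The alcove stabilizer is computed from the single point \<open>\<rho> / (2l - 2)\<close> of the alcove.  An element \<open>w\<close>
  of the stabilizer moves this point to \<open>y + z\<close> with \<open>y\<close> in the alcove and \<open>z\<close> a coweight.  If \<open>z\<close> is
  integral, size considerations leave only \<open>w = 1\<close> and \<open>w = \<omega>\<^sub>1\<close> (\<open>integral_translation\<close>); if \<open>z\<close> is
  half-integral, composing with \<open>\<omega>\<^sub>l\<close> leads back to the integral case.

  For the counts, a coweight \<open>x\<close> is encoded by the integer vector \<open>a = 2x\<close>, whose entries all have the
  same parity.  Membership in \<open>M(\<Phi>;q)\<close> means \<open>a\<^sub>i \<noteq> \<plusminus> a\<^sub>k\<close> modulo \<open>2q\<close> for \<open>i \<noteq> k\<close>, and a coset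
  modulo \<open>qZ\<close> contains exactly two such vectors with entries in \<open>0, \<dots>, 2q - 1\<close>, because adding \<open>q\<close> to
  every entry stays in the coset.  So \<open>2 \<chi>(w)\<close> is a number of residue vectors (\<open>chi_double\<close>).  A
  product formula for functions with pairwise inequivalent values (\<open>card_sep_funs\<close>) then gives every
  case:

    \<^item> for \<open>1\<close>, all vectors count; the residues \<open>0\<close> and \<open>q\<close>, which equal their own negatives, are
      responsible for the lower order terms;
    \<^item> for \<open>\<omega>\<^sub>1\<close>, the first and the last entry must be \<open>0\<close> and \<open>q\<close> in some order, so \<open>q\<close> is even;
    \<^item> for \<open>\<omega>\<^sub>l\<close> and its inverse, moreover \<open>a\<^sub>i + a\<^sub>l\<^sub>+\<^sub>1\<^sub>-\<^sub>i = q\<close> modulo \<open>2q\<close>.  The middle entry then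
      forces \<open>4\<close> to divide \<open>q\<close>.  The vector is determined by its entries up to the middle place,
      which must be pairwise different up to sign modulo \<open>q\<close>.
\<close>

section \<open>Coordinates and even signed permutations\<close>

locale type_D =
  fixes e :: "nat \<Rightarrow> 'a::euclidean_space" and l :: nat
  assumes e_bij: "bij_betw e {1..l} Basis"
    and l_ge: "5 \<le> l"
begin

definition of_coords :: "(nat \<Rightarrow> real) \<Rightarrow> 'a" where
  "of_coords f = (\<Sum>i=1..l. f i *\<^sub>R e i)"

lemma inner_e:
  assumes "i \<in> {1..l}" "k \<in> {1..l}"
  shows "e i \<bullet> e k = (if i = k then 1 else 0)"
proof -
  have "e i \<in> Basis" "e k \<in> Basis" "e i = e k \<longleftrightarrow> i = k"
    using assms bij_betw_imp_inj_on [OF e_bij] bij_betw_apply [OF e_bij]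
    by (simp_all add: inj_on_eq_iff)
  then show ?thesis by (simp add: inner_Basis)
qed

lemma coord_of_coords [simp]: "k \<in> {1..l} \<Longrightarrow> e k \<bullet> of_coords f = f k"
proof -
  assume k: "k \<in> {1..l}"
  have "e k \<bullet> of_coords f = (\<Sum>i=1..l. f i * (e k \<bullet> e i))"
    by (simp add: of_coords_def inner_sum_right)
  also have "\<dots> = (\<Sum>i=1..l. if i = k then f i else 0)"
    by (rule sum.cong) (use k inner_e in auto)
  finally show ?thesis using k by simp
qed

lemma coord_eqI:
  assumes "\<And>i. i \<in> {1..l} \<Longrightarrow> e i \<bullet> x = e i \<bullet> y"
  shows "x = y"
proof (rule euclidean_eqI)
  fix b :: 'a assume "b \<in> Basis"
  then obtain i where "i \<in> {1..l}" "b = e i" using bij_betw_imp_surj_on [OF e_bij] by blast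
  then show "x \<bullet> b = y \<bullet> b" using assms by (simp add: inner_commute)
qed

lemma inner_coord: "x \<bullet> y = (\<Sum>i=1..l. (e i \<bullet> x) * (e i \<bullet> y))"
proof -
  have "x \<bullet> y = (\<Sum>b\<in>Basis. (x \<bullet> b) * (y \<bullet> b))" by (rule euclidean_inner)
  also have "\<dots> = (\<Sum>i=1..l. (x \<bullet> e i) * (y \<bullet> e i))"
    by (rule sum.reindex_bij_betw [OF e_bij, symmetric])
  finally show ?thesis by (simp add: inner_commute)
qed

abbreviation roots :: "'a set" where "roots \<equiv> roots_D l e"

text \<open>
  Without the condition \<open>i < k\<close> the description is visibly stable under permutations of the
  coordinates.
\<close>

lemma root_iff:
  "\<beta> \<in> roots \<longleftrightarrow> (\<exists>a b i k. a \<in> {1, -1} \<and> b \<in> {1, -1} \<and> i \<in> {1..l} \<and> k \<in> {1..l} \<and> i \<noteq> k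
     \<and> \<beta> = a *\<^sub>R e i + b *\<^sub>R e k)" (is "?L \<longleftrightarrow> ?R")
proof
  assume ?L
  then obtain a b i k where "\<beta> = a *\<^sub>R e i + b *\<^sub>R e k" "a \<in> {1, -1}" "b \<in> {1, -1}"
    "1 \<le> i" "i < k" "k \<le> l" unfolding roots_D_def by blast
  then have "a \<in> {1, -1} \<and> b \<in> {1, -1} \<and> i \<in> {1..l} \<and> k \<in> {1..l} \<and> i \<noteq> k
     \<and> \<beta> = a *\<^sub>R e i + b *\<^sub>R e k" by auto
  then show ?R by blast
next
  assume ?R
  then obtain a b i k where *: "a \<in> {1, -1}" "b \<in> {1, -1}" "i \<in> {1..l}" "k \<in> {1..l}" "i \<noteq> k"
    "\<beta> = a *\<^sub>R e i + b *\<^sub>R e k" by blast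
  show ?L
  proof (cases "i < k")
    case True then show ?thesis using * unfolding roots_D_def by auto
  next
    case False
    then have "k < i" "\<beta> = b *\<^sub>R e k + a *\<^sub>R e i" using * by auto
    then show ?thesis using * unfolding roots_D_def by (smt (verit) atLeastAtMost_iff mem_Collect_eq)
  qed
qed

text \<open>
  The permutation selects the source coordinate; thus composing maps multiplies the permutations
  in the opposite order.
\<close>

definition sgn_perm :: "(nat \<Rightarrow> nat) \<Rightarrow> (nat \<Rightarrow> real) \<Rightarrow> 'a \<Rightarrow> 'a" where
  "sgn_perm \<sigma> \<epsilon> x = of_coords (\<lambda>i. \<epsilon> i * (e (\<sigma> i) \<bullet> x))"

definition signed_perms :: "('a \<Rightarrow> 'a) set" where
  "signed_perms = {sgn_perm \<sigma> \<epsilon> | \<sigma> \<epsilon>. \<sigma> permutes {1..l} \<and> (\<forall>i\<in>{1..l}. \<epsilon> i \<in> {1, -1}) \<and> (\<Prod>i=1..l. \<epsilon> i) = 1}"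

text \<open>
  Most elements of interest are given by their coordinates, so membership is tested
  coordinatewise.
\<close>

lemma signed_perm_I:
  assumes "\<sigma> permutes {1..l}" "\<And>i. i \<in> {1..l} \<Longrightarrow> \<epsilon> i \<in> {1, -1}" "(\<Prod>i=1..l. \<epsilon> i) = 1"
    and "\<And>i x. i \<in> {1..l} \<Longrightarrow> e i \<bullet> w x = \<epsilon> i * (e (\<sigma> i) \<bullet> x)"
  shows "w \<in> signed_perms"
proof -
  have "w = sgn_perm \<sigma> \<epsilon>"
    by (rule ext, rule coord_eqI) (simp add: sgn_perm_def assms(4))
  then show ?thesis using assms(1-3) unfolding signed_perms_def by blast
qed

lemma signed_perm_E:
  assumes "w \<in> signed_perms"
  obtains \<sigma> \<epsilon> where "\<sigma> permutes {1..l}" "\<And>i. i \<in> {1..l} \<Longrightarrow> \<epsilon> i \<in> {1, -1}" "(\<Prod>i=1..l. \<epsilon> i) = 1"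
    "\<And>i x. i \<in> {1..l} \<Longrightarrow> e i \<bullet> w x = \<epsilon> i * (e (\<sigma> i) \<bullet> x)"
proof -
  from assms obtain \<sigma> \<epsilon> where s: "w = sgn_perm \<sigma> \<epsilon>" "\<sigma> permutes {1..l}"
    "\<forall>i\<in>{1..l}. \<epsilon> i \<in> {1, -1}" "(\<Prod>i=1..l. \<epsilon> i) = 1" unfolding signed_perms_def by blast
  show ?thesis by (rule that [OF s(2) _ s(4)]) (use s(1,3) in \<open>simp_all add: sgn_perm_def\<close>)
qed

lemma signed_perm_id: "id \<in> signed_perms"
  by (rule signed_perm_I [of id "\<lambda>_. 1"]) (auto simp: permutes_id)

lemma signed_perm_comp:
  assumes "v \<in> signed_perms" "w \<in> signed_perms"
  shows "v \<circ> w \<in> signed_perms"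
proof -
  from assms(1) obtain \<sigma> \<epsilon> where s: "\<sigma> permutes {1..l}" "\<And>i. i \<in> {1..l} \<Longrightarrow> \<epsilon> i \<in> {1, -1}"
    "(\<Prod>i=1..l. \<epsilon> i) = 1" "\<And>i x. i \<in> {1..l} \<Longrightarrow> e i \<bullet> v x = \<epsilon> i * (e (\<sigma> i) \<bullet> x)"
    by (rule signed_perm_E) blast
  from assms(2) obtain \<tau> \<delta> where t: "\<tau> permutes {1..l}" "\<And>i. i \<in> {1..l} \<Longrightarrow> \<delta> i \<in> {1, -1}"
    "(\<Prod>i=1..l. \<delta> i) = 1" "\<And>i x. i \<in> {1..l} \<Longrightarrow> e i \<bullet> w x = \<delta> i * (e (\<tau> i) \<bullet> x)"
    by (rule signed_perm_E) blast
  have in_l: "\<sigma> i \<in> {1..l}" if "i \<in> {1..l}" for i using s(1) that by (metis permutes_in_image)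
  show ?thesis
  proof (rule signed_perm_I [of "\<tau> \<circ> \<sigma>" "\<lambda>i. \<epsilon> i * \<delta> (\<sigma> i)"])
    show "\<tau> \<circ> \<sigma> permutes {1..l}" using s t by (intro permutes_compose)
    show "\<epsilon> i * \<delta> (\<sigma> i) \<in> {1, -1}" if "i \<in> {1..l}" for i
      using s(2)[OF that] t(2)[OF in_l[OF that]] by auto
    show "(\<Prod>i=1..l. \<epsilon> i * \<delta> (\<sigma> i)) = 1"
      using prod.permute [OF s(1), of \<delta>] s(3) t(3) by (simp add: prod.distrib o_def)
    show "e i \<bullet> (v \<circ> w) x = \<epsilon> i * \<delta> (\<sigma> i) * (e ((\<tau> \<circ> \<sigma>) i) \<bullet> x)" if "i \<in> {1..l}" for i x
      using s(4)[OF that] t(4)[OF in_l[OF that]] by simp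
  qed
qed

lemma signed_perm_inverse:
  assumes "w \<in> signed_perms"
  obtains v where "v \<in> signed_perms" "\<And>x. v (w x) = x" "\<And>x. w (v x) = x"
proof -
  from assms obtain \<sigma> \<epsilon> where s: "\<sigma> permutes {1..l}" "\<And>i. i \<in> {1..l} \<Longrightarrow> \<epsilon> i \<in> {1, -1}"
    "(\<Prod>i=1..l. \<epsilon> i) = 1" "\<And>i x. i \<in> {1..l} \<Longrightarrow> e i \<bullet> w x = \<epsilon> i * (e (\<sigma> i) \<bullet> x)"
    by (rule signed_perm_E) blast
  define \<tau> where "\<tau> = inv \<sigma>"
  define v where "v = sgn_perm \<tau> (\<epsilon> \<circ> \<tau>)"
  have t: "\<tau> permutes {1..l}" unfolding \<tau>_def using s(1) by (rule permutes_inv)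
  have in_s: "\<sigma> i \<in> {1..l}" if "i \<in> {1..l}" for i using s(1) that by (metis permutes_in_image)
  have in_t: "\<tau> i \<in> {1..l}" if "i \<in> {1..l}" for i using t that by (metis permutes_in_image)
  have st: "\<sigma> (\<tau> i) = i" "\<tau> (\<sigma> i) = i" for i
    using permutes_inverses [OF s(1)] by (auto simp: \<tau>_def)
  have v: "e i \<bullet> v x = \<epsilon> (\<tau> i) * (e (\<tau> i) \<bullet> x)" if "i \<in> {1..l}" for i x
    using that by (simp add: v_def sgn_perm_def)
  have sq: "\<epsilon> i * \<epsilon> i = 1" if "i \<in> {1..l}" for i using s(2)[OF that] by auto
  show ?thesis
  proof
    show "v \<in> signed_perms"
      by (rule signed_perm_I [OF t _ _ v])
        (use s(2) in_t prod.permute [OF t, of \<epsilon>] s(3) in \<open>auto simp: o_def\<close>)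
    show "v (w x) = x" for x
    proof (rule coord_eqI)
      fix i assume i: "i \<in> {1..l}"
      have "e i \<bullet> v (w x) = \<epsilon> (\<tau> i) * (\<epsilon> (\<tau> i) * (e i \<bullet> x))"
        using v[OF i] s(4)[OF in_t[OF i]] st by simp
      also have "\<dots> = e i \<bullet> x" using sq[OF in_t[OF i]] by (metis mult.assoc mult_1)
      finally show "e i \<bullet> v (w x) = e i \<bullet> x" .
    qed
    show "w (v x) = x" for x
    proof (rule coord_eqI)
      fix i assume i: "i \<in> {1..l}"
      have "e i \<bullet> w (v x) = \<epsilon> i * (\<epsilon> i * (e i \<bullet> x))"
        using s(4)[OF i] v[OF in_s[OF i]] st by simp
      also have "\<dots> = e i \<bullet> x" using sq[OF i] by (metis mult.assoc mult_1)
      finally show "e i \<bullet> w (v x) = e i \<bullet> x" .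
    qed
  qed
qed

lemma signed_perm_linear: assumes "w \<in> signed_perms" shows "linear w"
proof -
  from assms obtain \<sigma> \<epsilon> where s: "\<And>i x. i \<in> {1..l} \<Longrightarrow> e i \<bullet> w x = \<epsilon> i * (e (\<sigma> i) \<bullet> x)"
    by (rule signed_perm_E) blast
  show ?thesis
    by (rule linearI; rule coord_eqI) (auto simp: s inner_add_right algebra_simps)
qed

lemma signed_perm_inner: assumes "w \<in> signed_perms" shows "w x \<bullet> w y = x \<bullet> y"
proof -
  from assms obtain \<sigma> \<epsilon> where s: "\<sigma> permutes {1..l}" "\<And>i. i \<in> {1..l} \<Longrightarrow> \<epsilon> i \<in> {1, -1}"
     "\<And>i x. i \<in> {1..l} \<Longrightarrow> e i \<bullet> w x = \<epsilon> i * (e (\<sigma> i) \<bullet> x)"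
    by (rule signed_perm_E) blast
  have "w x \<bullet> w y = (\<Sum>i=1..l. (e (\<sigma> i) \<bullet> x) * (e (\<sigma> i) \<bullet> y))"
    unfolding inner_coord [of "w x"]
  proof (rule sum.cong)
    fix i assume i: "i \<in> {1..l}"
    have "\<epsilon> i = 1 \<or> \<epsilon> i = -1" using s(2)[OF i] by blast
    then show "(e i \<bullet> w x) * (e i \<bullet> w y) = (e (\<sigma> i) \<bullet> x) * (e (\<sigma> i) \<bullet> y)"
      using s(3)[OF i] by auto
  qed simp
  also have "\<dots> = x \<bullet> y"
    using sum.permute [OF s(1), of "\<lambda>i. (e i \<bullet> x) * (e i \<bullet> y)"] inner_coord [of x y]
    by (simp add: o_def)
  finally show ?thesis .
qed

lemma signed_perm_inj: assumes "w \<in> signed_perms" shows "inj w"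
  using signed_perm_inverse [OF assms] by (metis injI)

lemma signed_perm_root: assumes "w \<in> signed_perms" "\<beta> \<in> roots" shows "w \<beta> \<in> roots"
proof -
  from assms(1) obtain v where v: "v \<in> signed_perms" "\<And>x. w (v x) = x" by (rule signed_perm_inverse) blast
  from assms(1) obtain \<sigma> \<epsilon> where s: "\<sigma> permutes {1..l}" "\<And>i. i \<in> {1..l} \<Longrightarrow> \<epsilon> i \<in> {1, -1}"
     "\<And>i x. i \<in> {1..l} \<Longrightarrow> e i \<bullet> w x = \<epsilon> i * (e (\<sigma> i) \<bullet> x)"
    by (rule signed_perm_E) blast
  have im: "w (e i) = \<epsilon> (inv \<sigma> i) *\<^sub>R e (inv \<sigma> i)" and il: "inv \<sigma> i \<in> {1..l}" if i: "i \<in> {1..l}" for i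
  proof -
    show t: "inv \<sigma> i \<in> {1..l}" using permutes_inv [OF s(1)] i by (metis permutes_in_image)
    show "w (e i) = \<epsilon> (inv \<sigma> i) *\<^sub>R e (inv \<sigma> i)"
    proof (rule coord_eqI)
      fix k assume k: "k \<in> {1..l}"
      have sk: "\<sigma> k \<in> {1..l}" using s(1) k by (metis permutes_in_image)
      have "\<sigma> k = i \<longleftrightarrow> k = inv \<sigma> i" using permutes_inverses [OF s(1)] by metis
      then show "e k \<bullet> w (e i) = e k \<bullet> (\<epsilon> (inv \<sigma> i) *\<^sub>R e (inv \<sigma> i))"
        using s(3)[OF k] inner_e[OF sk i] inner_e[OF k t] by auto
    qed
  qed
  from assms(2) obtain a b i k where *: "a \<in> {1, -1}" "b \<in> {1, -1}" "i \<in> {1..l}" "k \<in> {1..l}" "i \<noteq> k"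
    "\<beta> = a *\<^sub>R e i + b *\<^sub>R e k" unfolding root_iff by blast
  have "w \<beta> = (a * \<epsilon> (inv \<sigma> i)) *\<^sub>R e (inv \<sigma> i) + (b * \<epsilon> (inv \<sigma> k)) *\<^sub>R e (inv \<sigma> k)"
    unfolding *(6) using signed_perm_linear[OF assms(1)] im[OF *(3)] im[OF *(4)]
    by (simp add: linear_add linear_cmul)
  moreover have "inv \<sigma> i \<noteq> inv \<sigma> k" using *(5) permutes_inverses [OF s(1)] by metis
  moreover have "a * \<epsilon> (inv \<sigma> i) \<in> {1,-1}" "b * \<epsilon> (inv \<sigma> k) \<in> {1,-1}"
    using *(1,2) s(2)[OF il[OF *(3)]] s(2)[OF il[OF *(4)]] by auto
  ultimately show ?thesis unfolding root_iff using il[OF *(3)] il[OF *(4)] by blast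
qed

text \<open>
  The reflection in \<open>a e\<^sub>i + b e\<^sub>k\<close> exchanges the coordinates \<open>i\<close> and \<open>k\<close> and multiplies both by
  \<open>- a b\<close>; the two signs cancel in the product.
\<close>

lemma refl_signed_perm: assumes "\<alpha> \<in> roots" shows "root_refl \<alpha> \<in> signed_perms"
proof -
  from assms obtain a b i k where *: "a \<in> {1, -1}" "b \<in> {1, -1}" "i \<in> {1..l}" "k \<in> {1..l}" "i \<noteq> k"
    "\<alpha> = a *\<^sub>R e i + b *\<^sub>R e k" unfolding root_iff by blast
  define c where "c = - a * b"
  have cc: "c * c = 1" "c \<in> {1,-1}" "a * a = 1" "b * b = 1" using *(1,2) by (auto simp: c_def)
  have co: "e j \<bullet> \<alpha> = (if j = i then a else if j = k then b else 0)" if "j \<in> {1..l}" for j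
    using that * inner_e by (auto simp: inner_add_right)
  have n: "\<alpha> \<bullet> \<alpha> = 2"
    unfolding *(6) using *(3-5) cc by (simp add: inner_add_left inner_add_right inner_e)
  have ax: "\<alpha> \<bullet> x = a * (e i \<bullet> x) + b * (e k \<bullet> x)" for x
    unfolding *(6) by (simp add: inner_add_left)
  show ?thesis
  proof (rule signed_perm_I)
    show "Transposition.transpose i k permutes {1..l}" using * by (intro permutes_swap_id) auto
    show "(if j = i \<or> j = k then c else 1) \<in> {1,-1}" if "j \<in> {1..l}" for j using cc by auto
    have "(\<Prod>j=1..l. if j = i \<or> j = k then c else 1) = (\<Prod>j\<in>{i,k}. c)"
      by (rule prod.mono_neutral_cong_right) (use * in auto)
    then show "(\<Prod>j=1..l. if j = i \<or> j = k then c else 1) = 1" using *(5) cc by simp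
    fix j x assume j: "j \<in> {1..l}"
    have "e j \<bullet> root_refl \<alpha> x = e j \<bullet> x - (\<alpha> \<bullet> x) * (e j \<bullet> \<alpha>)"
      by (simp add: root_refl_def n inner_diff_right)
    also have "\<dots> = (if j = i \<or> j = k then c else 1) * (e (Transposition.transpose i k j) \<bullet> x)"
    proof -
      have "a * (a * t) = t" "b * (b * t) = t" for t using cc by (metis mult.assoc mult_1)+
      then show ?thesis
        unfolding co[OF j] ax c_def using *(5) by (auto simp: algebra_simps)
    qed
    finally show "e j \<bullet> root_refl \<alpha> x = (if j = i \<or> j = k then c else 1) * (e (Transposition.transpose i k j) \<bullet> x)" .
  qed
qed

end

section \<open>Positive roots, length and longest elements\<close>

lemma products_0: "products S 0 = {id}"
  unfolding products_def by auto

lemma products_Suc: "products S (Suc n) = {s \<circ> w | s w. s \<in> S \<and> w \<in> products S n}"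
proof -
  have "f \<in> products S (Suc n) \<longleftrightarrow> (\<exists>s w. f = s \<circ> w \<and> s \<in> S \<and> w \<in> products S n)" for f
  proof
    assume "f \<in> products S (Suc n)"
    then obtain ss where "f = foldr (\<circ>) ss id" "length ss = Suc n" "set ss \<subseteq> S"
      unfolding products_def by blast
    then show "\<exists>s w. f = s \<circ> w \<and> s \<in> S \<and> w \<in> products S n"
      unfolding products_def by (cases ss) auto
  next
    assume "\<exists>s w. f = s \<circ> w \<and> s \<in> S \<and> w \<in> products S n"
    then obtain s ss where "f = s \<circ> foldr (\<circ>) ss id" "s \<in> S" "length ss = n" "set ss \<subseteq> S"
      unfolding products_def by blast
    then show "f \<in> products S (Suc n)"
      unfolding products_def by (intro CollectI exI [of _ "s # ss"]) simp
  qed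
  then show ?thesis by auto
qed

lemma products_snoc: "w \<in> products S n \<Longrightarrow> s \<in> S \<Longrightarrow> w \<circ> s \<in> products S (Suc n)"
proof (induction n arbitrary: w)
  case 0
  then have "w \<circ> s = s \<circ> id" by (simp add: products_0)
  with 0 show ?case unfolding products_Suc products_0 by blast
next
  case (Suc n)
  then obtain t v where tv: "w = t \<circ> v" "t \<in> S" "v \<in> products S n" by (auto simp: products_Suc)
  with Suc have "v \<circ> s \<in> products S (Suc n)" by blast
  then have "t \<circ> (v \<circ> s) \<in> products S (Suc (Suc n))"
    using tv(2) unfolding products_Suc[of S "Suc n"] by blast
  then show ?case unfolding tv(1) comp_assoc .
qed

lemma gen_mono: "S \<subseteq> T \<Longrightarrow> gen S \<subseteq> gen T"
  unfolding gen_def products_def by (intro UN_mono subset_refl) (auto 0 4)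

context type_D
begin

abbreviation simple :: "nat \<Rightarrow> 'a" where "simple \<equiv> simple_root l e"

lemma simple_inner:
  "simple i \<bullet> x = (if i < l then e i \<bullet> x - e (i + 1) \<bullet> x else e (l - 1) \<bullet> x + e l \<bullet> x)"
  by (simp add: simple_root_def inner_diff_left inner_add_left)

lemma root_I:
  assumes "i \<in> {1..l}" "k \<in> {1..l}" "i \<noteq> k"
  shows "e i + e k \<in> roots" "e i - e k \<in> roots"
proof -
  have "e i + e k = 1 *\<^sub>R e i + 1 *\<^sub>R e k" "e i - e k = 1 *\<^sub>R e i + (-1) *\<^sub>R e k" by simp_all
  then show "e i + e k \<in> roots" "e i - e k \<in> roots" unfolding root_iff using assms by blast+
qed

lemma root_E:
  assumes "\<beta> \<in> roots"
  obtains a b i k where "a \<in> {1, -1}" "b \<in> {1, -1}" "1 \<le> i" "i < k" "k \<le> l"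
    "\<beta> = a *\<^sub>R e i + b *\<^sub>R e k"
  using assms unfolding roots_D_def by blast

lemma simple_root_root: "i \<in> {1..l} \<Longrightarrow> simple i \<in> roots"
  using l_ge by (auto simp: simple_root_def intro!: root_I)

lemma root_neg: "\<beta> \<in> roots \<Longrightarrow> - \<beta> \<in> roots"
proof -
  assume "\<beta> \<in> roots"
  then obtain a b i k where *: "a \<in> {1, -1}" "b \<in> {1, -1}" "1 \<le> i" "i < k" "k \<le> l"
    "\<beta> = a *\<^sub>R e i + b *\<^sub>R e k" by (rule root_E)
  then have "-\<beta> = (-a) *\<^sub>R e i + (-b) *\<^sub>R e k" "-a \<in> {1,-1}" "-b \<in> {1,-1}" by auto
  with * show ?thesis unfolding roots_D_def by blast
qed

lemma finite_roots: "finite roots"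
proof -
  have "roots \<subseteq> (\<lambda>(a, b, i, k). a *\<^sub>R e i + b *\<^sub>R e k) ` ({1,-1} \<times> {1,-1} \<times> {1..l} \<times> {1..l})"
      proof
    fix \<beta> assume "\<beta> \<in> roots"
    then obtain a b i k where *: "a \<in> {1, -1}" "b \<in> {1, -1}" "1 \<le> i" "i < k" "k \<le> l"
      "\<beta> = a *\<^sub>R e i + b *\<^sub>R e k" by (rule root_E)
    then have "(a, b, i, k) \<in> {1,-1} \<times> {1,-1} \<times> {1..l} \<times> {1..l}" by auto
    then show "\<beta> \<in> (\<lambda>(a, b, i, k). a *\<^sub>R e i + b *\<^sub>R e k) ` ({1,-1} \<times> {1,-1} \<times> {1..l} \<times> {1..l})"
      by (rule rev_image_eqI) (simp add: *)
  qed
  then show ?thesis by (rule finite_subset) auto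
qed

lemma root_inner_self: "\<beta> \<in> roots \<Longrightarrow> \<beta> \<bullet> \<beta> = 2"
  by (erule root_E) (auto simp: inner_add_left inner_add_right inner_e)

lemma root_inner_Ints:
  assumes "\<beta> \<in> roots" "\<And>i. i \<in> {1..l} \<Longrightarrow> e i \<bullet> x \<in> \<int>"
  shows "\<beta> \<bullet> x \<in> \<int>"
  using assms(1) by (rule root_E) (use assms(2) in \<open>auto simp: inner_add_left\<close>)

lemma root_inner_root: "\<beta> \<in> roots \<Longrightarrow> \<gamma> \<in> roots \<Longrightarrow> \<beta> \<bullet> \<gamma> \<in> \<int>"
  by (rule root_inner_Ints, assumption, erule root_E) (auto simp: inner_add_right inner_e)

lemma root_inner_le: assumes "\<beta> \<in> roots" "\<gamma> \<in> roots" "\<beta> \<noteq> \<gamma>" shows "\<beta> \<bullet> \<gamma> \<le> 1"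
proof -
  have "0 < (\<beta> - \<gamma>) \<bullet> (\<beta> - \<gamma>)" using assms by simp
  also have "\<dots> = 4 - 2 * (\<beta> \<bullet> \<gamma>)"
    using assms by (simp add: root_inner_self inner_diff_left inner_diff_right inner_commute)
  finally have "\<beta> \<bullet> \<gamma> < 2" by simp
  moreover obtain n :: int where "\<beta> \<bullet> \<gamma> = of_int n"
    using root_inner_root[OF assms(1,2)] by (auto elim: Ints_cases)
  ultimately show ?thesis by simp
qed

lemma refl_root: "\<alpha> \<in> roots \<Longrightarrow> root_refl \<alpha> x = x - (\<alpha> \<bullet> x) *\<^sub>R \<alpha>"
  by (simp add: root_refl_def root_inner_self)

lemma refl_refl: "\<alpha> \<in> roots \<Longrightarrow> root_refl \<alpha> (root_refl \<alpha> x) = x"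
  by (simp add: refl_root root_inner_self inner_diff_right)

text \<open>
  The half sum of the positive roots. Pairing with it gives the height of a root, so its sign
  defines positivity.
\<close>

definition rho :: 'a where "rho = of_coords (\<lambda>i. real (l - i))"

definition pos_roots :: "'a set" where "pos_roots = {\<beta> \<in> roots. 0 < \<beta> \<bullet> rho}"

lemma coord_rho: "i \<in> {1..l} \<Longrightarrow> e i \<bullet> rho = real l - real i"
  by (auto simp: rho_def of_nat_diff)

lemma simple_rho: "i \<in> {1..l} \<Longrightarrow> simple i \<bullet> rho = 1"
  using l_ge by (auto simp: simple_inner coord_rho of_nat_diff)

lemma simple_pos: "i \<in> {1..l} \<Longrightarrow> simple i \<in> pos_roots"
  by (simp add: pos_roots_def simple_root_root simple_rho)

lemma root_rho_Ints: "\<beta> \<in> roots \<Longrightarrow> \<beta> \<bullet> rho \<in> \<int>"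
  by (rule root_inner_Ints) (auto simp: coord_rho)

lemma root_rho_nonzero: "\<beta> \<in> roots \<Longrightarrow> \<beta> \<bullet> rho \<noteq> 0"
  by (erule root_E) (auto simp: inner_add_left coord_rho)

lemma pos_ge_1: "\<beta> \<in> pos_roots \<Longrightarrow> 1 \<le> \<beta> \<bullet> rho"
  unfolding pos_roots_def using root_rho_Ints by (fastforce elim!: Ints_cases)

lemma not_pos: "\<beta> \<in> roots \<Longrightarrow> \<beta> \<notin> pos_roots \<longleftrightarrow> \<beta> \<bullet> rho < 0"
  using root_rho_nonzero by (force simp: pos_roots_def)

lemma neg_pos: "\<beta> \<in> roots \<Longrightarrow> \<beta> \<notin> pos_roots \<Longrightarrow> - \<beta> \<in> pos_roots"
  using not_pos[of \<beta>] root_neg by (simp add: pos_roots_def)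

lemma pos_root: "\<beta> \<in> pos_roots \<Longrightarrow> \<beta> \<in> roots"
  by (simp add: pos_roots_def)

lemma finite_pos: "finite pos_roots"
  using finite_roots by (simp add: pos_roots_def)

abbreviation srefl :: "nat \<Rightarrow> 'a \<Rightarrow> 'a" where "srefl i \<equiv> root_refl (simple i)"

lemma srefl_signed_perm: "i \<in> {1..l} \<Longrightarrow> srefl i \<in> signed_perms"
  by (intro refl_signed_perm simple_root_root)

text \<open>
  The reflection lowers the height of \<open>\<beta>\<close>, which is at least \<open>1\<close>, by an integer that is at most
  \<open>1\<close> for \<open>\<beta> \<noteq> \<alpha>\<^sub>i\<close>. The new height is therefore nonnegative, and no root has height \<open>0\<close>.
\<close>

lemma srefl_pos:
  assumes "i \<in> {1..l}" "\<beta> \<in> pos_roots" "\<beta> \<noteq> simple i"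
  shows "srefl i \<beta> \<in> pos_roots"
proof -
  have r: "srefl i \<beta> \<in> roots" by (rule signed_perm_root [OF srefl_signed_perm [OF assms(1)] pos_root [OF assms(2)]])
  have "srefl i \<beta> \<bullet> rho = \<beta> \<bullet> rho - simple i \<bullet> \<beta>"
    using assms by (simp add: refl_root simple_root_root inner_diff_left simple_rho)
  moreover have "simple i \<bullet> \<beta> \<le> 1" using assms by (intro root_inner_le simple_root_root pos_root) auto
  moreover have "1 \<le> \<beta> \<bullet> rho" using assms by (intro pos_ge_1)
  ultimately have "0 \<le> srefl i \<beta> \<bullet> rho" by simp
  with root_rho_nonzero[OF r] r show ?thesis by (simp add: pos_roots_def)
qed

lemma srefl_simple: "i \<in> {1..l} \<Longrightarrow> srefl i (simple i) = - simple i"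
  by (simp add: refl_root simple_root_root root_inner_self algebra_simps scaleR_2)

lemma neg_not_pos: "\<beta> \<in> pos_roots \<Longrightarrow> - \<beta> \<notin> pos_roots"
  by (simp add: pos_roots_def)

text \<open>
  The cone that defines the order of the root poset.
\<close>

definition pos_cone :: "'a set" where
  "pos_cone = {\<Sum>i=1..l. real (c i) *\<^sub>R simple i | c :: nat \<Rightarrow> nat. True}"

lemma pos_cone_0: "0 \<in> pos_cone"
  unfolding pos_cone_def by (intro CollectI exI [of _ "\<lambda>_. 0"]) simp

lemma pos_cone_add: "x \<in> pos_cone \<Longrightarrow> y \<in> pos_cone \<Longrightarrow> x + y \<in> pos_cone"
proof -
  assume "x \<in> pos_cone" "y \<in> pos_cone"
  then obtain c d :: "nat \<Rightarrow> nat" where "x = (\<Sum>i=1..l. real (c i) *\<^sub>R simple i)" "y = (\<Sum>i=1..l. real (d i) *\<^sub>R simple i)"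
    unfolding pos_cone_def by blast
  then have "x + y = (\<Sum>i=1..l. real (c i + d i) *\<^sub>R simple i)"
    by (simp add: sum.distrib scaleR_add_left)
  then show ?thesis unfolding pos_cone_def by (intro CollectI exI [of _ "\<lambda>i. c i + d i"]) simp
qed

lemma pos_cone_simple: "i \<in> {1..l} \<Longrightarrow> simple i \<in> pos_cone"
  unfolding pos_cone_def
  by (intro CollectI exI [of _ "\<lambda>j. if j = i then 1 else 0"])
    (simp add: if_distrib [of real] if_distrib [of "\<lambda>c. c *\<^sub>R _"] cong: if_cong)

lemma pos_cone_diff: "1 \<le> i \<Longrightarrow> i \<le> k \<Longrightarrow> k \<le> l \<Longrightarrow> e i - e k \<in> pos_cone"
proof (induction "k - i" arbitrary: i)
  case 0
  then show ?case using pos_cone_0 by simp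
next
  case (Suc n)
  then have "e (i + 1) - e k \<in> pos_cone" by simp
  moreover have "e i - e (i + 1) \<in> pos_cone" using pos_cone_simple[of i] Suc.hyps(2) Suc.prems
    by (simp add: simple_root_def split: if_splits)
  ultimately have "(e i - e (i + 1)) + (e (i + 1) - e k) \<in> pos_cone" by (rule pos_cone_add [rotated])
  then show ?case by simp
qed

lemma pos_cone_sum: assumes "1 \<le> i" "i < k" "k \<le> l" shows "e i + e k \<in> pos_cone"
proof -
  have "e (l - 1) + e l \<in> pos_cone" using pos_cone_simple[of l] l_ge by (simp add: simple_root_def)
  moreover have "e i - e (l - 1) \<in> pos_cone" "e k - e l \<in> pos_cone" using assms by (auto intro: pos_cone_diff)
  ultimately have "(e (l - 1) + e l) + (e i - e (l - 1)) + (e k - e l) \<in> pos_cone"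
    using pos_cone_add by blast
  then show ?thesis by (simp add: algebra_simps)
qed

lemma pos_root_in_cone: assumes "\<beta> \<in> pos_roots" shows "\<beta> \<in> pos_cone"
proof -
  from pos_root[OF assms] obtain a b i k where *: "a \<in> {1, -1}" "b \<in> {1, -1}" "1 \<le> i" "i < k" "k \<le> l"
    "\<beta> = a *\<^sub>R e i + b *\<^sub>R e k" by (rule root_E)
  have "0 < a * (real l - real i) + b * (real l - real k)"
    using assms * by (simp add: pos_roots_def inner_add_left coord_rho)
  then have "a = 1" using * by auto
  then show ?thesis using * pos_cone_sum[of i k] pos_cone_diff[of i k] by auto
qed

lemma pos_dominant_nonneg:
  assumes "\<And>i. i \<in> {1..l} \<Longrightarrow> 0 \<le> simple i \<bullet> \<theta>" "\<beta> \<in> pos_roots"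
  shows "0 \<le> \<beta> \<bullet> \<theta>"
proof -
  obtain c :: "nat \<Rightarrow> nat" where "\<beta> = (\<Sum>i=1..l. real (c i) *\<^sub>R simple i)"
    using pos_root_in_cone[OF assms(2)] unfolding pos_cone_def by blast
  then have "\<beta> \<bullet> \<theta> = (\<Sum>i=1..l. real (c i) * (simple i \<bullet> \<theta>))" by (simp add: inner_sum_left)
  also have "\<dots> \<ge> 0" by (intro sum_nonneg) (use assms(1) in auto)
  finally show ?thesis .
qed

text \<open>
  The coordinates of \<open>w \<rho>\<close> are \<open>l - 1, \<dots>, 1, 0\<close> up to order and signs. They are integers that
  drop by at least \<open>1\<close> at each place; together with the bound \<open>l - 1\<close> on the first one and the
  inequality for \<open>\<alpha>\<^sub>l\<close> this leaves only \<open>w \<rho> = \<rho>\<close>. Since \<open>\<rho>\<^sub>l = 0\<close>, the sign at the last place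
  is not seen by \<open>\<rho>\<close>; it is \<open>1\<close> because the number of signs is even.
\<close>

lemma dominant_rho_imp_id:
  assumes "w \<in> signed_perms" "\<And>i. i \<in> {1..l} \<Longrightarrow> 0 < simple i \<bullet> w rho"
  shows "w = id"
proof -
  from assms(1) obtain \<sigma> \<epsilon> where s: "\<sigma> permutes {1..l}" "\<And>i. i \<in> {1..l} \<Longrightarrow> \<epsilon> i \<in> {1, -1}"
     "(\<Prod>i=1..l. \<epsilon> i) = 1" "\<And>i x. i \<in> {1..l} \<Longrightarrow> e i \<bullet> w x = \<epsilon> i * (e (\<sigma> i) \<bullet> x)"
    by (rule signed_perm_E) blast
  have in_s: "\<sigma> i \<in> {1..l}" if "i \<in> {1..l}" for i using s(1) that by (metis permutes_in_image)
  define v where "v i = \<epsilon> i * (real l - real (\<sigma> i))" for i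
  have v: "e i \<bullet> w rho = v i" if "i \<in> {1..l}" for i
    using s(4)[OF that] coord_rho[OF in_s[OF that]] by (simp add: v_def)
  have vint: "v i \<in> \<int>" and vle: "v i \<le> real l - 1" if "i \<in> {1..l}" for i
    using s(2)[OF that] in_s[OF that] l_ge by (auto simp: v_def)
  have ge1: "1 \<le> simple i \<bullet> w rho" if i: "i \<in> {1..l}" for i
  proof -
    have "simple i \<bullet> w rho \<in> \<int>" using simple_root_root[OF i] by (rule root_inner_Ints) (simp add: v vint)
    then show ?thesis using assms(2)[OF i] by (auto elim!: Ints_cases)
  qed
  have step: "v (i + 1) + 1 \<le> v i" if "1 \<le> i" "i < l" for i
    using ge1[of i] that v[of i] v[of "i + 1"] by (auto simp: simple_inner)
  have last: "1 \<le> v (l - 1) + v l"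
    using ge1[of l] v[of l] v[of "l - 1"] l_ge by (auto simp: simple_inner)
  have up: "v i \<le> real l - real i" if "1 \<le> i" "i \<le> l" for i
    using that
  proof (induction i rule: dec_induct)
    case base
    then show ?case using vle[of 1] l_ge by simp
  next
    case (step n)
    then show ?case using \<open>\<And>i. 1 \<le> i \<Longrightarrow> i < l \<Longrightarrow> v (i + 1) + 1 \<le> v i\<close>[of n] by auto
  qed
  have "v (l - 1) \<ge> 1" "v l \<ge> 0" 
  proof -
    have "v l + 1 \<le> v (l - 1)" using step[of "l - 1"] l_ge by simp
    moreover have "v (l - 1) \<le> 1" using up[of "l - 1"] l_ge by (simp add: of_nat_diff)
    ultimately show "v l \<ge> 0" "v (l - 1) \<ge> 1"
      using last by linarith+
  qed
  have low: "real l - real i \<le> v i" if "1 \<le> i" "i \<le> l" for i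
    using that(2,1)
  proof (induction i rule: inc_induct)
    case base
    then show ?case using \<open>v l \<ge> 0\<close> by simp
  next
    case (step n)
    then show ?case using \<open>\<And>i. 1 \<le> i \<Longrightarrow> i < l \<Longrightarrow> v (i + 1) + 1 \<le> v i\<close>[of n] by auto
  qed
  have eq: "\<epsilon> i * (real l - real (\<sigma> i)) = real l - real i" if "i \<in> {1..l}" for i
    using low[of i] up[of i] that by (auto simp: v_def)
  have sig: "\<sigma> i = i" if i: "i \<in> {1..l}" for i
    using eq[OF i] s(2)[OF i] in_s[OF i] i by auto
  have eps: "\<epsilon> i = 1" if i: "i \<in> {1..<l}" for i
    using eq[of i] s(2)[of i] sig[of i] i by auto
  have "(\<Prod>i=1..l. \<epsilon> i) = (\<Prod>i\<in>{l}. \<epsilon> i)"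
    by (rule prod.mono_neutral_right) (use eps l_ge in auto)
  then have "\<epsilon> l = 1" using s(3) by simp
  then have eps': "\<epsilon> i = 1" if "i \<in> {1..l}" for i using eps[of i] that by (cases "i = l") auto
  show ?thesis
  proof (rule ext, rule coord_eqI)
    fix x i assume i: "i \<in> {1..l}"
    show "e i \<bullet> w x = e i \<bullet> id x" using s(4)[OF i] eps'[OF i] sig[OF i] by simp
  qed
qed

text \<open>
  Apply the preceding lemma to the inverse, which is the adjoint of \<open>w\<close>.
\<close>

lemma simple_pos_imp_id:
  assumes "w \<in> signed_perms" "\<And>i. i \<in> {1..l} \<Longrightarrow> w (simple i) \<in> pos_roots"
  shows "w = id"
proof -
  from assms(1) obtain v where v: "v \<in> signed_perms" "\<And>x. v (w x) = x" "\<And>x. w (v x) = x" by (rule signed_perm_inverse) blast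
  have "v = id"
  proof (rule dominant_rho_imp_id [OF v(1)])
    fix i assume "i \<in> {1..l}"
    then have "0 < w (simple i) \<bullet> rho" using assms(2) by (simp add: pos_roots_def)
    also have "\<dots> = w (simple i) \<bullet> w (v rho)" by (simp add: v)
    finally show "0 < simple i \<bullet> v rho" by (simp add: signed_perm_inner[OF assms(1)])
  qed
  with v show ?thesis by auto
qed

definition inversions :: "('a \<Rightarrow> 'a) \<Rightarrow> 'a set" where
  "inversions w = {\<beta> \<in> pos_roots. w \<beta> \<notin> pos_roots}"

lemma finite_inversions: "finite (inversions w)"
  using finite_pos by (simp add: inversions_def)

lemma inversions_left:
  assumes "w \<in> signed_perms" "i \<in> {1..l}"
  shows "card (inversions (srefl i \<circ> w)) \<le> Suc (card (inversions w))"
proof -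
  have "inversions (srefl i \<circ> w) \<subseteq> inversions w \<union> (inv w ` {simple i})"
  proof
    fix \<beta> assume b: "\<beta> \<in> inversions (srefl i \<circ> w)"
    show "\<beta> \<in> inversions w \<union> (inv w ` {simple i})"
    proof (cases "w \<beta> = simple i")
      case True
      then have "\<beta> = inv w (simple i)" using inv_f_f[OF signed_perm_inj[OF assms(1)]] by metis
      then show ?thesis by simp
    next
      case False
      then show ?thesis using b srefl_pos[OF assms(2), of "w \<beta>"] by (auto simp: inversions_def)
    qed
  qed
  then have "card (inversions (srefl i \<circ> w)) \<le> card (inversions w \<union> (inv w ` {simple i}))"
    using finite_inversions by (intro card_mono) auto
  also have "\<dots> \<le> card (inversions w) + card (inv w ` {simple i})" by (rule card_Un_le)
  finally show ?thesis by simp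
qed

text \<open>
  The reflection \<open>s\<^sub>i\<close> permutes the positive roots other than \<open>\<alpha>\<^sub>i\<close>, so the inversions of the
  two elements correspond to each other apart from \<open>\<alpha>\<^sub>i\<close> itself.
\<close>

lemma inversions_right:
  assumes "w \<in> signed_perms" "i \<in> {1..l}" "w (simple i) \<notin> pos_roots"
  shows "card (inversions w) = Suc (card (inversions (w \<circ> srefl i)))"
proof -
  have lin: "w (- x) = - w x" for x using signed_perm_linear[OF assms(1)] by (simp add: linear_neg)
  have inv: "srefl i (srefl i x) = x" for x using assms(2) by (intro refl_refl simple_root_root)
  have nsr: "srefl i \<beta> \<noteq> simple i" if "\<beta> \<in> pos_roots" for \<beta>
    using inv[of \<beta>] srefl_simple[OF assms(2)] neg_not_pos[OF simple_pos[OF assms(2)]] that by auto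
  have mem: "simple i \<in> inversions w" using assms simple_pos by (simp add: inversions_def)
  have "- (w (simple i)) \<in> pos_roots"
    by (rule neg_pos [OF signed_perm_root [OF assms(1) simple_root_root [OF assms(2)]] assms(3)])
  then have nmem: "simple i \<notin> inversions (w \<circ> srefl i)"
    using assms(2) by (simp add: inversions_def srefl_simple lin)
  have "inversions (w \<circ> srefl i) = srefl i ` (inversions w - {simple i})"
  proof (intro set_eqI iffI)
    fix \<beta> assume b: "\<beta> \<in> inversions (w \<circ> srefl i)"
    then have "\<beta> \<in> pos_roots" "\<beta> \<noteq> simple i" "w (srefl i \<beta>) \<notin> pos_roots" using nmem by (auto simp: inversions_def)
    then have "srefl i \<beta> \<in> inversions w - {simple i}"
      using srefl_pos[OF assms(2)] nsr by (auto simp: inversions_def)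
    then show "\<beta> \<in> srefl i ` (inversions w - {simple i})" using inv by (metis imageI)
  next
    fix \<beta> assume "\<beta> \<in> srefl i ` (inversions w - {simple i})"
    then show "\<beta> \<in> inversions (w \<circ> srefl i)"
      using srefl_pos[OF assms(2)] inv by (auto simp: inversions_def)
  qed
  then have "card (inversions (w \<circ> srefl i)) = card (inversions w - {simple i})"
    using signed_perm_inj[OF srefl_signed_perm[OF assms(2)]] by (simp add: card_image inj_on_subset)
  then show ?thesis using mem finite_inversions by (metis card_Suc_Diff1)
qed

lemma inversions_le_length:
  "w \<in> products (srefl ` {1..l}) n \<Longrightarrow> w \<in> signed_perms \<and> card (inversions w) \<le> n"
proof (induction n arbitrary: w)
  case 0
  then have "w = id" by (simp add: products_0)
  with signed_perm_id have "w \<in> signed_perms" by (simp only:)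
  moreover have "inversions w = {}" using \<open>w = id\<close> by (auto simp: inversions_def)
  ultimately show ?case by simp
next
  case (Suc n)
  then obtain i v where iv: "w = srefl i \<circ> v" "i \<in> {1..l}" "v \<in> products (srefl ` {1..l}) n"
    unfolding products_Suc by blast
  with Suc.IH have v: "v \<in> signed_perms" "card (inversions v) \<le> n" by auto
  have "card (inversions w) \<le> Suc (card (inversions v))"
    unfolding iv(1) by (rule inversions_left[OF v(1) iv(2)])
  moreover have "w \<in> signed_perms" unfolding iv(1) by (rule signed_perm_comp[OF srefl_signed_perm[OF iv(2)] v(1)])
  ultimately show ?case using v(2) by linarith
qed

text \<open>
  While \<open>w \<noteq> 1\<close>, some simple root \<open>\<alpha>\<^sub>i\<close> is made negative. It is orthogonal to \<open>\<theta>\<close>, for otherwise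
  its image would pair positively with the dominant vector \<open>w \<theta> = \<theta>\<close>. Hence \<open>s\<^sub>i\<close> fixes \<open>\<theta>\<close> as
  well and \<open>w s\<^sub>i\<close> has one inversion less. The case \<open>\<theta> = 0\<close> yields reduced words in the whole
  group.
\<close>

lemma stabilizer_product:
  assumes "w \<in> signed_perms" "w \<theta> = \<theta>" "\<And>i. i \<in> {1..l} \<Longrightarrow> 0 \<le> simple i \<bullet> \<theta>"
  shows "w \<in> products (srefl ` {i \<in> {1..l}. simple i \<bullet> \<theta> = 0}) (card (inversions w))"
  using assms(1,2)
proof (induction "card (inversions w)" arbitrary: w)
  case 0
  then have "inversions w = {}" using finite_inversions by simp
  then have "w (simple i) \<in> pos_roots" if "i \<in> {1..l}" for i using simple_pos[OF that] by (auto simp: inversions_def)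
  then have "w = id" by (intro simple_pos_imp_id 0)
  moreover have "card (inversions w) = 0" using 0 by simp
  ultimately show ?case unfolding products_def by (auto intro!: exI [of _ "[]"])
next
  case (Suc n)
  have "w \<noteq> id" using Suc(2) by (auto simp: inversions_def)
  then obtain i where i: "i \<in> {1..l}" "w (simple i) \<notin> pos_roots" using simple_pos_imp_id Suc(3) by blast
  have inv: "srefl i (srefl i x) = x" for x using i(1) by (intro refl_refl simple_root_root)
  have "simple i \<bullet> \<theta> = 0"
  proof (rule ccontr)
    assume "simple i \<bullet> \<theta> \<noteq> 0"
    then have "0 < simple i \<bullet> \<theta>" using assms(3)[OF i(1)] by simp
    also have "\<dots> = w (simple i) \<bullet> \<theta>" using signed_perm_inner[OF Suc(3), of "simple i" \<theta>] Suc(4) by simp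
    finally have *: "0 < w (simple i) \<bullet> \<theta>" .
    have "- w (simple i) \<in> pos_roots"
      by (rule neg_pos [OF signed_perm_root [OF Suc(3) simple_root_root [OF i(1)]] i(2)])
    from pos_dominant_nonneg[OF assms(3) this] show False using * by simp
  qed
  then have "srefl i \<theta> = \<theta>" using i by (simp add: refl_root simple_root_root)
  then have "(w \<circ> srefl i) \<theta> = \<theta>" using Suc by simp
  moreover have c: "card (inversions w) = Suc (card (inversions (w \<circ> srefl i)))"
    by (rule inversions_right [OF Suc(3) i])
  moreover have "w \<circ> srefl i \<in> signed_perms" using signed_perm_comp srefl_signed_perm Suc i by blast
  ultimately have "w \<circ> srefl i \<in> products (srefl ` {i \<in> {1..l}. simple i \<bullet> \<theta> = 0}) (card (inversions (w \<circ> srefl i)))"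
    using Suc(1)[of "w \<circ> srefl i"] Suc(2) by simp
  from products_snoc [OF this, of "srefl i"]
  have "(w \<circ> srefl i) \<circ> srefl i \<in> products (srefl ` {i \<in> {1..l}. simple i \<bullet> \<theta> = 0}) (card (inversions w))"
    using i \<open>simple i \<bullet> \<theta> = 0\<close> c by auto
  moreover have "(w \<circ> srefl i) \<circ> srefl i = w" using inv by auto
  ultimately show ?case by simp
qed

lemma weyl_length_eq: assumes "w \<in> signed_perms" shows "weyl_length l e w = card (inversions w)"
  unfolding weyl_length_def
proof (rule Least_equality)
  have "w \<in> products (srefl ` {i \<in> {1..l}. simple i \<bullet> 0 = 0}) (card (inversions w))"
    by (rule stabilizer_product [OF assms]) (auto intro: linear_0 signed_perm_linear assms)
  moreover have "{i \<in> {1..l}. simple i \<bullet> 0 = 0} = {1..l}" by auto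
  ultimately show "w \<in> products (srefl ` {1..l}) (card (inversions w))" by (simp only:)
qed (use inversions_le_length in blast)

lemma gen_stabilizer:
  assumes "\<And>i. i \<in> {1..l} \<Longrightarrow> 0 \<le> simple i \<bullet> \<theta>"
  shows "gen (srefl ` {i \<in> {1..l}. simple i \<bullet> \<theta> = 0}) = {w \<in> signed_perms. w \<theta> = \<theta>}"
proof (intro equalityI subsetI)
  fix w assume "w \<in> gen (srefl ` {i \<in> {1..l}. simple i \<bullet> \<theta> = 0})"
  then obtain n where "w \<in> products (srefl ` {i \<in> {1..l}. simple i \<bullet> \<theta> = 0}) n" unfolding gen_def by blast
  then show "w \<in> {w \<in> signed_perms. w \<theta> = \<theta>}"
  proof (induction n arbitrary: w)
    case 0
    then have "w = id" by (simp add: products_0)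
    with signed_perm_id have "w \<in> signed_perms" by (simp only:)
    moreover have "w \<theta> = \<theta>" using \<open>w = id\<close> by simp
    ultimately show ?case by blast
  next
    case (Suc n)
    then obtain i v where iv: "w = srefl i \<circ> v" "i \<in> {1..l}" "simple i \<bullet> \<theta> = 0" "v \<in> signed_perms" "v \<theta> = \<theta>"
      unfolding products_Suc by blast
    then have "w \<theta> = \<theta>" by (simp add: refl_root simple_root_root)
    moreover have "w \<in> signed_perms" unfolding iv(1) by (rule signed_perm_comp[OF srefl_signed_perm[OF iv(2)] iv(4)])
    ultimately show ?case by blast
  qed
next
  fix w assume "w \<in> {w \<in> signed_perms. w \<theta> = \<theta>}"
  then show "w \<in> gen (srefl ` {i \<in> {1..l}. simple i \<bullet> \<theta> = 0})"
    using stabilizer_product[OF _ _ assms] unfolding gen_def by blast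
qed

lemma weyl_eq: "weyl l e = signed_perms"
proof (intro equalityI subsetI)
  fix w assume "w \<in> weyl l e"
  then obtain n where "w \<in> products (root_refl ` roots) n" unfolding weyl_def gen_def by blast
  then show "w \<in> signed_perms"
  proof (induction n arbitrary: w)
    case 0
    then have "w = id" by (simp add: products_0)
    with signed_perm_id have "w \<in> signed_perms" by (simp only:)
    then show ?case .
  next
    case (Suc n)
    then show ?case unfolding products_Suc using signed_perm_comp[OF refl_signed_perm] by blast
  qed
next
  fix w assume "w \<in> signed_perms"
  moreover have "w 0 = 0" by (rule linear_0, rule signed_perm_linear) fact
  ultimately have "w \<in> gen (srefl ` {i \<in> {1..l}. simple i \<bullet> 0 = 0})" by (subst gen_stabilizer) auto
  moreover have "{i \<in> {1..l}. simple i \<bullet> 0 = 0} = {1..l}" by auto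
  ultimately have "w \<in> gen (srefl ` {1..l})" by (simp only:)
  moreover have "srefl ` {1..l} \<subseteq> root_refl ` roots" using simple_root_root by auto
  ultimately show "w \<in> weyl l e" unfolding weyl_def using gen_mono by blast
qed

text \<open>
  An element that fixes \<open>\<theta>\<close> can only invert positive roots orthogonal to \<open>\<theta>\<close>. The condition on
  \<open>w \<rho>\<close> says that \<open>w\<close> negates the height of each of these, so it inverts all of them and has
  maximal length. Any other \<open>v\<close> of maximal length inverts the same roots, and then \<open>w v\<close> keeps
  all positive roots positive.
\<close>

lemma longest_stabilizer:
  assumes dom: "\<And>i. i \<in> {1..l} \<Longrightarrow> 0 \<le> simple i \<bullet> \<theta>"
    and w: "w \<in> signed_perms" "\<And>x. w (w x) = x" "w \<theta> = \<theta>" "w rho = - rho + c *\<^sub>R \<theta>"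
  shows "longest l e {w \<in> signed_perms. w \<theta> = \<theta>} = w"
proof -
  let ?G = "{w \<in> signed_perms. w \<theta> = \<theta>}"
  define P0 where "P0 = {\<beta> \<in> pos_roots. \<beta> \<bullet> \<theta> = 0}"
  have ge: "0 \<le> \<beta> \<bullet> \<theta>" if "\<beta> \<in> pos_roots" for \<beta>
    by (rule pos_dominant_nonneg [OF dom that])
  have stay: "v \<beta> \<in> pos_roots" "v \<beta> \<bullet> \<theta> > 0" if "v \<in> ?G" "\<beta> \<in> pos_roots" "\<beta> \<notin> P0" for v \<beta>
  proof -
    have "0 < \<beta> \<bullet> \<theta>" using ge that by (force simp: P0_def)
    also have "\<dots> = v \<beta> \<bullet> \<theta>" using signed_perm_inner[of v \<beta> \<theta>] that by simp
    finally show gt: "v \<beta> \<bullet> \<theta> > 0" .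
    show "v \<beta> \<in> pos_roots"
    proof (rule ccontr)
      assume "v \<beta> \<notin> pos_roots"
      moreover have "v \<beta> \<in> roots" using that signed_perm_root[OF _ pos_root] by auto
      ultimately have "- v \<beta> \<in> pos_roots" using neg_pos by blast
      from ge[OF this] gt show False by simp
    qed
  qed
  have sub: "inversions v \<subseteq> P0" if "v \<in> ?G" for v
    using stay[OF that] by (auto simp: inversions_def)
  have flip: "w \<beta> \<bullet> rho = - (\<beta> \<bullet> rho)" if "\<beta> \<bullet> \<theta> = 0" for \<beta>
  proof -
    have "w \<beta> \<bullet> rho = w \<beta> \<bullet> w (w rho)" by (simp only: w(2))
    also have "\<dots> = \<beta> \<bullet> w rho" by (rule signed_perm_inner [OF w(1)])
    finally show ?thesis using that by (simp add: w(4) inner_diff_right)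
  qed
  have invw: "inversions w = P0"
    using sub[of w] w flip by (auto simp: P0_def inversions_def pos_roots_def)
  have finP: "finite P0" using finite_pos by (simp add: P0_def)
  have len: "weyl_length l e v = card (inversions v)" if "v \<in> ?G" for v
    using weyl_length_eq that by simp
  show ?thesis
    unfolding longest_def
  proof (rule the_equality)
    show "w \<in> ?G \<and> (\<forall>v\<in>?G. weyl_length l e v \<le> weyl_length l e w)"
      using w len[of w] len sub card_mono[OF finP] by (auto simp: invw)
  next
    fix v assume v: "v \<in> ?G \<and> (\<forall>u\<in>?G. weyl_length l e u \<le> weyl_length l e v)"
    then have vG: "v \<in> signed_perms" "v \<theta> = \<theta>" and "weyl_length l e w \<le> weyl_length l e v" using w by auto
    then have "card P0 \<le> card (inversions v)" using len w v by (simp add: invw)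
    then have iv: "inversions v = P0" using sub v finP by (intro card_seteq) auto
    have "w \<circ> v = id"
    proof (rule simple_pos_imp_id)
      show "w \<circ> v \<in> signed_perms" using signed_perm_comp w vG by blast
      fix i assume i: "i \<in> {1..l}"
      show "(w \<circ> v) (simple i) \<in> pos_roots"
      proof (cases "simple i \<in> P0")
        case True
        then have "v (simple i) \<notin> pos_roots" using iv by (auto simp: inversions_def)
        moreover have vr: "v (simple i) \<in> roots" by (rule signed_perm_root [OF vG(1) simple_root_root [OF i]])
        ultimately have neg: "v (simple i) \<bullet> rho < 0" using not_pos by simp
        have "v (simple i) \<bullet> \<theta> = 0" using signed_perm_inner[OF vG(1), of "simple i" \<theta>] vG True by (simp add: P0_def)
        then have "w (v (simple i)) \<bullet> rho > 0" using flip neg by simp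
        then show ?thesis using signed_perm_root[OF w(1) vr] by (simp add: pos_roots_def)
      next
        case False
        note p = stay[of v "simple i", OF _ simple_pos[OF i] False]
        have "v (simple i) \<in> pos_roots" "v (simple i) \<notin> P0" using p vG by (auto simp: P0_def)
        then show ?thesis using stay[of w "v (simple i)"] w by simp
      qed
    qed
    then show "v = w" using w(2) by (metis comp_apply eq_id_iff ext)
  qed
qed

end

section \<open>The highest root, the alcove and the coweight lattice\<close>

lemma coset_eq_iff:
  fixes L :: "'a::ab_group_add set"
  assumes "0 \<in> L" "\<And>x y. x \<in> L \<Longrightarrow> y \<in> L \<Longrightarrow> x - y \<in> L"
  shows "coset L x = coset L y \<longleftrightarrow> x - y \<in> L"
proof
  assume "coset L x = coset L y"
  moreover have "x + 0 \<in> coset L x" unfolding coset_def using assms(1) by blast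
  ultimately have "x \<in> coset L y" by simp
  then show "x - y \<in> L" unfolding coset_def by auto
next
  have neg: "- u \<in> L" if "u \<in> L" for u using assms(2)[OF assms(1) that] by simp
  have add: "u + v \<in> L" if "u \<in> L" "v \<in> L" for u v
    using assms(2)[OF that(1) neg[OF that(2)]] by simp
  have sub: "coset L x \<subseteq> coset L y" if d: "x - y \<in> L" for x y
  proof
    fix u assume "u \<in> coset L x"
    then obtain z where z: "z \<in> L" "u = x + z" unfolding coset_def by blast
    then have "u = y + ((x - y) + z)" by simp
    moreover have "(x - y) + z \<in> L" using add d z by blast
    ultimately show "u \<in> coset L y" unfolding coset_def by blast
  qed
  assume "x - y \<in> L"
  moreover from neg[OF this] have "y - x \<in> L" by simp
  ultimately show "coset L x = coset L y" using sub by blast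
qed

context type_D
begin

text \<open>
  That \<open>e\<^sub>1 + e\<^sub>2\<close> dominates every root is a case distinction on signs. Two greatest elements
  would differ by an element of the cone in both directions, and comparing heights makes all
  coefficients vanish.
\<close>

lemma highest_root_eq: "highest_root l e = e 1 + e 2"
  unfolding highest_root_def
proof (rule the_equality)
  have Q: "x \<in> pos_cone \<longleftrightarrow> (\<exists>c::nat \<Rightarrow> nat. x = (\<Sum>i=1..l. real (c i) *\<^sub>R simple i))" for x
    unfolding pos_cone_def by auto
  have "e 1 + e 2 - \<gamma> \<in> pos_cone" if \<gamma>: "\<gamma> \<in> roots" for \<gamma>
  proof -
    from \<gamma> obtain a b i k where *: "a \<in> {1, -1}" "b \<in> {1, -1}" "1 \<le> i" "i < k" "k \<le> l"
      "\<gamma> = a *\<^sub>R e i + b *\<^sub>R e k" by (rule root_E)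
    have d1: "e 1 - e i \<in> pos_cone" and d2: "e 2 - e k \<in> pos_cone" using * by (auto intro: pos_cone_diff)
    have twice: "e j + e j \<in> pos_cone" if "1 \<le> j" "j < l" for j
    proof -
      have "(e j - e l) + (e j + e l) \<in> pos_cone" using that by (intro pos_cone_add pos_cone_diff pos_cone_sum) auto
      then show ?thesis by (simp add: algebra_simps)
    qed
    have s1: "e 1 + e i \<in> pos_cone" using * twice[of 1] l_ge pos_cone_sum[of 1 i] by (cases "i = 1") auto
    have s2: "e 2 + e k \<in> pos_cone" using * twice[of 2] l_ge pos_cone_sum[of 2 k] by (cases "k = 2") auto
    have "e 1 - a *\<^sub>R e i \<in> pos_cone" "e 2 - b *\<^sub>R e k \<in> pos_cone" using *(1,2) d1 d2 s1 s2 by auto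
    then have "(e 1 - a *\<^sub>R e i) + (e 2 - b *\<^sub>R e k) \<in> pos_cone" by (rule pos_cone_add)
    then show ?thesis by (simp add: *(6) algebra_simps)
  qed
  then show h: "e 1 + e 2 \<in> roots \<and> (\<forall>\<gamma>\<in>roots. \<exists>c::nat \<Rightarrow> nat. e 1 + e 2 - \<gamma> = (\<Sum>i=1..l. real (c i) *\<^sub>R simple i))"
    unfolding Q using l_ge by (auto intro: root_I)
  fix \<beta> assume b: "\<beta> \<in> roots \<and> (\<forall>\<gamma>\<in>roots. \<exists>c::nat \<Rightarrow> nat. \<beta> - \<gamma> = (\<Sum>i=1..l. real (c i) *\<^sub>R simple i))"
  obtain c :: "nat \<Rightarrow> nat" where c: "\<beta> - (e 1 + e 2) = (\<Sum>i=1..l. real (c i) *\<^sub>R simple i)" using b h by blast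
  obtain d :: "nat \<Rightarrow> nat" where d: "e 1 + e 2 - \<beta> = (\<Sum>i=1..l. real (d i) *\<^sub>R simple i)" using b h by blast
  have ht: "(\<Sum>i=1..l. real (c i) *\<^sub>R simple i) \<bullet> rho = real (\<Sum>i=1..l. c i)" for c :: "nat \<Rightarrow> nat"
    by (simp add: inner_sum_left simple_rho)
  have "real (\<Sum>i=1..l. c i) = - real (\<Sum>i=1..l. d i)"
    unfolding ht[symmetric] c[symmetric] d[symmetric] by (simp add: inner_diff_left inner_add_left)
  then have "(\<Sum>i=1..l. c i) = 0" by linarith
  then have "\<forall>i\<in>{1..l}. c i = 0" by simp
  then show "\<beta> = e 1 + e 2" using c by simp
qed

lemma alcove_iff:
  "x \<in> alcove l e \<longleftrightarrow> (\<forall>i\<in>{1..<l}. e (i + 1) \<bullet> x < e i \<bullet> x) \<and> 0 < e (l - 1) \<bullet> x + e l \<bullet> x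
     \<and> e 1 \<bullet> x + e 2 \<bullet> x < 1"
proof -
  have "{1..l} = insert l {1..<l}" using l_ge by auto
  then show ?thesis unfolding alcove_def highest_root_eq by (auto simp: simple_inner inner_add_left)
qed

abbreviation Z :: "'a set" where "Z \<equiv> coweight_lattice l e"

definition same_parity :: "(nat \<Rightarrow> int) \<Rightarrow> bool" where
  "same_parity a \<longleftrightarrow> (\<forall>i\<in>{1..l}. even (a i) = even (a 1))"

lemma same_parityD: "same_parity a \<Longrightarrow> i \<in> {1..l} \<Longrightarrow> even (a i) = even (a 1)"
  unfolding same_parity_def by (rule bspec)

text \<open>
  Integrality on \<open>e\<^sub>i + e\<^sub>k\<close> and \<open>e\<^sub>i - e\<^sub>k\<close> makes each \<open>2 x\<^sub>i\<close> and each difference \<open>x\<^sub>i - x\<^sub>k\<close>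
  integral, so the doubled coordinates have one parity.
\<close>

lemma lattice_iff:
  "x \<in> Z \<longleftrightarrow> (\<exists>a. same_parity a \<and> (\<forall>i\<in>{1..l}. e i \<bullet> x = of_int (a i) / 2))"
proof
  assume x: "x \<in> Z"
  have ints: "e i \<bullet> x + e k \<bullet> x \<in> \<int>" "e i \<bullet> x - e k \<bullet> x \<in> \<int>" if "i \<in> {1..l}" "k \<in> {1..l}" "i \<noteq> k" for i k
    using x root_I[OF that] unfolding coweight_lattice_def by (auto simp: inner_add_left inner_diff_left)
  have int2: "2 * (e i \<bullet> x) \<in> \<int>" if i: "i \<in> {1..l}" for i
  proof -
    obtain k where k: "k \<in> {1..l}" "i \<noteq> k"
      using that[of 1] that[of 2] l_ge by (cases "i = 1") auto
    have "(e i \<bullet> x + e k \<bullet> x) + (e i \<bullet> x - e k \<bullet> x) \<in> \<int>"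
      by (rule Ints_add [OF ints [OF i k]])
    then show ?thesis by simp
  qed
  define a where "a i = \<lfloor>2 * (e i \<bullet> x)\<rfloor>" for i
  have a: "of_int (a i) = 2 * (e i \<bullet> x)" if "i \<in> {1..l}" for i
    using int2[OF that] by (simp add: a_def)
  have "even (a i) = even (a 1)" if i: "i \<in> {1..l}" for i
  proof (cases "i = 1")
    case False
    then obtain n where "e i \<bullet> x - e 1 \<bullet> x = of_int n"
      using ints(2)[of i 1] i l_ge by (auto elim!: Ints_cases)
    then have "real_of_int (a i) = real_of_int (a 1 + 2 * n)" using a[OF i] a[of 1] l_ge by simp
    then have "a i = a 1 + 2 * n" by (simp only: of_int_eq_iff)
    then show ?thesis by simp
  qed simp
  then have "same_parity a" unfolding same_parity_def by blast
  moreover have "e i \<bullet> x = of_int (a i) / 2" if "i \<in> {1..l}" for i using a[OF that] by simp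
  ultimately show "\<exists>a. same_parity a \<and> (\<forall>i\<in>{1..l}. e i \<bullet> x = of_int (a i) / 2)" by blast
next
  assume "\<exists>a. same_parity a \<and> (\<forall>i\<in>{1..l}. e i \<bullet> x = of_int (a i) / 2)"
  then obtain a where a: "same_parity a" "\<And>i. i \<in> {1..l} \<Longrightarrow> e i \<bullet> x = of_int (a i) / 2" by blast
  show "x \<in> Z"
    unfolding coweight_lattice_def
  proof safe
    fix \<beta> assume "\<beta> \<in> roots"
    then obtain u v i k where *: "u \<in> {1, -1}" "v \<in> {1, -1}" "1 \<le> i" "i < k" "k \<le> l"
      "\<beta> = u *\<^sub>R e i + v *\<^sub>R e k" by (rule root_E)
    have "even (a i) = even (a k)" using a(1) * unfolding same_parity_def
      by (metis atLeastAtMost_iff le_trans less_imp_le)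
    then obtain m n where "a i + a k = 2 * m" "a i - a k = 2 * n"
      by (metis even_add even_diff evenE)
    then have "real_of_int (a i) + real_of_int (a k) = 2 * of_int m"
      "real_of_int (a i) - real_of_int (a k) = 2 * of_int n"
      by (metis of_int_add of_int_mult of_int_numeral, metis of_int_diff of_int_mult of_int_numeral)
    then have "e i \<bullet> x + e k \<bullet> x = of_int m" "e i \<bullet> x - e k \<bullet> x = of_int n"
      using a(2)[of i] a(2)[of k] * by auto
    then have "\<beta> \<bullet> x \<in> {of_int m, of_int n, - of_int m, - of_int n}" using *(1,2,6) by (auto simp: inner_add_left)
    then show "\<beta> \<bullet> x \<in> \<int>" by auto
  qed
qed

lemma lattice_0: "0 \<in> Z" and lattice_diff: "x \<in> Z \<Longrightarrow> y \<in> Z \<Longrightarrow> x - y \<in> Z"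
  by (auto simp: coweight_lattice_def inner_diff_right)

lemma lattice_signed_perm: assumes "w \<in> signed_perms" "x \<in> Z" shows "w x \<in> Z"
proof -
  from assms(1) obtain v where v: "v \<in> signed_perms" "\<And>x. v (w x) = x" by (rule signed_perm_inverse) blast
  have "\<beta> \<bullet> w x \<in> \<int>" if b: "\<beta> \<in> roots" for \<beta>
  proof -
    have "v \<beta> \<bullet> v (w x) = \<beta> \<bullet> w x" by (rule signed_perm_inner [OF v(1)])
    then have "\<beta> \<bullet> w x = v \<beta> \<bullet> x" by (simp add: v(2))
    then show ?thesis using signed_perm_root[OF v(1) b] assms(2) by (simp add: coweight_lattice_def)
  qed
  then show ?thesis by (simp add: coweight_lattice_def)
qed

lemma image_coset:
  assumes "w \<in> signed_perms" "\<And>v z. v \<in> signed_perms \<Longrightarrow> z \<in> L \<Longrightarrow> v z \<in> L"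
  shows "w ` coset L x = coset L (w x)"
proof -
  from assms(1) obtain v where v: "v \<in> signed_perms" "\<And>x. v (w x) = x" "\<And>x. w (v x) = x" by (rule signed_perm_inverse) blast
  have add: "w (x + z) = w x + w z" for x z using signed_perm_linear[OF assms(1)] by (rule linear_add)
  show ?thesis
  proof (intro equalityI subsetI)
    fix t assume "t \<in> w ` coset L x"
    then obtain z where z: "z \<in> L" "t = w x + w z" unfolding coset_def using add by auto
    then show "t \<in> coset L (w x)" unfolding coset_def using assms(2)[OF assms(1)] by blast
  next
    fix t assume "t \<in> coset L (w x)"
    then obtain z where z: "z \<in> L" "t = w x + z" unfolding coset_def by blast
    then have "t = w (x + v z)" using add v by simp
    moreover have "x + v z \<in> coset L x" unfolding coset_def using assms(2)[OF v(1) z(1)] by blast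
    ultimately show "t \<in> w ` coset L x" by blast
  qed
qed

text \<open>
  The coweight \<open>h\<close> turns \<open>w\<close> into an affine symmetry of the alcove; translations by coweights
  are invisible in the quotient.
\<close>

lemma alcove_stabilizer_I:
  assumes "w \<in> signed_perms" "h \<in> Z" "\<And>x. x \<in> alcove l e \<longleftrightarrow> w x + h \<in> alcove l e"
  shows "w \<in> alcove_stabilizer l e"
proof -
  from assms(1) obtain v where v: "v \<in> signed_perms" "\<And>x. w (v x) = x" by (rule signed_perm_inverse) blast
  have im: "w ` coset Z x = coset Z (w x + h)" for x
  proof -
    have "w ` coset Z x = coset Z (w x)" using assms(1) lattice_signed_perm by (rule image_coset)
    also have "\<dots> = coset Z (w x + h)"
      using lattice_diff[OF lattice_0 assms(2)] by (subst coset_eq_iff) (auto intro: lattice_0 lattice_diff)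
    finally show ?thesis .
  qed
  have "(\<lambda>x. w x + h) ` alcove l e = alcove l e"
  proof (intro equalityI subsetI)
    fix y assume y: "y \<in> alcove l e"
    have e: "y = w (v (y - h)) + h" by (simp add: v)
    then have "v (y - h) \<in> alcove l e" using assms(3)[of "v (y - h)"] y by simp
    then show "y \<in> (\<lambda>x. w x + h) ` alcove l e" using e by blast
  qed (use assms(3) in blast)
  then have "(\<lambda>t. w ` t) ` (coset Z ` alcove l e) = coset Z ` alcove l e"
    unfolding image_image im by (metis image_image)
  then show ?thesis using assms(1) by (simp add: alcove_stabilizer_def weyl_eq)
qed

lemma alcove_stabilizer_comp:
  assumes "v \<in> alcove_stabilizer l e" "w \<in> alcove_stabilizer l e"
  shows "v \<circ> w \<in> alcove_stabilizer l e"
proof -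
  let ?A = "coset Z ` alcove l e"
  have "(\<lambda>t. (v \<circ> w) ` t) ` ?A = (\<lambda>t. v ` t) ` ((\<lambda>t. w ` t) ` ?A)"
    by (simp only: image_comp [symmetric] image_image)
  moreover have "v \<circ> w \<in> signed_perms" using assms signed_perm_comp by (simp add: alcove_stabilizer_def weyl_eq)
  ultimately show ?thesis using assms by (simp only: alcove_stabilizer_def weyl_eq mem_Collect_eq)
qed

lemma alcove_stabilizer_D:
  assumes "w \<in> alcove_stabilizer l e" "x \<in> alcove l e"
  obtains y where "y \<in> alcove l e" "w x - y \<in> Z"
proof -
  have "w ` coset Z x \<in> coset Z ` alcove l e"
    using assms unfolding alcove_stabilizer_def by blast
  then obtain y where y: "y \<in> alcove l e" "w ` coset Z x = coset Z y" by blast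
  have "w ` coset Z x = coset Z (w x)"
    using assms(1) lattice_signed_perm by (intro image_coset) (simp_all add: alcove_stabilizer_def weyl_eq)
  then have "w x - y \<in> Z" using y(2) coset_eq_iff[of Z "w x" y] lattice_0 lattice_diff by simp
  with y show ?thesis using that by blast
qed

end

section \<open>The longest elements and their products in coordinates\<close>

locale type_D_odd = type_D +
  assumes odd_l: "odd l"
begin

text \<open>
  The next four maps are the longest elements of the Weyl group and of the parabolic subgroups
  belonging to the nodes \<open>1\<close>, \<open>l\<close> and \<open>l - 1\<close>. The number of signs in the first two is \<open>l - 1\<close>,
  which is even.
\<close>

definition W0 :: "'a \<Rightarrow> 'a" where
  "W0 x = of_coords (\<lambda>i. if i = l then e i \<bullet> x else - (e i \<bullet> x))"
definition W1 :: "'a \<Rightarrow> 'a" where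
  "W1 x = of_coords (\<lambda>i. if i = 1 then e i \<bullet> x else - (e i \<bullet> x))"
definition Wl :: "'a \<Rightarrow> 'a" where
  "Wl x = of_coords (\<lambda>i. e (l + 1 - i) \<bullet> x)"
definition Wl' :: "'a \<Rightarrow> 'a" where
  "Wl' x = of_coords (\<lambda>i. if i = 1 \<or> i = l then - (e (l + 1 - i) \<bullet> x) else e (l + 1 - i) \<bullet> x)"

text \<open>
  The elements \<open>\<omega>\<^sub>1\<close>, \<open>\<omega>\<^sub>l\<close> and \<open>\<omega>\<^sub>l\<^sub>-\<^sub>1\<close>, the last one being the inverse of the second.
\<close>

definition om1 :: "'a \<Rightarrow> 'a" where
  "om1 x = of_coords (\<lambda>i. if i = 1 \<or> i = l then - (e i \<bullet> x) else e i \<bullet> x)"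
definition oml :: "'a \<Rightarrow> 'a" where
  "oml x = of_coords (\<lambda>i. if i = 1 then e l \<bullet> x else - (e (l + 1 - i) \<bullet> x))"
definition oml' :: "'a \<Rightarrow> 'a" where
  "oml' x = of_coords (\<lambda>i. if i = l then e 1 \<bullet> x else - (e (l + 1 - i) \<bullet> x))"

lemma coords [simp]:
  assumes "i \<in> {1..l}"
  shows "e i \<bullet> W0 x = (if i = l then e i \<bullet> x else - (e i \<bullet> x))"
    "e i \<bullet> W1 x = (if i = 1 then e i \<bullet> x else - (e i \<bullet> x))"
    "e i \<bullet> Wl x = e (l + 1 - i) \<bullet> x"
    "e i \<bullet> Wl' x = (if i = 1 \<or> i = l then - (e (l + 1 - i) \<bullet> x) else e (l + 1 - i) \<bullet> x)"
    "e i \<bullet> om1 x = (if i = 1 \<or> i = l then - (e i \<bullet> x) else e i \<bullet> x)"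
    "e i \<bullet> oml x = (if i = 1 then e l \<bullet> x else - (e (l + 1 - i) \<bullet> x))"
    "e i \<bullet> oml' x = (if i = l then e 1 \<bullet> x else - (e (l + 1 - i) \<bullet> x))"
  using assms by (simp_all only: W0_def W1_def Wl_def Wl'_def om1_def oml_def oml'_def coord_of_coords)

lemma signed_perm_by_negated_set:
  assumes "\<sigma> permutes {1..l}" "S \<subseteq> {1..l}" "even (card S)"
    "\<And>i x. i \<in> {1..l} \<Longrightarrow> e i \<bullet> w x = (if i \<in> S then -1 else 1) * (e (\<sigma> i) \<bullet> x)"
  shows "w \<in> signed_perms"
proof (rule signed_perm_I [OF assms(1) _ _ assms(4)])
  have "(\<Prod>i=1..l. if i \<in> S then - 1 else 1 :: real) = (\<Prod>i\<in>S. - 1)"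
    by (rule prod.mono_neutral_cong_right) (use assms(2) in auto)
  then show "(\<Prod>i=1..l. if i \<in> S then - 1 else 1 :: real) = 1" using assms(3) by simp
qed auto

definition rv :: "nat \<Rightarrow> nat" where "rv i = (if i \<in> {1..l} then l + 1 - i else i)"

lemma rv_permutes: "rv permutes {1..l}"
proof (rule bij_imp_permutes)
  show "bij_betw rv {1..l} {1..l}"
    by (rule bij_betw_byWitness [of _ rv]) (auto simp: rv_def)
qed (auto simp: rv_def)

lemma W_signed_perm: "W0 \<in> signed_perms" "W1 \<in> signed_perms" "Wl \<in> signed_perms" "Wl' \<in> signed_perms"
proof -
  show "W0 \<in> signed_perms"
    by (rule signed_perm_by_negated_set [of id "{1..l} - {l}"]) (use l_ge odd_l in \<open>auto simp: permutes_id\<close>)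
  show "W1 \<in> signed_perms"
    by (rule signed_perm_by_negated_set [of id "{1..l} - {1}"]) (use l_ge odd_l in \<open>auto simp: permutes_id\<close>)
  show "Wl \<in> signed_perms"
    by (rule signed_perm_by_negated_set [OF rv_permutes, of "{}"]) (auto simp: rv_def)
  show "Wl' \<in> signed_perms"
    by (rule signed_perm_by_negated_set [OF rv_permutes, of "{1,l}"]) (use l_ge in \<open>auto simp: rv_def\<close>)
qed

lemma W0_longest: "longest l e (weyl l e) = W0"
proof -
  have "longest l e {w \<in> signed_perms. w 0 = 0} = W0"
  proof (rule longest_stabilizer [where c = 0])
    show "W0 rho = - rho + 0 *\<^sub>R 0" by (rule coord_eqI) (simp add: coord_rho)
    show "W0 0 = 0" by (rule coord_eqI) simp
  qed (auto intro!: coord_eqI W_signed_perm)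
  moreover have "{w \<in> signed_perms. w 0 = 0} = weyl l e" unfolding weyl_eq using signed_perm_linear linear_0 by blast
  ultimately show ?thesis by simp
qed

text \<open>
  Here \<open>\<theta>\<close> is a positive multiple of the fundamental coweight of the node \<open>j\<close>, so that the
  simple reflections fixing it are those of the other nodes.
\<close>

lemma longest_parabolic:
  assumes "\<And>i. i \<in> {1..l} \<Longrightarrow> (if i = j then 0 < simple i \<bullet> \<theta> else simple i \<bullet> \<theta> = 0)"
    and w: "w \<in> signed_perms" "\<And>x. w (w x) = x" "w \<theta> = \<theta>" "w rho = - rho + c *\<^sub>R \<theta>"
  shows "longest l e (gen (srefl ` ({1..l} - {j}))) = w"
proof -
  have dom: "0 \<le> simple i \<bullet> \<theta>" if "i \<in> {1..l}" for i using assms(1)[OF that] by (auto split: if_splits)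
  have "{1..l} - {j} = {i \<in> {1..l}. simple i \<bullet> \<theta> = 0}" using assms(1) by (force split: if_splits)
  then show ?thesis using gen_stabilizer[OF dom] longest_stabilizer[OF dom w] by simp
qed

lemma rev_index: "i \<in> {1..l} \<Longrightarrow> l + 1 - i \<in> {1..l}" "i \<in> {1..l} \<Longrightarrow> l + 1 - (l + 1 - i) = i"
  by auto

lemma coord_rev [simp]:
  assumes "i \<in> {1..l}"
  shows "e (Suc l - i) \<bullet> of_coords f = f (Suc l - i)"
    "e (Suc l - i) \<bullet> W0 x = (if i = 1 then e l \<bullet> x else - (e (Suc l - i) \<bullet> x))"
    "e (Suc l - i) \<bullet> oml x = (if i = l then e l \<bullet> x else - (e i \<bullet> x))"
    "e (Suc l - i) \<bullet> oml' x = (if i = 1 then e 1 \<bullet> x else - (e i \<bullet> x))"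
    "e (Suc l - i) \<bullet> om1 x = (if i = 1 \<or> i = l then - (e (Suc l - i) \<bullet> x) else e (Suc l - i) \<bullet> x)"
proof -
  have i: "Suc l - i \<in> {1..l}" "Suc l - i = l \<longleftrightarrow> i = 1" "Suc l - i = 1 \<longleftrightarrow> i = l" "l + 1 - (Suc l - i) = i"
    using assms by auto
  show "e (Suc l - i) \<bullet> of_coords f = f (Suc l - i)"
    "e (Suc l - i) \<bullet> W0 x = (if i = 1 then e l \<bullet> x else - (e (Suc l - i) \<bullet> x))"
    "e (Suc l - i) \<bullet> oml x = (if i = l then e l \<bullet> x else - (e i \<bullet> x))"
    "e (Suc l - i) \<bullet> oml' x = (if i = 1 then e 1 \<bullet> x else - (e i \<bullet> x))"
    "e (Suc l - i) \<bullet> om1 x = (if i = 1 \<or> i = l then - (e (Suc l - i) \<bullet> x) else e (Suc l - i) \<bullet> x)"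
    using i by (simp_all only: coords [OF i(1)] coord_of_coords [OF i(1)] i) auto
qed

lemma W1_longest: "longest l e (gen (srefl ` ({1..l} - {1}))) = W1"
proof (rule longest_parabolic [where \<theta> = "e 1" and c = "2 * (real l - 1)"])
  show "W1 rho = - rho + (2 * (real l - 1)) *\<^sub>R e 1"
    by (rule coord_eqI) (use l_ge in \<open>auto simp: coord_rho inner_diff_right inner_e\<close>)
  show "W1 (e 1) = e 1" by (rule coord_eqI) (use l_ge in \<open>auto simp: inner_e\<close>)
qed (use l_ge in \<open>auto intro!: coord_eqI W_signed_perm simp: simple_inner inner_e\<close>)

lemma Wl_longest: "longest l e (gen (srefl ` ({1..l} - {l}))) = Wl"
proof (rule longest_parabolic [where \<theta> = "of_coords (\<lambda>_. 1)" and c = "real l - 1"])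
  show "Wl rho = - rho + (real l - 1) *\<^sub>R of_coords (\<lambda>_. 1)"
  proof (rule coord_eqI)
    fix i assume i: "i \<in> {1..l}"
    then show "e i \<bullet> Wl rho = e i \<bullet> (- rho + (real l - 1) *\<^sub>R of_coords (\<lambda>_. 1))"
      using coord_rho[OF rev_index(1)[OF i]]
      by (simp add: coord_rho inner_diff_right of_nat_diff)
  qed
  show "Wl (of_coords (\<lambda>_. 1)) = of_coords (\<lambda>_. 1)" by (rule coord_eqI) (use l_ge in \<open>auto\<close>)
  show "Wl (Wl x) = x" for x
  proof (rule coord_eqI)
    fix i assume i: "i \<in> {1..l}"
    show "e i \<bullet> Wl (Wl x) = e i \<bullet> x" using i rev_index[OF i] by simp
  qed
qed (use l_ge in \<open>auto intro!: W_signed_perm simp: simple_inner\<close>)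

lemma Wl'_longest: "longest l e (gen (srefl ` ({1..l} - {l - 1}))) = Wl'"
proof (rule longest_parabolic [where \<theta> = "of_coords (\<lambda>i. if i = l then -1 else 1)" and c = "real l - 1"])
  let ?t = "of_coords (\<lambda>i. if i = l then -1 else 1)"
  show "Wl' rho = - rho + (real l - 1) *\<^sub>R ?t"
  proof (rule coord_eqI)
    fix i assume i: "i \<in> {1..l}"
    then show "e i \<bullet> Wl' rho = e i \<bullet> (- rho + (real l - 1) *\<^sub>R ?t)"
      using coord_rho[OF rev_index(1)[OF i]] l_ge
      by (auto simp: coord_rho inner_diff_right of_nat_diff)
  qed
  show "Wl' ?t = ?t" by (rule coord_eqI) (use l_ge in \<open>auto\<close>)
  show "Wl' (Wl' x) = x" for x
  proof (rule coord_eqI)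
    fix i assume i: "i \<in> {1..l}"
    show "e i \<bullet> Wl' (Wl' x) = e i \<bullet> x" using i rev_index[OF i] l_ge by auto
  qed
  show "if i = l - 1 then 0 < simple i \<bullet> ?t else simple i \<bullet> ?t = 0" if "i \<in> {1..l}" for i
    using that l_ge by (auto simp: simple_inner)
qed (use l_ge in \<open>auto intro!: W_signed_perm simp: simple_inner\<close>)

lemma omega_eq: "omega l e 1 = om1" "omega l e l = oml" "omega l e (l - 1) = oml'"
proof -
  show "omega l e 1 = om1"
    unfolding omega_def W0_longest W1_longest
    by (rule ext, rule coord_eqI) (use l_ge in auto)
  show "omega l e l = oml"
    unfolding omega_def W0_longest Wl_longest
    by (rule ext, rule coord_eqI) (use l_ge in auto)
  show "omega l e (l - 1) = oml'"
    unfolding omega_def W0_longest Wl'_longest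
    by (rule ext, rule coord_eqI) (use l_ge in auto)
qed

lemma om_signed_perm: "om1 \<in> signed_perms" "oml \<in> signed_perms" "oml' \<in> signed_perms"
proof -
  show "om1 \<in> signed_perms"
    by (rule signed_perm_by_negated_set [of id "{1,l}"]) (use l_ge in \<open>auto simp: permutes_id\<close>)
  show "oml \<in> signed_perms"
    by (rule signed_perm_by_negated_set [OF rv_permutes, of "{1..l} - {1}"]) (use l_ge odd_l in \<open>auto simp: rv_def\<close>)
  show "oml' \<in> signed_perms"
    by (rule signed_perm_by_negated_set [OF rv_permutes, of "{1..l} - {l}"]) (use l_ge odd_l in \<open>auto simp: rv_def\<close>)
qed

lemma om_relations: "oml \<circ> oml = om1" "oml \<circ> om1 = oml'" "om1 \<circ> oml' = oml" "oml (oml' x) = x"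
proof -
  show "oml \<circ> oml = om1" by (rule ext, rule coord_eqI) (use l_ge in auto)
  show "oml \<circ> om1 = oml'" by (rule ext, rule coord_eqI) (use l_ge in auto)
  show "om1 \<circ> oml' = oml" by (rule ext, rule coord_eqI) (use l_ge in auto)
  show "oml (oml' x) = x" by (rule coord_eqI) (use l_ge in auto)
qed

end

section \<open>The stabilizer of the alcove\<close>

context type_D_odd
begin

lemma alcove_decreasing:
  assumes "y \<in> alcove l e" "1 \<le> i" "i \<le> k" "k \<le> l"
  shows "e k \<bullet> y \<le> e i \<bullet> y"
  using assms(3,4)
proof (induction k rule: dec_induct)
  case (step n)
  have "e (n + 1) \<bullet> y < e n \<bullet> y" using assms(1,2) step unfolding alcove_iff by auto
  with step show ?case by simp
qed simp

lemma alcove_small: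
  assumes "y \<in> alcove l e" "2 \<le> i" "i \<le> l"
  shows "\<bar>e i \<bullet> y\<bar> < 1/2"
proof -
  have "e (1 + 1) \<bullet> y < e 1 \<bullet> y"
    using assms(1) l_ge unfolding alcove_iff by (meson atLeastLessThan_iff le_refl less_le_trans one_less_numeral_iff semiring_norm(77))
  then have "e 2 \<bullet> y < e 1 \<bullet> y" by (simp add: numeral_2_eq_2)
  moreover have "0 < e (l - 1) \<bullet> y + e l \<bullet> y" "e 1 \<bullet> y + e 2 \<bullet> y < 1"
    using assms(1) unfolding alcove_iff by auto
  moreover have "e i \<bullet> y \<le> e 2 \<bullet> y" "e l \<bullet> y \<le> e i \<bullet> y" "e (l - 1) \<bullet> y \<le> e 2 \<bullet> y"
    using assms l_ge by (auto intro: alcove_decreasing)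
  ultimately show ?thesis by linarith
qed

text \<open>
  The half sum of the positive roots divided by the Coxeter number \<open>2l - 2\<close>. It is fixed by the
  affine symmetry \<open>x \<mapsto> \<omega>\<^sub>l x + half\<close> of the alcove (\<open>oml_alcove_point\<close>).
\<close>

definition alcove_point :: 'a where "alcove_point = (1 / (2 * real l - 2)) *\<^sub>R rho"

lemma coord_alcove_point: "i \<in> {1..l} \<Longrightarrow> e i \<bullet> alcove_point = (real l - real i) / (2 * real l - 2)"
  by (simp add: alcove_point_def coord_rho)

lemma alcove_point_in_alcove: "alcove_point \<in> alcove l e"
proof -
  have "e 1 \<bullet> alcove_point + e 2 \<bullet> alcove_point = ((real l - 1) + (real l - 2)) / (2 * real l - 2)"
    using l_ge by (simp add: coord_alcove_point add_divide_distrib [symmetric])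
  also have "\<dots> < 1" using l_ge by simp
  finally have "e 1 \<bullet> alcove_point + e 2 \<bullet> alcove_point < 1" .
  then show ?thesis
    unfolding alcove_iff using l_ge by (auto simp: coord_alcove_point of_nat_diff divide_strict_right_mono)
qed

lemma alcove_point_bound:
  assumes "w \<in> signed_perms" "i \<in> {1..l}"
  shows "\<bar>e i \<bullet> w alcove_point\<bar> \<le> 1/2"
proof -
  from assms(1) obtain \<sigma> \<epsilon> where s: "\<sigma> permutes {1..l}" "\<And>i. i \<in> {1..l} \<Longrightarrow> \<epsilon> i \<in> {1, -1}"
     "\<And>i x. i \<in> {1..l} \<Longrightarrow> e i \<bullet> w x = \<epsilon> i * (e (\<sigma> i) \<bullet> x)"
    by (rule signed_perm_E) blast
  have si: "\<sigma> i \<in> {1..l}" using s(1) assms(2) by (metis permutes_in_image)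
  have "\<bar>e i \<bullet> w alcove_point\<bar> = \<bar>e (\<sigma> i) \<bullet> alcove_point\<bar>" using s(3)[OF assms(2)] s(2)[OF assms(2)] by auto
  also have "\<dots> = (real l - real (\<sigma> i)) / (2 * real l - 2)"
    using si l_ge by (simp add: coord_alcove_point abs_of_nonneg)
  also have "\<dots> \<le> 1/2" using si l_ge by (simp add: field_simps)
  finally show ?thesis .
qed

lemma fundamental_alcove_imp_id:
  assumes "w \<in> signed_perms" "\<And>i. i \<in> {1..l} \<Longrightarrow> 0 < simple i \<bullet> w alcove_point"
  shows "w = id"
proof (rule dominant_rho_imp_id [OF assms(1)])
  fix i assume "i \<in> {1..l}"
  then have "0 < simple i \<bullet> w alcove_point" by (rule assms)
  then show "0 < simple i \<bullet> w rho"
    using signed_perm_linear[OF assms(1)] l_ge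
    by (simp add: alcove_point_def linear_cmul zero_less_mult_iff zero_less_divide_iff)
qed

text \<open>
  All coordinates of \<open>y\<close> but the first lie strictly between \<open>- 1/2\<close> and \<open>1/2\<close>, and those of the
  moved point are at most \<open>1/2\<close> in absolute value. So an integral translation can only change
  the first coordinate, by \<open>0\<close> or \<open>1\<close>. In the first case \<open>w\<close> keeps the point in the alcove and
  is trivial; in the second case \<open>\<omega>\<^sub>1 w\<close> does.
\<close>

lemma integral_translation:
  assumes w: "w \<in> signed_perms" and y: "y \<in> alcove l e"
    and int: "\<And>i. i \<in> {1..l} \<Longrightarrow> e i \<bullet> (w alcove_point - y) \<in> \<int>"
  shows "w \<in> {id, om1}"
proof -
  have yc: "e (i + 1) \<bullet> y < e i \<bullet> y" if "i \<in> {1..<l}" for i using y that unfolding alcove_iff by blast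
  have yl: "0 < e (l - 1) \<bullet> y + e l \<bullet> y" and y1: "e 1 \<bullet> y + e 2 \<bullet> y < 1" using y unfolding alcove_iff by auto
  have eq: "e i \<bullet> w alcove_point = e i \<bullet> y" if i: "i \<in> {2..l}" for i
  proof -
    obtain n where n: "e i \<bullet> w alcove_point - e i \<bullet> y = of_int n"
      using int[of i] i by (auto simp: inner_diff_right elim!: Ints_cases)
    have "\<bar>e i \<bullet> y\<bar> < 1/2" "\<bar>e i \<bullet> w alcove_point\<bar> \<le> 1/2" using alcove_small[OF y] alcove_point_bound[OF w] i by auto
    then have "\<bar>real_of_int n\<bar> < 1" unfolding n[symmetric] by linarith
    then have "n = 0" by linarith
    with n show ?thesis by simp
  qed
  obtain n where n: "e 1 \<bullet> w alcove_point - e 1 \<bullet> y = of_int n"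
    using int[of 1] l_ge by (auto simp: inner_diff_right elim!: Ints_cases)
  have b1: "\<bar>e 1 \<bullet> w alcove_point\<bar> \<le> 1/2" using alcove_point_bound[OF w] l_ge by simp
  have "\<bar>e 2 \<bullet> y\<bar> < 1/2" using alcove_small[OF y] l_ge by simp
  have "0 < e 1 \<bullet> y"
  proof -
    have "e (l - 1) \<bullet> y \<le> e 1 \<bullet> y" "e l \<bullet> y \<le> e 1 \<bullet> y" using l_ge y by (auto intro: alcove_decreasing)
    with yl show ?thesis by linarith
  qed
  \<comment> \<open>The bound \<open>3/2\<close> is crude, but it leaves only two integers.\<close>
  have "e 1 \<bullet> y < 3/2" using y1 \<open>\<bar>e 2 \<bullet> y\<bar> < 1/2\<close> by linarith
  then have "- 2 < real_of_int n" "real_of_int n < 1"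
    unfolding n[symmetric] using b1 \<open>0 < e 1 \<bullet> y\<close> by linarith+
  then consider "n = 0" | "n = -1" by linarith
  then show ?thesis
  proof cases
    case 1
    then have "e i \<bullet> w alcove_point = e i \<bullet> y" if "i \<in> {1..l}" for i using eq[of i] n that by (cases "i = 1") auto
    then have "w alcove_point = y" by (rule coord_eqI)
    then have "w = id" using y by (intro fundamental_alcove_imp_id w) (simp add: alcove_def)
    then show ?thesis by simp
  next
    case 2
    have c: "e i \<bullet> om1 (w alcove_point) = (if i = 1 then 1 - e 1 \<bullet> y else if i = l then - (e l \<bullet> y) else e i \<bullet> y)"
      if "i \<in> {1..l}" for i using that eq[of i] n 2 by auto
    have "l - 1 \<in> {1..l}" "l \<in> {1..l}" "l - 1 \<noteq> 1" "l - 1 \<noteq> l" "l \<noteq> 1" using l_ge by auto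
    then have cl: "e (l - 1) \<bullet> om1 (w alcove_point) = e (l - 1) \<bullet> y" "e l \<bullet> om1 (w alcove_point) = - (e l \<bullet> y)"
      using c[of "l - 1"] c[of l] by presburger+
    have "om1 \<circ> w = id"
    proof (rule fundamental_alcove_imp_id)
      show "om1 \<circ> w \<in> signed_perms" by (rule signed_perm_comp [OF om_signed_perm(1) w])
      fix i assume i: "i \<in> {1..l}"
      consider "i = 1" | "2 \<le> i" "i < l - 1" | "i = l - 1" | "i = l" using i by force
      then show "0 < simple i \<bullet> (om1 \<circ> w) alcove_point"
      proof cases
        case 1
        then show ?thesis using c[of 1] c[of 2] y1 l_ge by (simp add: simple_inner numeral_2_eq_2)
      next
        case 2
        then have "e i \<bullet> om1 (w alcove_point) = e i \<bullet> y" "e (i + 1) \<bullet> om1 (w alcove_point) = e (i + 1) \<bullet> y"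
          using c[of i] c[of "i + 1"] by auto
        moreover have "i < l" using 2 by simp
        ultimately show ?thesis using yc[of i] 2 by (simp add: simple_inner del: coords)
      next
        case 3
        then show ?thesis using cl yl l_ge by (simp add: simple_inner del: coords)
      next
        case 4
        then show ?thesis using cl yc[of "l - 1"] l_ge by (simp add: simple_inner del: coords)
      qed
    qed
    then have "om1 (w x) = x" for x by (metis comp_apply id_apply)
    moreover have "om1 (om1 x) = x" for x by (rule coord_eqI) (use l_ge in auto)
    ultimately have "w = om1" by (metis ext)
    then show ?thesis by simp
  qed
qed

definition half :: 'a where "half = of_coords (\<lambda>_. 1/2)"

lemma half_in_lattice: "half \<in> Z"
  unfolding lattice_iff by (intro exI [of _ "\<lambda>_. 1"]) (simp add: half_def same_parity_def)

text \<open>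
  Following \<open>\<omega>\<^sub>l\<close> by the translation by \<open>(1/2, \<dots>, 1/2)\<close> permutes the walls of the alcove: it
  induces a rotation of order four of the extended Dynkin diagram.
\<close>

lemma oml_alcove: "x \<in> alcove l e \<longleftrightarrow> oml x + half \<in> alcove l e"
proof -
  let ?y = "oml x + half"
  have c: "e i \<bullet> ?y = (if i = 1 then 1/2 + e l \<bullet> x else 1/2 - e (l + 1 - i) \<bullet> x)" if "i \<in> {1..l}" for i
    using that by (simp add: inner_add_right half_def)
  have c': "e (i + 1) \<bullet> ?y = 1/2 - e (l - i) \<bullet> x" if "i \<in> {1..<l}" for i
    using c[of "i + 1"] that by simp
  have A: "e (l - 1) \<bullet> ?y = 1/2 - e 2 \<bullet> x" "e l \<bullet> ?y = 1/2 - e 1 \<bullet> x" "e 1 \<bullet> ?y = 1/2 + e l \<bullet> x"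
    "e 2 \<bullet> ?y = 1/2 - e (l - 1) \<bullet> x"
    using c[of "l - 1"] c[of l] c[of 1] c[of 2] l_ge by (auto simp: numeral_2_eq_2)
  show ?thesis
  proof
    assume x: "x \<in> alcove l e"
    have "e (i + 1) \<bullet> ?y < e i \<bullet> ?y" if i: "i \<in> {1..<l}" for i
    proof (cases "i = 1")
      case True
      then show ?thesis using A x i unfolding alcove_iff by (simp add: numeral_2_eq_2)
    next
      case False
      then have "e (l - i + 1) \<bullet> x < e (l - i) \<bullet> x" using x i unfolding alcove_iff by auto
      moreover have "l - i + 1 = l + 1 - i" using i by auto
      ultimately show ?thesis using c'[OF i] c[of i] i False by simp
    qed
    moreover have "e 2 \<bullet> x + e 1 \<bullet> x < 1" "e l \<bullet> x < e (l - 1) \<bullet> x"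
      using x l_ge unfolding alcove_iff by (auto dest: bspec [of _ _ "l - 1"])
    ultimately show "?y \<in> alcove l e" unfolding alcove_iff A by auto
  next
    assume y: "?y \<in> alcove l e"
    have yc: "e (i + 1) \<bullet> ?y < e i \<bullet> ?y" if "i \<in> {1..<l}" for i using y that unfolding alcove_iff by blast
    have yl: "0 < e (l - 1) \<bullet> ?y + e l \<bullet> ?y" "e 1 \<bullet> ?y + e 2 \<bullet> ?y < 1" using y unfolding alcove_iff by auto
    have "e (i + 1) \<bullet> x < e i \<bullet> x" if i: "i \<in> {1..<l}" for i
    proof (cases "i = l - 1")
      case True
      then show ?thesis using yl l_ge unfolding A by simp
    next
      case False
      then have j: "l - i \<in> {2..<l}" using i by auto
      then have "e (l - i + 1) \<bullet> ?y < e (l - i) \<bullet> ?y" by (intro yc) auto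
      moreover have "l - (l - i) = i" "l + 1 - (l - i) = i + 1" using i by auto
      ultimately show ?thesis using c'[of "l - i"] c[of "l - i"] j by simp
    qed
    moreover have "e 2 \<bullet> ?y < e 1 \<bullet> ?y" using yc[of 1] l_ge by (simp add: numeral_2_eq_2)
    ultimately show "x \<in> alcove l e" unfolding alcove_iff using yl A by auto
  qed
qed

lemma oml_alcove_point: "oml alcove_point + half = alcove_point"
proof (rule coord_eqI)
  fix i assume i: "i \<in> {1..l}"
  then show "e i \<bullet> (oml alcove_point + half) = e i \<bullet> alcove_point"
    using coord_alcove_point[OF rev_index(1)[OF i]] l_ge
    by (auto simp: inner_add_right half_def coord_alcove_point field_simps of_nat_diff)
qed

lemma alcove_stabilizer_eq: "alcove_stabilizer l e = {id, om1, oml', oml}"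
proof (intro equalityI subsetI)
  fix w assume w: "w \<in> alcove_stabilizer l e"
  then have wS: "w \<in> signed_perms" by (simp add: alcove_stabilizer_def weyl_eq)
  from w alcove_point_in_alcove obtain y where y: "y \<in> alcove l e" "w alcove_point - y \<in> Z" by (rule alcove_stabilizer_D)
  obtain a where a: "same_parity a" "\<And>i. i \<in> {1..l} \<Longrightarrow> e i \<bullet> (w alcove_point - y) = of_int (a i) / 2"
    using y(2) unfolding lattice_iff by blast
  show "w \<in> {id, om1, oml', oml}"
  proof (cases "even (a 1)")
    case True
    have "e i \<bullet> (w alcove_point - y) \<in> \<int>" if i: "i \<in> {1..l}" for i
    proof -
      have "even (a i)" using a(1) i True unfolding same_parity_def by blast
      then show ?thesis unfolding a(2)[OF i] by (auto elim!: evenE)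
    qed
    then show ?thesis using integral_translation[OF wS y(1)] by auto
  next
    case False
    \<comment> \<open>\<open>\<omega>\<^sub>l\<close> moves the point by the half-integral vector \<open>- half\<close>, so the translation
      part of \<open>w \<circ> oml\<close> is integral.\<close>
    have "w \<circ> oml \<in> {id, om1}"
    proof (rule integral_translation [OF signed_perm_comp [OF wS om_signed_perm(2)] y(1)])
      fix i assume i: "i \<in> {1..l}"
      obtain \<sigma> \<epsilon> where s: "\<sigma> permutes {1..l}" "\<And>i. i \<in> {1..l} \<Longrightarrow> \<epsilon> i \<in> {1, -1}"
         "\<And>i x. i \<in> {1..l} \<Longrightarrow> e i \<bullet> w x = \<epsilon> i * (e (\<sigma> i) \<bullet> x)"
        using wS by (rule signed_perm_E) blast
      have "\<sigma> i \<in> {1..l}" using s(1) i by (metis permutes_in_image)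
      then have h: "e i \<bullet> w half = \<epsilon> i / 2" using s(3)[OF i] by (simp add: half_def)
      have "oml alcove_point = alcove_point - half" using oml_alcove_point by (metis add_diff_cancel)
      then have "(w \<circ> oml) alcove_point = w alcove_point - w half" using signed_perm_linear[OF wS] by (simp add: linear_diff)
      then have e: "e i \<bullet> ((w \<circ> oml) alcove_point - y) = (of_int (a i) - \<epsilon> i) / 2"
        using a(2)[OF i] h by (simp add: inner_diff_right diff_divide_distrib del: coords)
      have "odd (a i)" using a(1) i False unfolding same_parity_def by blast
      then obtain m where "a i = 2 * m + 1" by (rule oddE)
      then have "e i \<bullet> ((w \<circ> oml) alcove_point - y) \<in> {of_int m, of_int (m + 1)}" using e s(2)[OF i] by auto
      then show "e i \<bullet> ((w \<circ> oml) alcove_point - y) \<in> \<int>" by auto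
    qed
    moreover have "w = (w \<circ> oml) \<circ> oml'" by (rule ext) (simp add: om_relations)
    ultimately have "w = oml' \<or> w = oml" using om_relations(3) by (metis id_comp insertE singletonD)
    then show ?thesis by blast
  qed
next
  have l: "oml \<in> alcove_stabilizer l e"
    by (rule alcove_stabilizer_I [OF om_signed_perm(2) half_in_lattice oml_alcove])
  have i: "id \<in> alcove_stabilizer l e"
    by (rule alcove_stabilizer_I [OF signed_perm_id lattice_0]) simp
  have m: "om1 \<in> alcove_stabilizer l e" using alcove_stabilizer_comp[OF l l] by (simp only: om_relations)
  have l': "oml' \<in> alcove_stabilizer l e" using alcove_stabilizer_comp[OF l m] by (simp only: om_relations)
  fix w assume "w \<in> {id, om1, oml', oml}"
  then show "w \<in> alcove_stabilizer l e" using l i m l' by blast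
qed

end

section \<open>Functions with pairwise inequivalent values\<close>

text \<open>
  The set \<open>cl a\<close> contains the values that the value \<open>a\<close> excludes at all other places. If \<open>cl\<close>
  maps elements to their equivalence classes, these are the functions with pairwise inequivalent
  values.
\<close>

definition sep_funs :: "('b \<Rightarrow> 'b set) \<Rightarrow> 'i set \<Rightarrow> 'b set \<Rightarrow> ('i \<Rightarrow> 'b) set" where
  "sep_funs cl I T = {f \<in> I \<rightarrow>\<^sub>E T. \<forall>i\<in>I. \<forall>k\<in>I. i \<noteq> k \<longrightarrow> f k \<notin> cl (f i)}"

lemma sep_funs_sep: "f \<in> sep_funs cl I T \<Longrightarrow> i \<in> I \<Longrightarrow> k \<in> I \<Longrightarrow> i \<noteq> k \<Longrightarrow> f k \<notin> cl (f i)"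
  unfolding sep_funs_def by simp

lemma sep_funs_mem: "f \<in> sep_funs cl I T \<Longrightarrow> i \<in> I \<Longrightarrow> f i \<in> T"
  unfolding sep_funs_def by (elim CollectE conjE) (rule PiE_mem)

lemma sep_funs_I:
  assumes "\<And>i. i \<in> I \<Longrightarrow> f i \<in> T" "\<And>i. i \<notin> I \<Longrightarrow> f i = undefined"
    "\<And>i k. i \<in> I \<Longrightarrow> k \<in> I \<Longrightarrow> i \<noteq> k \<Longrightarrow> f k \<notin> cl (f i)"
  shows "f \<in> sep_funs cl I T"
proof -
  have "f \<in> I \<rightarrow>\<^sub>E T" by (rule PiE_I) (erule assms(1,2))+
  moreover have "\<forall>i\<in>I. \<forall>k\<in>I. i \<noteq> k \<longrightarrow> f k \<notin> cl (f i)"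
    by (intro ballI impI) (erule (2) assms(3))
  ultimately show ?thesis unfolding sep_funs_def by blast
qed

lemma sep_funs_undefined: "f \<in> sep_funs cl I T \<Longrightarrow> i \<notin> I \<Longrightarrow> f i = undefined"
  unfolding sep_funs_def by (elim CollectE conjE) (rule PiE_arb)

lemma finite_sep_funs: "finite I \<Longrightarrow> finite T \<Longrightarrow> finite (sep_funs cl I T)"
  unfolding sep_funs_def by (simp add: finite_PiE)

text \<open>
  Choose the values one place after another: each value used so far removes a whole class of
  size \<open>d\<close>. The formula stays correct when \<open>T\<close> is exhausted, since an empty set of functions has
  already produced a zero factor.
\<close>

lemma card_sep_funs:
  fixes I :: "'i set" and T :: "'b set"
  assumes "finite I" "finite T"
    and cl: "\<And>a. a \<in> T \<Longrightarrow> a \<in> cl a \<and> cl a \<subseteq> T \<and> card (cl a) = d"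
      "\<And>a b. a \<in> T \<Longrightarrow> b \<in> cl a \<Longrightarrow> cl b = cl a"
  shows "real (card (sep_funs cl I T)) = (\<Prod>i<card I. real (card T) - real d * real i)"
  using assms(1)
proof (induction I)
  case empty
  have "sep_funs cl ({} :: 'i set) T = {\<lambda>_. undefined}" by (auto simp: sep_funs_def)
  then show ?case by simp
next
  case (insert j I)
  define used where "used f = (\<Union>i\<in>I. cl (f i))" for f :: "_ \<Rightarrow> 'b"
  have room: "card (T - used f) + d * card I = card T" if f: "f \<in> sep_funs cl I T" for f
  proof -
    have fT: "f i \<in> T" if "i \<in> I" for i using f that by (rule sep_funs_mem)
    have fin: "finite (cl (f i))" if "i \<in> I" for i using cl(1)[OF fT[OF that]] assms(2) finite_subset by blast
    have disj: "cl (f i) \<inter> cl (f k) = {}" if "i \<in> I" "k \<in> I" "i \<noteq> k" for i k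
    proof (rule ccontr)
      assume "cl (f i) \<inter> cl (f k) \<noteq> {}"
      then obtain x where "x \<in> cl (f i)" "x \<in> cl (f k)" by blast
      then have "cl (f i) = cl (f k)" using cl(2)[OF fT[OF that(1)]] cl(2)[OF fT[OF that(2)]] by blast
      then have "f k \<in> cl (f i)" using cl(1)[OF fT[OF that(2)]] by simp
      then show False using sep_funs_sep[OF f that] by simp
    qed
    have "card (used f) = (\<Sum>i\<in>I. card (cl (f i)))"
      unfolding used_def by (rule card_UN_disjoint) (use insert fin disj in auto)
    also have "\<dots> = d * card I" using cl(1) fT by simp
    finally have "card (used f) = d * card I" .
    moreover have "used f \<subseteq> T" unfolding used_def using cl(1) fT by blast
    ultimately show ?thesis
      using card_Diff_subset[of "used f" T] card_mono[OF assms(2), of "used f"] finite_subset[OF _ assms(2)]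
      by auto
  qed
  have sym: "a \<in> cl b" if "b \<in> cl a" "a \<in> T" for a b
    using cl(1)[OF that(2)] cl(2)[OF that(2,1)] by simp
  have "bij_betw (\<lambda>(f, y). f(j := y)) (SIGMA f:sep_funs cl I T. T - used f) (sep_funs cl (insert j I) T)"
  proof (rule bij_betw_byWitness [of _ "\<lambda>f. (f(j := undefined), f j)"])
    show "\<forall>p\<in>SIGMA f:sep_funs cl I T. T - used f.
       (\<lambda>f. (f(j := undefined), f j)) ((\<lambda>(f, y). f(j := y)) p) = p"
    proof
      fix p assume "p \<in> (SIGMA f:sep_funs cl I T. T - used f)"
      then obtain f y where p: "p = (f, y)" and f: "f \<in> sep_funs cl I T" by blast
      have "f j = undefined" by (rule sep_funs_undefined [OF f insert(2)])
      then have "(f(j := y))(j := undefined) = f" by (simp add: fun_upd_idem)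
      then show "(\<lambda>f. (f(j := undefined), f j)) ((\<lambda>(f, y). f(j := y)) p) = p" by (simp add: p)
    qed
    show "\<forall>f\<in>sep_funs cl (insert j I) T. (\<lambda>(f, y). f(j := y)) (f(j := undefined), f j) = f"
      by auto
    show "(\<lambda>(f, y). f(j := y)) ` (SIGMA f:sep_funs cl I T. T - used f) \<subseteq> sep_funs cl (insert j I) T"
    proof safe
      fix f y assume f: "f \<in> sep_funs cl I T" and y: "y \<in> T" "y \<notin> used f"
      have fT: "f i \<in> T" if "i \<in> I" for i using f that by (rule sep_funs_mem)
      have "y \<notin> cl (f i)" "f i \<notin> cl y" if "i \<in> I" for i
      proof -
        show "y \<notin> cl (f i)" using y(2) that by (simp add: used_def)
        then show "f i \<notin> cl y" using sym[of "f i" y] y(1) by blast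
      qed
      then show "f(j := y) \<in> sep_funs cl (insert j I) T"
        using insert(2) y(1) fT sep_funs_sep[OF f] sep_funs_undefined[OF f]
        by (intro sep_funs_I) auto
    qed
    show "(\<lambda>f. (f(j := undefined), f j)) ` sep_funs cl (insert j I) T \<subseteq> (SIGMA f:sep_funs cl I T. T - used f)"
    proof safe
      fix f assume f: "f \<in> sep_funs cl (insert j I) T"
      note sep = sep_funs_sep[OF f] and mem = sep_funs_mem[OF f] and und = sep_funs_undefined[OF f]
      have same: "(f(j := undefined)) i = f i" if "i \<in> I" for i using insert(2) that by auto
      show "f(j := undefined) \<in> sep_funs cl I T"
      proof (rule sep_funs_I)
        show "(f(j := undefined)) i \<in> T" if "i \<in> I" for i using mem that same by simp
        show "(f(j := undefined)) i = undefined" if "i \<notin> I" for i using und that by simp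
        show "(f(j := undefined)) k \<notin> cl ((f(j := undefined)) i)" if "i \<in> I" "k \<in> I" "i \<noteq> k" for i k
          using sep that same by simp
      qed
      show "f j \<in> T" using mem by simp
      assume "f j \<in> used (f(j := undefined))"
      then obtain i where i: "i \<in> I" "f j \<in> cl (f i)" using same by (auto simp: used_def)
      then have "i \<noteq> j" using insert(2) by auto
      then show False using sep[of i j] i by simp
    qed
  qed
  then have "card (sep_funs cl (insert j I) T) = card (SIGMA f:sep_funs cl I T. T - used f)"
    by (simp add: bij_betw_same_card)
  also have "\<dots> = (\<Sum>f\<in>sep_funs cl I T. card (T - used f))"
    using insert(1) assms(2) finite_sep_funs by (intro card_SigmaI) auto
  finally have "real (card (sep_funs cl (insert j I) T)) = (\<Sum>f\<in>sep_funs cl I T. real (card (T - used f)))"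
    by simp
  also have "\<dots> = (\<Sum>f\<in>sep_funs cl I T. real (card T) - real d * real (card I))"
  proof (rule sum.cong)
    fix f assume "f \<in> sep_funs cl I T"
    from arg_cong[OF room[OF this], of real]
    show "real (card (T - used f)) = real (card T) - real d * real (card I)" by simp
  qed simp
  also have "\<dots> = (\<Prod>i<card I. real (card T) - real d * real i) * (real (card T) - real d * real (card I))"
    by (simp add: insert(3))
  finally show ?case using insert(1,2) by simp
qed

text \<open>
  A prescribed value \<open>z\<close> at the place \<open>i\<close> removes exactly its own class from the values
  available elsewhere.
\<close>

lemma sep_funs_pin:
  assumes i: "i \<in> I" and z: "z \<in> cl z" "T \<inter> cl z = {}" "\<And>a. a \<in> T \<Longrightarrow> z \<notin> cl a"
  shows "bij_betw (\<lambda>f. f(i := undefined)) {f \<in> sep_funs cl I (cl z \<union> T). f i = z} (sep_funs cl (I - {i}) T)"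
proof (rule bij_betw_byWitness [of _ "\<lambda>g. g(i := z)"])
  show "\<forall>f\<in>{f \<in> sep_funs cl I (cl z \<union> T). f i = z}. f(i := undefined, i := z) = f"
    by (simp add: fun_upd_idem)
  have "g i = undefined" if "g \<in> sep_funs cl (I - {i}) T" for g
    using sep_funs_undefined[OF that] by simp
  then show "\<forall>g\<in>sep_funs cl (I - {i}) T. g(i := z, i := undefined) = g"
    by (simp add: fun_upd_idem)
  show "(\<lambda>f. f(i := undefined)) ` {f \<in> sep_funs cl I (cl z \<union> T). f i = z} \<subseteq> sep_funs cl (I - {i}) T"
  proof (rule image_subsetI)
    fix f assume "f \<in> {f \<in> sep_funs cl I (cl z \<union> T). f i = z}"
    then have f: "f \<in> sep_funs cl I (cl z \<union> T)" "z = f i" by simp_all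
    have "f k \<in> T" if "k \<in> I - {i}" for k
      using sep_funs_mem[OF f(1), of k] sep_funs_sep[OF f(1) i, of k] f(2) that by auto
    then show "f(i := undefined) \<in> sep_funs cl (I - {i}) T"
      using sep_funs_undefined[OF f(1)] sep_funs_sep[OF f(1)] by (intro sep_funs_I) auto
  qed
  show "(\<lambda>g. g(i := z)) ` sep_funs cl (I - {i}) T \<subseteq> {f \<in> sep_funs cl I (cl z \<union> T). f i = z}"
  proof (rule image_subsetI)
    fix g assume g: "g \<in> sep_funs cl (I - {i}) T"
    have gT: "g k \<in> T" if "k \<in> I" "k \<noteq> i" for k using sep_funs_mem[OF g] that by simp
    have "z \<notin> cl (g k)" "g k \<notin> cl z" if "k \<in> I" "k \<noteq> i" for k
      using gT[OF that] z by auto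
    then have "g(i := z) \<in> sep_funs cl I (cl z \<union> T)"
      using gT sep_funs_sep[OF g] sep_funs_undefined[OF g] z(1) i by (intro sep_funs_I) auto
    then show "g(i := z) \<in> {f \<in> sep_funs cl I (cl z \<union> T). f i = z}" by simp
  qed
qed

lemma card_sep_funs_pin2:
  assumes "i \<in> I" "k \<in> I" "i \<noteq> k"
    and "y \<in> cl y" "(cl z \<union> T) \<inter> cl y = {}" "\<And>a. a \<in> cl z \<union> T \<Longrightarrow> y \<notin> cl a"
    and "z \<in> cl z" "T \<inter> cl z = {}" "\<And>a. a \<in> T \<Longrightarrow> z \<notin> cl a"
  shows "card {f \<in> sep_funs cl I (cl y \<union> (cl z \<union> T)). f i = y \<and> f k = z} = card (sep_funs cl (I - {i} - {k}) T)"
proof -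
  have "bij_betw (\<lambda>f. f(i := undefined)) {f \<in> {f \<in> sep_funs cl I (cl y \<union> (cl z \<union> T)). f i = y}. f k = z}
      {g \<in> sep_funs cl (I - {i}) (cl z \<union> T). g k = z}"
    by (rule bij_betw_Collect [OF sep_funs_pin]) (use assms in auto)
  moreover have "bij_betw (\<lambda>f. f(k := undefined)) {g \<in> sep_funs cl (I - {i}) (cl z \<union> T). g k = z}
      (sep_funs cl (I - {i} - {k}) T)"
    by (rule sep_funs_pin) (use assms in auto)
  ultimately show ?thesis by (simp add: bij_betw_same_card conj_assoc)
qed

text \<open>
  A value that is alone in its class is taken at no place or at exactly one place.
\<close>

lemma card_sep_funs_insert:
  assumes "finite I" "finite T" "z \<notin> T" "\<And>a. a \<in> T \<Longrightarrow> z \<notin> cl a" "cl z = {z}"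
  shows "card (sep_funs cl I (insert z T)) = card (sep_funs cl I T) + (\<Sum>i\<in>I. card (sep_funs cl (I - {i}) T))"
proof -
  let ?S = "sep_funs cl I (insert z T)"
  have fin: "finite ?S" using assms by (intro finite_sep_funs) auto
  have split: "?S = sep_funs cl I T \<union> (\<Union>i\<in>I. {f \<in> ?S. f i = z})"
  proof (intro equalityI subsetI)
    fix f assume f: "f \<in> ?S"
    show "f \<in> sep_funs cl I T \<union> (\<Union>i\<in>I. {f \<in> ?S. f i = z})"
    proof (cases "\<exists>i\<in>I. f i = z")
      case False
      then have "f \<in> sep_funs cl I T"
        using sep_funs_mem[OF f] sep_funs_undefined[OF f] sep_funs_sep[OF f] by (intro sep_funs_I) auto
      then show ?thesis by simp
    qed (use f in auto)
  next
    fix f assume "f \<in> sep_funs cl I T \<union> (\<Union>i\<in>I. {f \<in> ?S. f i = z})"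
    then show "f \<in> ?S"
    proof
      assume f: "f \<in> sep_funs cl I T"
      show ?thesis
        using sep_funs_mem[OF f] sep_funs_undefined[OF f] sep_funs_sep[OF f] by (intro sep_funs_I) auto
    qed auto
  qed
  have "card ?S = card (sep_funs cl I T) + card (\<Union>i\<in>I. {f \<in> ?S. f i = z})"
  proof (subst split, rule card_Un_disjoint)
    show "finite (sep_funs cl I T)" using assms by (intro finite_sep_funs)
    show "finite (\<Union>i\<in>I. {f \<in> ?S. f i = z})" using assms(1) fin by auto
    show "sep_funs cl I T \<inter> (\<Union>i\<in>I. {f \<in> ?S. f i = z}) = {}" using assms(3) sep_funs_mem by fastforce
  qed
  also have "card (\<Union>i\<in>I. {f \<in> ?S. f i = z}) = (\<Sum>i\<in>I. card {f \<in> ?S. f i = z})"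
  proof (rule card_UN_disjoint)
    show "\<forall>i\<in>I. \<forall>k\<in>I. i \<noteq> k \<longrightarrow> {f \<in> ?S. f i = z} \<inter> {f \<in> ?S. f k = z} = {}"
      using sep_funs_sep[of _ cl I "insert z T"] assms(5) by fastforce
  qed (use assms(1) fin in auto)
  also have "\<dots> = (\<Sum>i\<in>I. card (sep_funs cl (I - {i}) T))"
  proof (intro sum.cong refl bij_betw_same_card)
    fix i assume "i \<in> I"
    then show "bij_betw (\<lambda>f. f(i := undefined)) {f \<in> ?S. f i = z} (sep_funs cl (I - {i}) T)"
      using sep_funs_pin[of i I z cl T] assms by simp
  qed
  finally show ?thesis .
qed

section \<open>Residues modulo 2q up to sign\<close>

text \<open>
  The class of a residue modulo \<open>2q\<close> up to sign. It has two elements, except for the residues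
  \<open>0\<close> and \<open>q\<close>, which are their own negatives.
\<close>

definition pm :: "nat \<Rightarrow> int \<Rightarrow> int set" where
  "pm q a = {a, (- a) mod (2 * int q)}"

definition evens :: "nat \<Rightarrow> int set" where "evens q = {a \<in> {0..<2 * int q}. even a}"
definition odds :: "nat \<Rightarrow> int set" where "odds q = {a \<in> {0..<2 * int q}. odd a}"

lemma finite_evens: "finite (evens q)" and finite_odds: "finite (odds q)"
  by (rule finite_subset [of _ "{0..<2 * int q}"], force simp: evens_def odds_def, simp)+

lemma card_evens: "card (evens q) = q" and card_odds: "card (odds q) = q"
proof -
  have "evens q = (\<lambda>c. 2 * c) ` {0..<int q}"
    by (auto simp: evens_def image_def elim!: evenE)
  then show "card (evens q) = q" by (simp add: card_image inj_on_def)
  have "odds q = (\<lambda>c. 2 * c + 1) ` {0..<int q}"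
    by (auto simp: odds_def image_def elim!: oddE)
  then show "card (odds q) = q" by (simp add: card_image inj_on_def)
qed

lemma neg_residue:
  assumes "a \<in> {0..<2 * int q}"
  shows "(- a) mod (2 * int q) = (if a = 0 then 0 else 2 * int q - a)"
  using assms by (auto simp: zmod_zminus1_eq_if)

lemma pm_self_opposite: "q > 0 \<Longrightarrow> pm q 0 = {0}" "q > 0 \<Longrightarrow> pm q (int q) = {int q}"
  by (auto simp: pm_def neg_residue)

text \<open>
  Away from \<open>0\<close> and \<open>q\<close> all classes have two elements, and negation preserves parity modulo
  \<open>2q\<close>.
\<close>

lemma card_pm_free:
  assumes "finite I" "T = evens q - {0, int q} \<or> T = odds q - {0, int q}"
  shows "real (card (sep_funs (pm q) I T)) = (\<Prod>i<card I. real (card T) - 2 * real i)"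
proof -
  have T: "T \<subseteq> {0<..<2 * int q} - {int q}" using assms(2) by (auto simp: evens_def odds_def)
  have "real (card (sep_funs (pm q) I T)) = (\<Prod>i<card I. real (card T) - real 2 * real i)"
  proof (rule card_sep_funs [OF assms(1)])
    show "finite T" using assms(2) finite_evens finite_odds by auto
    fix a assume a: "a \<in> T"
    then have n: "(- a) mod (2 * int q) = 2 * int q - a" using T by (subst neg_residue) auto
    show "a \<in> pm q a \<and> pm q a \<subseteq> T \<and> card (pm q a) = 2"
      using a assms(2) unfolding pm_def n by (auto simp: evens_def odds_def)
    fix b assume "b \<in> pm q a"
    then consider "b = a" | "b = 2 * int q - a" unfolding pm_def n by auto
    then show "pm q b = pm q a"
    proof cases
      case 2
      then have "(- b) mod (2 * int q) = a" using a T by (subst neg_residue) auto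
      with 2 show ?thesis by (auto simp: pm_def n)
    qed simp
  qed
  then show ?thesis by simp
qed

lemma card_not_self_opposite:
  assumes "q > 0"
  shows "card (evens q - {0, int q}) = (if even q then q - 2 else q - 1)"
    "card (odds q - {0, int q}) = (if even q then q else q - 1)"
proof -
  have "evens q - {0, int q} = evens q - (if even q then {0, int q} else {0})"
    "odds q - {0, int q} = odds q - (if even q then {} else {int q})"
    by (auto simp: evens_def odds_def)
  moreover have "(if even q then {0, int q} else {0}) \<subseteq> evens q"
    "(if even q then {} else {int q}) \<subseteq> odds q"
    using assms by (auto simp: evens_def odds_def)
  ultimately show "card (evens q - {0, int q}) = (if even q then q - 2 else q - 1)"
    "card (odds q - {0, int q}) = (if even q then q else q - 1)"
    using assms by (auto simp: card_Diff_subset card_evens card_odds)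
qed

lemma pm_not_self_opposite:
  assumes "a \<in> {0..<2 * int q} - {0, int q}"
  shows "0 \<notin> pm q a" "int q \<notin> pm q a"
  using assms by (auto simp: pm_def neg_residue)

text \<open>
  For odd \<open>q\<close> each parity contains exactly one of the self-opposite residues \<open>0\<close> and \<open>q\<close>.
\<close>

lemma card_pm_odd:
  fixes I :: "'i set"
  assumes "finite I" "odd q" "T \<in> {evens q, odds q}"
  shows "real (card (sep_funs (pm q) I T)) = (\<Prod>i<card I. real q - 1 - 2 * real i)
     + real (card I) * (\<Prod>i<card I - 1. real q - 1 - 2 * real i)"
proof -
  have q: "q > 0" using assms(2) by (cases q) auto
  define F where "F = T - {0, int q}"
  have "evens q = insert 0 (evens q - {0, int q})" "odds q = insert (int q) (odds q - {0, int q})"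
    using assms(2) q by (auto simp: evens_def odds_def)
  then obtain z where zc: "z \<in> {0, int q}" and T: "T = insert z F"
    using assms(3) unfolding F_def by blast
  have F: "F = evens q - {0, int q} \<or> F = odds q - {0, int q}" using assms(3) by (auto simp: F_def)
  have cF: "card F = q - 1" using F card_not_self_opposite[OF q] assms(2) by auto
  have sub: "a \<in> {0..<2 * int q} - {0, int q}" if "a \<in> F" for a using that F by (auto simp: evens_def odds_def)
  have "card (sep_funs (pm q) I T) = card (sep_funs (pm q) I F) + (\<Sum>i\<in>I. card (sep_funs (pm q) (I - {i}) F))"
    unfolding T
  proof (rule card_sep_funs_insert [OF assms(1)])
    show "finite F" using F finite_evens finite_odds by auto
    show "z \<notin> F" using zc by (auto simp: F_def)
    show "z \<notin> pm q a" if "a \<in> F" for a using pm_not_self_opposite[OF sub[OF that]] zc by auto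
    show "pm q z = {z}" using zc pm_self_opposite q by auto
  qed
  then have "real (card (sep_funs (pm q) I T)) = real (card (sep_funs (pm q) I F)) + (\<Sum>i\<in>I. real (card (sep_funs (pm q) (I - {i}) F)))"
    by simp
  moreover have "real (card (sep_funs (pm q) J F)) = (\<Prod>i<card J. real q - 1 - 2 * real i)"
    if "finite J" for J :: "'i set"
    using card_pm_free[OF that F] q by (simp add: cF of_nat_diff)
  ultimately show ?thesis using assms(1) by simp
qed

lemma card_pm_even_odds:
  assumes "finite I" "even q" "q > 0"
  shows "real (card (sep_funs (pm q) I (odds q))) = (\<Prod>i<card I. real q - 2 * real i)"
proof -
  have "odds q = odds q - {0, int q}" using assms by (auto simp: odds_def)
  then show ?thesis using card_pm_free[of I "odds q" q] assms card_odds by simp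
qed

text \<open>
  For even \<open>q\<close> both self-opposite residues are even; the three terms record how many of them
  occur.
\<close>

lemma card_pm_even_evens:
  fixes I :: "'i set"
  assumes "finite I" "even q" "q > 0" and n: "n = card I"
  shows "real (card (sep_funs (pm q) I (evens q))) = (\<Prod>i<n. real q - 2 - 2 * real i)
     + 2 * real n * (\<Prod>i<n - 1. real q - 2 - 2 * real i)
     + real n * real (n - 1) * (\<Prod>i<n - 2. real q - 2 - 2 * real i)"
proof -
  define F where "F = evens q - {0, int q}"
  have q2: "q \<ge> 2" using assms(2,3) by (cases q; cases "q - 1") auto
  have F: "F = evens q - {0, int q} \<or> F = odds q - {0, int q}" by (auto simp: F_def)
  have fin: "finite F" by (auto simp: F_def finite_evens)
  have E: "evens q = insert 0 (insert (int q) F)" using assms by (auto simp: F_def evens_def)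
  have sub: "a \<in> {0..<2 * int q} - {0, int q}" if "a \<in> F" for a using that by (auto simp: evens_def F_def)
  define C where "C k = (\<Prod>i<k. real q - 2 - 2 * real i)" for k
  have base: "real (card (sep_funs (pm q) J F)) = C (card J)" if "finite J" for J :: "'i set"
    using card_pm_free[OF that F] card_not_self_opposite(1)[OF assms(3)] assms(2) q2
    by (simp add: F_def C_def of_nat_diff)
  have mid: "real (card (sep_funs (pm q) J (insert (int q) F))) = C (card J) + real (card J) * C (card J - 1)"
    if J: "finite J" for J :: "'i set"
  proof -
    have "card (sep_funs (pm q) J (insert (int q) F)) = card (sep_funs (pm q) J F) + (\<Sum>i\<in>J. card (sep_funs (pm q) (J - {i}) F))"
      by (rule card_sep_funs_insert [OF J fin])
        (use pm_not_self_opposite sub pm_self_opposite assms(3) in \<open>auto simp: F_def\<close>)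
    then have "real (card (sep_funs (pm q) J (insert (int q) F))) = real (card (sep_funs (pm q) J F)) + (\<Sum>i\<in>J. real (card (sep_funs (pm q) (J - {i}) F)))"
      by simp
    also have "\<dots> = C (card J) + (\<Sum>i\<in>J. C (card J - 1))" using base J by simp
    finally show ?thesis by simp
  qed
  have "card (sep_funs (pm q) I (evens q)) = card (sep_funs (pm q) I (insert (int q) F)) + (\<Sum>i\<in>I. card (sep_funs (pm q) (I - {i}) (insert (int q) F)))"
    unfolding E
  proof (rule card_sep_funs_insert [OF assms(1)])
    show "0 \<notin> pm q a" if "a \<in> insert (int q) F" for a
      using that pm_not_self_opposite(1)[OF sub] pm_self_opposite(2)[OF assms(3)] assms(3) by auto
  qed (use fin assms(3) pm_self_opposite in \<open>auto simp: F_def\<close>)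
  then have "real (card (sep_funs (pm q) I (evens q))) = real (card (sep_funs (pm q) I (insert (int q) F))) + (\<Sum>i\<in>I. real (card (sep_funs (pm q) (I - {i}) (insert (int q) F))))"
    by simp
  also have "\<dots> = C n + real n * C (n - 1) + (\<Sum>i\<in>I. C (n - 1) + real (n - 1) * C (n - 2))"
    using mid assms(1) by (simp add: n numeral_2_eq_2)
  also have "\<dots> = C n + 2 * real n * C (n - 1) + real n * real (n - 1) * C (n - 2)"
    using n by (simp add: algebra_simps)
  finally show ?thesis by (simp add: C_def)
qed

section \<open>Residue vectors and fixed cosets\<close>

lemma pm_iff:
  assumes "a \<in> {0..<2 * int q}" "b \<in> {0..<2 * int q}"
  shows "b \<in> pm q a \<longleftrightarrow> 2 * int q dvd a - b \<or> 2 * int q dvd a + b"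
proof -
  have "b = a \<longleftrightarrow> a mod (2 * int q) = b mod (2 * int q)" using assms by auto
  moreover have "b = (- a) mod (2 * int q) \<longleftrightarrow> (- a) mod (2 * int q) = b mod (2 * int q)" using assms by auto
  moreover have "2 * int q dvd (- a) - b \<longleftrightarrow> 2 * int q dvd a + b"
    using dvd_minus_iff[of "2 * int q" "a + b"] by (simp add: algebra_simps)
  ultimately show ?thesis by (simp add: pm_def mod_eq_dvd_iff)
qed

lemma residue_eq_iff:
  assumes "a \<in> {0..<n}" "b \<in> {0..<n}"
  shows "a = b \<longleftrightarrow> n dvd a - (b :: int)"
proof -
  have "a = b \<longleftrightarrow> a mod n = b mod n" using assms by auto
  then show ?thesis by (simp add: mod_eq_dvd_iff)
qed

context type_D
begin

definition half_vec :: "(nat \<Rightarrow> int) \<Rightarrow> 'a" where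
  "half_vec a = of_coords (\<lambda>i. of_int (a i) / 2)"

lemma coord_half_vec [simp]: "i \<in> {1..l} \<Longrightarrow> e i \<bullet> half_vec a = of_int (a i) / 2"
  by (simp add: half_vec_def)

definition qZ :: "nat \<Rightarrow> 'a set" where "qZ q = (\<lambda>z. real q *\<^sub>R z) ` Z"

lemma qZ_iff:
  "x \<in> qZ q \<longleftrightarrow> (\<exists>b. same_parity b \<and> (\<forall>i\<in>{1..l}. e i \<bullet> x = real q * of_int (b i) / 2))"
proof
  assume "x \<in> qZ q"
  then obtain z where z: "z \<in> Z" "x = real q *\<^sub>R z" unfolding qZ_def by blast
  then obtain b where "same_parity b" "\<And>i. i \<in> {1..l} \<Longrightarrow> e i \<bullet> z = of_int (b i) / 2"
    unfolding lattice_iff by blast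
  then show "\<exists>b. same_parity b \<and> (\<forall>i\<in>{1..l}. e i \<bullet> x = real q * of_int (b i) / 2)"
    using z(2) by (intro exI [of _ b]) simp
next
  assume "\<exists>b. same_parity b \<and> (\<forall>i\<in>{1..l}. e i \<bullet> x = real q * of_int (b i) / 2)"
  then obtain b where b: "same_parity b" "\<And>i. i \<in> {1..l} \<Longrightarrow> e i \<bullet> x = real q * of_int (b i) / 2" by blast
  have "x = real q *\<^sub>R half_vec b" by (rule coord_eqI) (simp add: b(2))
  moreover have "half_vec b \<in> Z" unfolding lattice_iff using b(1) by (intro exI [of _ b]) simp
  ultimately show "x \<in> qZ q" unfolding qZ_def by blast
qed

lemma qZ_0: "0 \<in> qZ q"
  unfolding qZ_def using lattice_0 by (intro image_eqI [of _ _ 0]) auto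

lemma qZ_diff: "x \<in> qZ q \<Longrightarrow> y \<in> qZ q \<Longrightarrow> x - y \<in> qZ q"
  unfolding qZ_def using lattice_diff by (auto simp: scaleR_diff_right [symmetric])

lemma qZ_signed_perm: assumes "w \<in> signed_perms" "x \<in> qZ q" shows "w x \<in> qZ q"
proof -
  obtain z where z: "z \<in> Z" "x = real q *\<^sub>R z" using assms(2) unfolding qZ_def by blast
  then have "w x = real q *\<^sub>R w z" using signed_perm_linear[OF assms(1)] by (simp add: linear_cmul)
  then show ?thesis using lattice_signed_perm[OF assms(1) z(1)] unfolding qZ_def by blast
qed

lemma half_vec_diff_qZ:
  "half_vec a - half_vec c \<in> qZ q \<longleftrightarrow> (\<exists>b. same_parity b \<and> (\<forall>i\<in>{1..l}. a i - c i = int q * b i))"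
proof -
  have "e i \<bullet> (half_vec a - half_vec c) = real q * of_int (b i) / 2 \<longleftrightarrow> a i - c i = int q * b i"
    if "i \<in> {1..l}" for i b
  proof -
    have "e i \<bullet> (half_vec a - half_vec c) = of_int (a i - c i) / 2"
      using that by (simp add: inner_diff_right diff_divide_distrib)
    moreover have "real q * of_int (b i) = of_int (int q * b i)" by simp
    ultimately show ?thesis by (metis div_by_1 divide_cancel_right of_int_eq_iff zero_neq_numeral)
  qed
  then show ?thesis unfolding qZ_iff by auto
qed

lemma half_vec_in_lattice: "same_parity a \<Longrightarrow> half_vec a \<in> Z"
  unfolding lattice_iff by (intro exI [of _ a]) simp

lemma half_multiple: "(\<exists>k::int. of_int m / 2 = real q * of_int k) \<longleftrightarrow> 2 * int q dvd m"
proof -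
  have "real_of_int m / 2 = real q * of_int k \<longleftrightarrow> m = 2 * int q * k" for k
  proof -
    have "real_of_int m / 2 = real q * of_int k \<longleftrightarrow> real_of_int m = of_int (2 * int q * k)"
      by (auto simp: field_simps)
    then show ?thesis by (simp only: of_int_eq_iff)
  qed
  then show ?thesis by (simp add: dvd_def)
qed

text \<open>
  The factor \<open>1/2\<close> in the coordinates turns congruences modulo \<open>q\<close> into congruences modulo \<open>2q\<close>.
\<close>

lemma roots_avoid_iff:
  "(\<forall>\<beta>\<in>roots. \<not> (\<exists>k::int. \<beta> \<bullet> half_vec a = real q * of_int k)) \<longleftrightarrow>
   (\<forall>i\<in>{1..l}. \<forall>k\<in>{1..l}. i \<noteq> k \<longrightarrow> \<not> 2 * int q dvd a i - a k \<and> \<not> 2 * int q dvd a i + a k)"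
   (is "?L \<longleftrightarrow> ?R")
proof
  assume L: ?L
  show ?R
  proof (intro ballI impI)
    fix i k assume ik: "i \<in> {1..l}" "k \<in> {1..l}" "i \<noteq> k"
    have "(e i - e k) \<bullet> half_vec a = of_int (a i - a k) / 2" "(e i + e k) \<bullet> half_vec a = of_int (a i + a k) / 2"
      using ik by (simp_all add: inner_diff_left inner_add_left diff_divide_distrib add_divide_distrib)
    then show "\<not> 2 * int q dvd a i - a k \<and> \<not> 2 * int q dvd a i + a k"
      using L root_I[OF ik] unfolding half_multiple [symmetric] by metis
  qed
next
  assume R: ?R
  show ?L
  proof
    fix \<beta> assume "\<beta> \<in> roots"
    then obtain u v i k where *: "u \<in> {1, -1}" "v \<in> {1, -1}" "1 \<le> i" "i < k" "k \<le> l"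
      "\<beta> = u *\<^sub>R e i + v *\<^sub>R e k" by (rule root_E)
    have ik: "i \<in> {1..l}" "k \<in> {1..l}" "i \<noteq> k" using * by auto
    have b: "\<beta> \<bullet> half_vec a = u * of_int (a i) / 2 + v * of_int (a k) / 2"
      using ik by (simp add: *(6) inner_add_left)
    obtain m where m: "m \<in> {a i + a k, a i - a k, - (a i + a k), - (a i - a k)}" "\<beta> \<bullet> half_vec a = of_int m / 2"
      using that[of "a i + a k"] that[of "a i - a k"] that[of "- (a i + a k)"] that[of "- (a i - a k)"]
        *(1,2) b by (auto simp: field_simps)
    have "\<not> 2 * int q dvd a i - a k" "\<not> 2 * int q dvd a i + a k" using R ik by blast+
    then have "\<not> 2 * int q dvd m" using m(1) by (auto simp only: dvd_minus_iff insert_iff)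
    then show "\<not> (\<exists>k::int. \<beta> \<bullet> half_vec a = real q * of_int k)" unfolding m(2) half_multiple .
  qed
qed

text \<open>
  Representatives of the elements of \<open>M(\<Phi>;q)\<close>, with doubled coordinates; the union over the two
  parities corresponds to the integral and the half-integral coweights.
\<close>

definition res_vectors :: "nat \<Rightarrow> (nat \<Rightarrow> int) set" where
  "res_vectors q = sep_funs (pm q) {1..l} (evens q) \<union> sep_funs (pm q) {1..l} (odds q)"

lemma res_vectors_range: "a \<in> res_vectors q \<Longrightarrow> i \<in> {1..l} \<Longrightarrow> a i \<in> {0..<2 * int q}"
  unfolding res_vectors_def using sep_funs_mem[of a _ _ _ i] by (fastforce simp: evens_def odds_def)

lemma res_vectors_undefined: "a \<in> res_vectors q \<Longrightarrow> i \<notin> {1..l} \<Longrightarrow> a i = undefined"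
  unfolding res_vectors_def by (elim UnE) (rule sep_funs_undefined, assumption+)+

lemma res_vectors_sep:
  assumes "a \<in> res_vectors q" "i \<in> {1..l}" "k \<in> {1..l}" "i \<noteq> k"
  shows "\<not> 2 * int q dvd a i - a k" "\<not> 2 * int q dvd a i + a k"
proof -
  have "a k \<notin> pm q (a i)"
    using assms sep_funs_sep[OF _ assms(2-4)] unfolding res_vectors_def by blast
  then show "\<not> 2 * int q dvd a i - a k" "\<not> 2 * int q dvd a i + a k"
    using pm_iff[OF res_vectors_range[OF assms(1,2)] res_vectors_range[OF assms(1,3)]] by auto
qed

lemma res_vectors_parity: assumes "a \<in> res_vectors q" shows "same_parity a"
proof -
  have "1 \<in> {1..l}" using l_ge by simp
  then show ?thesis
    using assms sep_funs_mem[of a "pm q" "{1..l}"] unfolding res_vectors_def same_parity_def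
    by (auto simp: evens_def odds_def simp del: atLeastAtMost_iff)
qed

lemma res_vectors_I:
  assumes par: "same_parity a" and range: "\<And>i. i \<in> {1..l} \<Longrightarrow> a i \<in> {0..<2 * int q}"
    and und: "\<And>i. i \<notin> {1..l} \<Longrightarrow> a i = undefined"
    and sep: "\<And>i k. i \<in> {1..l} \<Longrightarrow> k \<in> {1..l} \<Longrightarrow> i \<noteq> k \<Longrightarrow> \<not> 2 * int q dvd a i - a k \<and> \<not> 2 * int q dvd a i + a k"
  shows "a \<in> res_vectors q"
proof -
  have S: "a \<in> sep_funs (pm q) {1..l} T" if T: "\<And>i. i \<in> {1..l} \<Longrightarrow> a i \<in> T" for T
  proof (rule sep_funs_I [OF T und])
    show "a k \<notin> pm q (a i)" if "i \<in> {1..l}" "k \<in> {1..l}" "i \<noteq> k" for i k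
      using pm_iff[OF range[OF that(1)] range[OF that(2)]] sep[OF that] by simp
  qed
  show ?thesis
  proof (cases "even (a 1)")
    case True
    then have "a i \<in> evens q" if "i \<in> {1..l}" for i
      using par range[OF that] that unfolding same_parity_def evens_def by blast
    then show ?thesis using S unfolding res_vectors_def by blast
  next
    case False
    then have "a i \<in> odds q" if "i \<in> {1..l}" for i
      using par range[OF that] that unfolding same_parity_def odds_def by blast
    then show ?thesis using S unfolding res_vectors_def by blast
  qed
qed

lemma finite_res_vectors: "finite (res_vectors q)"
  unfolding res_vectors_def by (intro finite_UnI finite_sep_funs finite_evens finite_odds) auto

definition res_coset :: "nat \<Rightarrow> (nat \<Rightarrow> int) \<Rightarrow> 'a set" where
  "res_coset q a = coset (qZ q) (half_vec a)"

lemma res_coset_eq_iff: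
  "res_coset q a = res_coset q c \<longleftrightarrow> (\<exists>b. same_parity b \<and> (\<forall>i\<in>{1..l}. a i - c i = int q * b i))"
  unfolding res_coset_def half_vec_diff_qZ [symmetric] by (rule coset_eq_iff) (auto intro: qZ_0 qZ_diff)

definition reduce :: "nat \<Rightarrow> (nat \<Rightarrow> int) \<Rightarrow> nat \<Rightarrow> int" where
  "reduce q a = restrict (\<lambda>i. a i mod (2 * int q)) {1..l}"

lemma reduce_in_res_vectors:
  assumes "q > 0" "same_parity a"
    "\<And>i k. i \<in> {1..l} \<Longrightarrow> k \<in> {1..l} \<Longrightarrow> i \<noteq> k \<Longrightarrow> \<not> 2 * int q dvd a i - a k \<and> \<not> 2 * int q dvd a i + a k"
  shows "reduce q a \<in> res_vectors q"
proof (rule res_vectors_I)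
  have one: "1 \<in> {1..l}" using l_ge by simp
  have "even (a i mod (2 * int q)) = even (a i)" for i by (simp add: dvd_mod_iff)
  then have par: "even (reduce q a i) = even (a i)" if "i \<in> {1..l}" for i
    using that by (simp only: reduce_def restrict_apply if_True)
  show "same_parity (reduce q a)"
    unfolding same_parity_def
  proof
    fix i assume i: "i \<in> {1..l}"
    then have "even (a i) = even (a 1)" using assms(2) unfolding same_parity_def by blast
    then show "even (reduce q a i) = even (reduce q a 1)" by (simp only: par[OF i] par[OF one])
  qed
  show "reduce q a i \<in> {0..<2 * int q}" if "i \<in> {1..l}" for i using that assms(1) by (simp add: reduce_def)
  show "reduce q a i = undefined" if "i \<notin> {1..l}" for i using that unfolding reduce_def by (simp only: restrict_apply if_False)
  show "\<not> 2 * int q dvd reduce q a i - reduce q a k \<and> \<not> 2 * int q dvd reduce q a i + reduce q a k"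
    if "i \<in> {1..l}" "k \<in> {1..l}" "i \<noteq> k" for i k
    using assms(3)[OF that] that(1,2) by (simp add: reduce_def dvd_eq_mod_eq_0 mod_simps)
qed

lemma res_coset_reduce: "res_coset q (reduce q a) = res_coset q a"
  unfolding res_coset_eq_iff
proof (intro exI [of _ "\<lambda>i. - 2 * (a i div (2 * int q))"] conjI ballI)
  show "same_parity (\<lambda>i. - 2 * (a i div (2 * int q)))" by (simp add: same_parity_def)
  fix i assume "i \<in> {1..l}"
  then show "reduce q a i - a i = int q * (- 2 * (a i div (2 * int q)))"
    using mult_div_mod_eq[of "2 * int q" "a i"] by (simp add: reduce_def algebra_simps)
qed

lemma M_compl_eq: assumes "q > 0" shows "M_compl l e q = res_coset q ` res_vectors q"
proof (intro equalityI subsetI)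
  fix t assume "t \<in> M_compl l e q"
  then obtain x where x: "t = coset (qZ q) x" "x \<in> Z" "\<forall>\<beta>\<in>roots. \<not> (\<exists>k::int. \<beta> \<bullet> x = real q * of_int k)"
    unfolding M_compl_def qZ_def by blast
  obtain a where a: "same_parity a" "\<And>i. i \<in> {1..l} \<Longrightarrow> e i \<bullet> x = of_int (a i) / 2"
    using x(2) unfolding lattice_iff by blast
  have xa: "x = half_vec a" by (rule coord_eqI) (simp add: a(2))
  have sep: "\<forall>i\<in>{1..l}. \<forall>k\<in>{1..l}. i \<noteq> k \<longrightarrow> \<not> 2 * int q dvd a i - a k \<and> \<not> 2 * int q dvd a i + a k"
    using x(3) unfolding xa roots_avoid_iff .
  have "reduce q a \<in> res_vectors q"
    by (rule reduce_in_res_vectors [OF assms a(1)]) (use sep in blast)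
  moreover have "t = res_coset q (reduce q a)" unfolding res_coset_reduce by (simp add: res_coset_def x xa)
  ultimately show "t \<in> res_coset q ` res_vectors q" by blast
next
  fix t assume "t \<in> res_coset q ` res_vectors q"
  then obtain a where a: "a \<in> res_vectors q" "t = coset (qZ q) (half_vec a)" unfolding res_coset_def by blast
  have "\<forall>\<beta>\<in>roots. \<not> (\<exists>k::int. \<beta> \<bullet> half_vec a = real q * of_int k)"
    unfolding roots_avoid_iff using res_vectors_sep[OF a(1)] by blast
  then show "t \<in> M_compl l e q"
    using a(2) half_vec_in_lattice[OF res_vectors_parity[OF a(1)]] unfolding M_compl_def qZ_def by blast
qed

text \<open>
  Two vectors represent the same coset if and only if they differ by \<open>q b\<close>, where the entries of
  \<open>b\<close> have one parity. If they are even, the vectors agree modulo \<open>2q\<close>; if they are odd, the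
  vectors differ by \<open>q\<close> in each entry. So every coset has exactly two representatives.
\<close>

lemma chi_double:
  assumes w: "w \<in> signed_perms" and q: "q > 0"
  shows "2 * chi l e q w = card {a \<in> res_vectors q. w (half_vec a) - half_vec a \<in> qZ q}"
proof -
  define S where "S = {a \<in> res_vectors q. w (half_vec a) - half_vec a \<in> qZ q}"
  have fixed: "w ` res_coset q a = res_coset q a \<longleftrightarrow> w (half_vec a) - half_vec a \<in> qZ q" for a
  proof -
    have "w ` res_coset q a = coset (qZ q) (w (half_vec a))"
      unfolding res_coset_def by (rule image_coset [OF w]) (erule (1) qZ_signed_perm)
    then show ?thesis unfolding res_coset_def
      using coset_eq_iff[OF qZ_0 qZ_diff] by auto
  qed
  then have S: "S = {a \<in> res_vectors q. w ` res_coset q a = res_coset q a}" unfolding S_def by simp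
  have img: "{t \<in> M_compl l e q. w ` t = t} = res_coset q ` S"
    unfolding M_compl_eq[OF q] S by auto
  have fin: "finite S" unfolding S_def using finite_res_vectors by simp
  have one: "1 \<in> {1..l}" using l_ge by simp
  have fibre: "card {c \<in> S. res_coset q c = res_coset q a} = 2" if a: "a \<in> S" for a
  proof -
    \<comment> \<open>The second representative: \<open>q\<close> times the half-integral coweight \<open>(1/2, \<dots>, 1/2)\<close>
      is added.\<close>
    define s where "s = reduce q (\<lambda>i. a i + int q)"
    have aR: "a \<in> res_vectors q" using a S by simp
    have cs: "res_coset q s = res_coset q a"
      unfolding s_def res_coset_reduce res_coset_eq_iff by (intro exI [of _ "\<lambda>_. 1"]) (simp add: same_parity_def)
    have sR: "s \<in> res_vectors q"
      unfolding s_def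
    proof (rule reduce_in_res_vectors [OF q])
      show "same_parity (\<lambda>i. a i + int q)"         using res_vectors_parity[OF aR] unfolding same_parity_def by (metis even_add)
      fix i k assume ik: "i \<in> {1..l}" "k \<in> {1..l}" "i \<noteq> k"
      have "a i + int q + (a k + int q) = a i + a k + 2 * int q" by simp
      then show "\<not> 2 * int q dvd a i + int q - (a k + int q) \<and> \<not> 2 * int q dvd a i + int q + (a k + int q)"
        using res_vectors_sep[OF aR ik] by (simp add: dvd_add_left_iff)
    qed
    have sS: "s \<in> S" using sR cs a unfolding S by simp
    have "s 1 \<noteq> a 1"
    proof
      assume "s 1 = a 1"
      then have "(a 1 + int q) mod (2 * int q) = a 1 mod (2 * int q)"
        using one res_vectors_range[OF aR one] by (simp add: s_def reduce_def)
      then have "2 * int q dvd int q" by (simp add: mod_eq_dvd_iff)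
      then show False using q by (auto dest!: zdvd_imp_le)
    qed
    then have ne: "s \<noteq> a" by auto
    have "c = a \<or> c = s" if c: "c \<in> S" "res_coset q c = res_coset q a" for c
    proof -
      have cR: "c \<in> res_vectors q" using c(1) S by simp
      obtain b where b: "same_parity b" "\<And>i. i \<in> {1..l} \<Longrightarrow> c i - a i = int q * b i"
        using c(2) unfolding res_coset_eq_iff by blast
      have ext: "c = d" if d: "d \<in> res_vectors q" "\<And>i. i \<in> {1..l} \<Longrightarrow> 2 * int q dvd c i - d i" for d
      proof
        fix i show "c i = d i"
        proof (cases "i \<in> {1..l}")
          case True
          then show ?thesis
            using residue_eq_iff[OF res_vectors_range[OF cR True] res_vectors_range[OF d(1) True]] d(2) by simp
        next
          case False
          then show ?thesis using res_vectors_undefined[OF cR False] res_vectors_undefined[OF d(1) False] by simp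
        qed
      qed
      show ?thesis
      proof (cases "even (b 1)")
        case True
        have "2 * int q dvd c i - a i" if i: "i \<in> {1..l}" for i
        proof -
          have "even (b i)" using b(1) i True unfolding same_parity_def by blast
          then show ?thesis unfolding b(2)[OF i] by (simp add: mult.commute mult_dvd_mono)
        qed
        then show ?thesis using ext[OF aR] by simp
      next
        case False
        have "2 * int q dvd c i - s i" if i: "i \<in> {1..l}" for i
        proof -
          have "odd (b i)" using b(1) i False unfolding same_parity_def by blast
          then obtain m where m: "b i = 2 * m + 1" by (rule oddE)
          have "c i mod (2 * int q) = (a i + int q) mod (2 * int q)"
          proof -
            have "c i - (a i + int q) = 2 * int q * m" using b(2)[OF i] m by (simp add: algebra_simps)
            then show ?thesis by (simp add: mod_eq_dvd_iff)
          qed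
          then have "c i mod (2 * int q) = s i mod (2 * int q)" using i by (simp add: s_def reduce_def)
          then show ?thesis by (simp add: mod_eq_dvd_iff)
        qed
        then show ?thesis using ext[OF sR] by simp
      qed
    qed
    then have "{c \<in> S. res_coset q c = res_coset q a} = {a, s}" using a sS cs by blast
    then show ?thesis using ne by simp
  qed
  have "card S = (\<Sum>a\<in>S. 1)" by simp
  also have "\<dots> = (\<Sum>t\<in>res_coset q ` S. \<Sum>a\<in>{a \<in> S. res_coset q a = t}. 1)"
    by (rule sum.image_gen [OF fin])
  also have "\<dots> = (\<Sum>t\<in>res_coset q ` S. 2)"
    by (rule sum.cong) (use fibre in auto)
  finally show ?thesis using img unfolding chi_def S_def [symmetric] by simp
qed

end

section \<open>Congruence up to sign modulo q\<close>

lemma dvd_iff_if_dvd_diff: "(n::int) dvd x - y \<Longrightarrow> n dvd x \<longleftrightarrow> n dvd y"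
  by (metis dvd_eq_mod_eq_0 mod_eq_dvd_iff)

lemma small_multiple:
  assumes "(n::int) dvd x" "- 2 * n < x" "x < 4 * n"
  shows "x \<in> {- n, 0, n, 2 * n, 3 * n}"
proof -
  obtain k where k: "x = n * k" using assms(1) by (rule dvdE)
  have n: "0 < n" using assms by linarith
  have "n * (- 2) < n * k" "n * k < n * 4" using assms(2,3) unfolding k by linarith+
  then have "- 2 < k" "k < 4" using n by (simp_all only: mult_less_cancel_left_pos)
  then have "k \<in> {-1, 0, 1, 2, 3}" by auto
  then show ?thesis unfolding k by auto
qed

lemma dvd_double:
  assumes "int q dvd x"
  shows "2 * int q dvd x \<or> 2 * int q dvd x - int q"
proof -
  obtain k where k: "x = int q * k" using assms by (rule dvdE)
  show ?thesis
  proof (cases "even k")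
    case True
    then show ?thesis unfolding k by (auto elim!: evenE)
  next
    case False
    then obtain j where "k = 2 * j + 1" by (rule oddE)
    then have "x - int q = 2 * int q * j" unfolding k by (simp add: algebra_simps)
    then show ?thesis by simp
  qed
qed

text \<open>
  The class of a residue modulo \<open>2q\<close> under congruence up to sign modulo \<open>q\<close>, that is, its orbit
  under \<open>a \<mapsto> - a\<close> and \<open>a \<mapsto> q - a\<close>.
\<close>

definition pm_half :: "nat \<Rightarrow> int \<Rightarrow> int set" where
  "pm_half q a = {b \<in> {0..<2 * int q}. int q dvd a - b \<or> int q dvd a + b}"

lemma pm_half_eq:
  assumes "b \<in> pm_half q a"
  shows "pm_half q b = pm_half q a"
proof -
  have "(int q dvd b - c \<or> int q dvd b + c) \<longleftrightarrow> (int q dvd a - c \<or> int q dvd a + c)" for c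
  proof -
    consider "int q dvd a - b" | "int q dvd a + b" using assms unfolding pm_half_def by blast
    then show ?thesis
    proof cases
      case 1
      then have "int q dvd (a - c) - (b - c)" "int q dvd (a + c) - (b + c)" by simp_all
      from this[THEN dvd_iff_if_dvd_diff] show ?thesis by blast
    next
      case 2
      then have "int q dvd (a - c) - (- (b + c))" "int q dvd (a + c) - (- (b - c))" by (simp_all add: algebra_simps)
      from this[THEN dvd_iff_if_dvd_diff] show ?thesis unfolding dvd_minus_iff by blast
    qed
  qed
  then show ?thesis unfolding pm_half_def by simp
qed

lemma pm_half_self: "a \<in> {0..<2 * int q} \<Longrightarrow> a \<in> pm_half q a"
  by (simp add: pm_half_def)

lemma pm_half_sym: "b \<in> pm_half q a \<Longrightarrow> a \<in> {0..<2 * int q} \<Longrightarrow> a \<in> pm_half q b"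
  using pm_half_eq pm_half_self by blast

lemma pm_half_cases:
  assumes "a \<in> {0..<2 * int q}" "b \<in> pm_half q a"
  shows "b \<in> {a, a - int q, a + int q, - a, int q - a, 2 * int q - a, 3 * int q - a}"
proof -
  have b: "0 \<le> b" "b < 2 * int q" using assms(2) by (auto simp: pm_half_def)
  from assms(2) consider "int q dvd a - b" | "int q dvd a + b" unfolding pm_half_def by blast
  then show ?thesis
  proof cases
    case 1
    then have "a - b \<in> {- int q, 0, int q, 2 * int q, 3 * int q}"
      by (rule small_multiple) (use assms(1) b in auto)
    then show ?thesis using assms(1) b by auto
  next
    case 2
    then have "a + b \<in> {- int q, 0, int q, 2 * int q, 3 * int q}"
      by (rule small_multiple) (use assms(1) b in auto)
    then show ?thesis using assms(1) b by auto
  qed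
qed

text \<open>
  These are the classes with only two elements; all others have four (see \<open>card_pm_half\<close>).
\<close>

lemma pm_half_special:
  assumes "q > 0" "q = 2 * h"
  shows "pm_half q 0 = {0, int q}" "pm_half q (int h) = {int h, 3 * int h}"
proof -
  have "pm_half q 0 \<subseteq> {0, int q}"
  proof
    fix b assume b: "b \<in> pm_half q 0"
    then show "b \<in> {0, int q}" using pm_half_cases[OF _ b] assms(1) by (auto simp: pm_half_def)
  qed
  then show "pm_half q 0 = {0, int q}" using assms(1) by (auto simp: pm_half_def)
  have "pm_half q (int h) \<subseteq> {int h, 3 * int h}"
  proof
    fix b assume b: "b \<in> pm_half q (int h)"
    then show "b \<in> {int h, 3 * int h}" using pm_half_cases[OF _ b] assms by (auto simp: pm_half_def)
  qed
  then show "pm_half q (int h) = {int h, 3 * int h}" using assms by (auto simp: pm_half_def)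
qed

lemma card_pm_half:
  assumes "q = 2 * h" "a \<in> {0..<2 * int q} - {0, int q, int h, 3 * int h}"
  shows "card (pm_half q a) = 4"
proof -
  define x y where "x = (if a < int q then a + int q else a - int q)"
    and "y = (if a < int q then int q - a else 3 * int q - a)"
  have "pm_half q a = {a, 2 * int q - a, x, y}"
  proof
    show "pm_half q a \<subseteq> {a, 2 * int q - a, x, y}"
    proof
      fix b assume b: "b \<in> pm_half q a"
      then have "0 \<le> b" "b < 2 * int q" by (auto simp: pm_half_def)
      then show "b \<in> {a, 2 * int q - a, x, y}"
        using pm_half_cases[OF _ b] assms by (auto simp: x_def y_def)
    qed
    have "int q dvd a - x" "int q dvd a + y" "int q dvd a + (2 * int q - a)"
      by (auto simp: x_def y_def)
    then show "{a, 2 * int q - a, x, y} \<subseteq> pm_half q a"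
      using assms by (auto simp: pm_half_def x_def y_def)
  qed
  moreover have "a \<noteq> 2 * int q - a" "a \<noteq> x" "a \<noteq> y" "2 * int q - a \<noteq> x" "2 * int q - a \<noteq> y" "x \<noteq> y"
    using assms by (auto simp: x_def y_def)
  ultimately show ?thesis by simp
qed

lemma card_sep_pm_half:
  assumes q: "q > 0" "q = 2 * h" "even h" and I: "finite I"
    and T: "T = evens q - pm_half q 0 - pm_half q (int h)"
  shows "real (card (sep_funs (pm_half q) I T)) = (\<Prod>i<card I. real q - 4 - 4 * real i)"
proof -
  have h: "h > 0" using q by simp
  have "T = evens q - {0, int q, int h, 3 * int h}" unfolding T pm_half_special[OF q(1,2)] by blast
  moreover have "{0, int q, int h, 3 * int h} \<subseteq> evens q" using q h by (auto simp: evens_def)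
  moreover have "card {0, int q, int h, 3 * int h} = 4" using q h by simp
  ultimately have cT: "card T = q - 4" and q4: "4 \<le> q"
    using card_mono[of "evens q" "{0, int q, int h, 3 * int h}"]
    by (simp_all add: card_Diff_subset card_evens finite_evens)
  have "real (card (sep_funs (pm_half q) I T)) = (\<Prod>i<card I. real (card T) - real 4 * real i)"
  proof (rule card_sep_funs [OF I])
    show "finite T" unfolding T using finite_evens by simp
    fix a assume a: "a \<in> T"
    then have ar: "a \<in> {0..<2 * int q}" and ae: "even a" by (auto simp: T evens_def)
    have sub: "pm_half q a \<subseteq> T"
    proof
      fix b assume b: "b \<in> pm_half q a"
      have "even b"
      proof -
        have "2 dvd int q" using q by simp
        moreover have "int q dvd a - b \<or> int q dvd a + b" using b by (simp add: pm_half_def)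
        ultimately have "2 dvd a - b \<or> 2 dvd a + b" using dvd_trans by blast
        then show ?thesis using ae by simp
      qed
      then have "b \<in> evens q" using b by (simp add: evens_def pm_half_def)
      moreover have "b \<notin> pm_half q c" if "a \<notin> pm_half q c" for c
        using pm_half_eq[of b q c] pm_half_eq[OF b] pm_half_self[OF ar] that by blast
      ultimately show "b \<in> T" using a unfolding T by blast
    qed
    have "a \<in> {0..<2 * int q} - {0, int q, int h, 3 * int h}"
      using a ar unfolding T pm_half_special[OF q(1,2)] by blast
    with card_pm_half[OF q(2)] sub pm_half_self[OF ar]
    show "a \<in> pm_half q a \<and> pm_half q a \<subseteq> T \<and> card (pm_half q a) = 4" by blast
    show "pm_half q b = pm_half q a" if "b \<in> pm_half q a" for b using that by (rule pm_half_eq)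
  qed
  then show ?thesis using q4 by (simp add: cT of_nat_diff)
qed

section \<open>Fixed cosets of the identity and of \<open>\<omega>\<^sub>1\<close>\<close>

context type_D_odd
begin

lemma card_res_vectors: assumes "q > 0"
  shows "card (res_vectors q) = card (sep_funs (pm q) {1..l} (evens q)) + card (sep_funs (pm q) {1..l} (odds q))"
  unfolding res_vectors_def
proof (rule card_Un_disjoint)
  have one: "1 \<in> {1..l}" using l_ge by simp
  show "sep_funs (pm q) {1..l} (evens q) \<inter> sep_funs (pm q) {1..l} (odds q) = {}"
  proof (rule equals0I)
    fix a assume "a \<in> sep_funs (pm q) {1..l} (evens q) \<inter> sep_funs (pm q) {1..l} (odds q)"
    then have "a 1 \<in> evens q" "a 1 \<in> odds q" using sep_funs_mem[OF _ one] by blast+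
    then show False by (simp add: evens_def odds_def)
  qed
qed (auto intro: finite_sep_funs finite_evens finite_odds)

lemma chi_id_card: assumes "q > 0"
  shows "2 * real (chi l e q id) = real (card (sep_funs (pm q) {1..l} (evens q)))
     + real (card (sep_funs (pm q) {1..l} (odds q)))"
proof -
  have "2 * chi l e q id = card (res_vectors q)" using chi_double[OF signed_perm_id assms] qZ_0 by simp
  then have "real (2 * chi l e q id) = real (card (res_vectors q))" by (simp only:)
  then show ?thesis unfolding card_res_vectors[OF assms] by simp
qed

lemma chi_id_odd:
  assumes "odd q"
  shows "real (chi l e q id) = (\<Prod>i=1..l-1. real q - (2 * real i - 1)) * (real q - (real l - 1))"
proof -
  define C where "C k = (\<Prod>i<k. real q - 1 - 2 * real i)" for k
  have q: "q > 0" using assms by (cases q) auto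
  have "2 * real (chi l e q id) = 2 * (C l + real l * C (l - 1))"
    unfolding chi_id_card[OF q] C_def using card_pm_odd[OF _ assms, of "{1..l}"] by simp
  moreover have "C l = C (l - 1) * (real q - 1 - 2 * real (l - 1))"
    using l_ge by (cases l) (simp_all add: C_def)
  moreover have "C (l - 1) = (\<Prod>i=1..l-1. real q - (2 * real i - 1))"
    unfolding C_def One_nat_def prod.atLeast1_atMost_eq by (rule prod.cong) auto
  ultimately show ?thesis using l_ge by (simp add: of_nat_diff algebra_simps)
qed

lemma chi_id_even:
  assumes "even q" "q > 0"
  shows "real (chi l e q id) = (\<Prod>i=1..l-2. real q - 2 * real i) *
         (real q ^ 2 - 2 * (real l - 1) * real q + real l * (real l - 1) / 2)"
proof -
  define C where "C k = (\<Prod>i<k. real q - 2 - 2 * real i)" for k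
  have E: "real (card (sep_funs (pm q) {1..l} (evens q))) = C l + 2 * real l * C (l - 1) + real l * real (l - 1) * C (l - 2)"
    using card_pm_even_evens[of "{1..l}" q l] assms by (simp add: C_def)
  have O: "real (card (sep_funs (pm q) {1..l} (odds q))) = real q * C (l - 1)"
  proof -
    obtain n where n: "l = Suc n" using l_ge by (cases l) auto
    have "(\<Prod>i<Suc n. real q - 2 * real i) = real q * C n"
      unfolding prod.lessThan_Suc_shift C_def by (simp add: algebra_simps)
    then show ?thesis using card_pm_even_odds[of "{1..l}" q] assms by (simp add: n)
  qed
  obtain n where n: "l = Suc (Suc n)" using l_ge by (cases l; cases "l - 1") auto
  have C1: "C (l - 1) = C n * (real q - 2 - 2 * real n)" and C2: "C l = C (l - 1) * (real q - 2 - 2 * real (Suc n))"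
    by (simp_all add: n C_def)
  have "C n = (\<Prod>i=1..l-2. real q - 2 * real i)"
    unfolding C_def n One_nat_def prod.atLeast1_atMost_eq by (simp add: algebra_simps)
  moreover have "2 * real (chi l e q id) = C l + 2 * real l * C (l - 1) + real l * real (l - 1) * C n + real q * C (l - 1)"
    unfolding chi_id_card[OF assms(2)] E O by (simp add: n)
  moreover have "\<dots> = 2 * (C n * (real q ^ 2 - 2 * (real l - 1) * real q + real l * (real l - 1) / 2))"
    unfolding C2 C1 by (simp add: n power2_eq_square algebra_simps)
  ultimately show ?thesis by simp
qed

text \<open>
  The element \<open>\<omega>\<^sub>1\<close> changes only the signs of the entries \<open>1\<close> and \<open>l\<close>. The unchanged entries
  force the multipliers of \<open>q\<close> to be even, so both changed entries are multiples of \<open>q\<close>, and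
  they are distinct.
\<close>

lemma om1_fixed_iff:
  assumes a: "a \<in> res_vectors q" and q: "q > 0"
  shows "om1 (half_vec a) - half_vec a \<in> qZ q \<longleftrightarrow> (a 1 = 0 \<and> a l = int q) \<or> (a 1 = int q \<and> a l = 0)"
proof -
  have l1: "1 \<in> {1..l}" "l \<in> {1..l}" "2 \<in> {1..l}" "1 \<noteq> l" using l_ge by auto
  define c where "c i = (if i = 1 \<or> i = l then - a i else a i)" for i
  have "om1 (half_vec a) = half_vec c" by (rule coord_eqI) (auto simp: c_def)
  then have iff: "om1 (half_vec a) - half_vec a \<in> qZ q \<longleftrightarrow> (\<exists>b. same_parity b \<and> (\<forall>i\<in>{1..l}. c i - a i = int q * b i))"
    by (simp only: half_vec_diff_qZ)
  show ?thesis
    unfolding iff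
  proof
    assume "\<exists>b. same_parity b \<and> (\<forall>i\<in>{1..l}. c i - a i = int q * b i)"
    then obtain b where b: "same_parity b" "\<And>i. i \<in> {1..l} \<Longrightarrow> c i - a i = int q * b i" by blast
    \<comment> \<open>The place \<open>2\<close> stands for any place that is left alone.\<close>
    have "b 2 = 0" using b(2)[OF l1(3)] q l_ge by (simp add: c_def)
    then have "even (b 1)" using b(1) l1(3) unfolding same_parity_def by (metis dvd_0_right)
    then have even: "even (b i)" if "i \<in> {1..l}" for i using b(1) that unfolding same_parity_def by blast
    have "a i \<in> {0, int q}" if i: "i \<in> {1, l}" for i
    proof -
      have il: "i \<in> {1..l}" using i l1 by auto
      obtain k where "b i = 2 * k" using even[OF il] by (rule evenE)
      then have "a i = int q * (- k)" using b(2)[OF il] i by (auto simp: c_def mult.commute)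
      then have "int q dvd a i" by (rule dvdI)
      then have "a i \<in> {- int q, 0, int q, 2 * int q, 3 * int q}"
        by (rule small_multiple) (use res_vectors_range[OF a il] in auto)
      then show ?thesis using res_vectors_range[OF a il] q by auto
    qed
    moreover have "a 1 \<noteq> a l" using res_vectors_sep(1)[OF a l1(1,2,4)] by auto
    ultimately show "(a 1 = 0 \<and> a l = int q) \<or> (a 1 = int q \<and> a l = 0)" by force
  next
    assume *: "(a 1 = 0 \<and> a l = int q) \<or> (a 1 = int q \<and> a l = 0)"
    define b where "b i = (if (i = 1 \<or> i = l) \<and> a i = int q then -2 else 0 :: int)" for i
    have "same_parity b" by (auto simp: same_parity_def b_def)
    moreover have "\<forall>i\<in>{1..l}. c i - a i = int q * b i" using * by (auto simp: b_def c_def)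
    ultimately show "\<exists>b. same_parity b \<and> (\<forall>i\<in>{1..l}. c i - a i = int q * b i)" by blast
  qed
qed

text \<open>
  The residues \<open>0\<close> and \<open>q\<close> have different parity.
\<close>

lemma chi_om1_odd: assumes "odd q" shows "chi l e q om1 = 0"
proof -
  have q: "q > 0" using assms by (cases q) auto
  have "False" if a: "a \<in> res_vectors q" and "om1 (half_vec a) - half_vec a \<in> qZ q" for a
  proof -
    have "even (a 1) \<noteq> even (a l)" using that om1_fixed_iff[OF a q] assms by auto
    moreover have "even (a l) = even (a 1)"
      by (rule same_parityD [OF res_vectors_parity [OF a]]) (use l_ge in simp)
    ultimately show False by simp
  qed
  then have "{a \<in> res_vectors q. om1 (half_vec a) - half_vec a \<in> qZ q} = {}" by blast
  then have "2 * chi l e q om1 = 0" unfolding chi_double[OF om_signed_perm(1) q] by (simp only: card.empty)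
  then show ?thesis by simp
qed

text \<open>
  There are two ways to distribute \<open>0\<close> and \<open>q\<close> to the two end places, which cancels the factor
  \<open>2\<close> of \<open>chi_double\<close>; the other \<open>l - 2\<close> entries avoid \<open>0\<close> and \<open>q\<close>.
\<close>

lemma chi_om1_even: assumes "even q" "q > 0"
  shows "real (chi l e q om1) = (\<Prod>i=1..l-2. real q - 2 * real i)"
proof -
  define F where "F = evens q - {0, int q}"
  define X where "X u v = {a \<in> sep_funs (pm q) {1..l} (evens q). a 1 = u \<and> a l = v}" for u v
  have l1: "1 \<in> {1..l}" "l \<in> {1..l}" "1 \<noteq> l" using l_ge by auto
  have q2: "q \<ge> 2" using assms by (cases q; cases "q - 1") auto
  have card: "card (X u v) = card (sep_funs (pm q) ({1..l} - {1} - {l}) F)"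
    if uv: "(u, v) \<in> {(0, int q), (int q, 0)}" for u v
  proof -
    have E: "evens q = pm q u \<union> (pm q v \<union> F)"
      using uv assms pm_self_opposite[OF assms(2)] by (auto simp: F_def evens_def)
    have pm: "pm q u = {u}" "pm q v = {v}" "u \<noteq> v" using uv pm_self_opposite[OF assms(2)] assms(2) by auto
    have nF: "u \<notin> pm q a" "v \<notin> pm q a" if "a \<in> F" for a
      using pm_not_self_opposite[of a q] that uv by (auto simp: F_def evens_def)
    have "u \<notin> F" "v \<notin> F" using uv by (auto simp: F_def)
    then show ?thesis
      unfolding X_def E using l1 nF pm by (intro card_sep_funs_pin2) auto
  qed
  have "{a \<in> res_vectors q. om1 (half_vec a) - half_vec a \<in> qZ q} = X 0 (int q) \<union> X (int q) 0"
  proof -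
    have "a \<in> sep_funs (pm q) {1..l} (evens q)" if a: "a \<in> res_vectors q" "even (a 1)" for a
    proof -
      have "a \<notin> sep_funs (pm q) {1..l} (odds q)"
        using sep_funs_mem[OF _ l1(1), of a "pm q" "odds q"] a(2) by (auto simp: odds_def)
      then show ?thesis using a(1) unfolding res_vectors_def by blast
    qed
    moreover have "a \<in> res_vectors q" if "a \<in> sep_funs (pm q) {1..l} (evens q)" for a
      using that unfolding res_vectors_def by blast
    ultimately show ?thesis
      using om1_fixed_iff[OF _ assms(2)] assms(1) unfolding X_def by auto
  qed
  then have "2 * chi l e q om1 = card (X 0 (int q) \<union> X (int q) 0)"
    using chi_double[OF om_signed_perm(1) assms(2)] by simp
  also have "\<dots> = card (X 0 (int q)) + card (X (int q) 0)"
  proof (rule card_Un_disjoint)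
    have fin: "finite (sep_funs (pm q) {1..l} (evens q))"
      by (intro finite_sep_funs finite_evens) simp
    show "finite (X 0 (int q))" "finite (X (int q) 0)"
      unfolding X_def by (rule rev_finite_subset [OF fin], blast)+
    show "X 0 (int q) \<inter> X (int q) 0 = {}" unfolding X_def using assms(2) by auto
  qed
  finally have "chi l e q om1 = card (sep_funs (pm q) ({1..l} - {1} - {l}) F)" using card by simp
  moreover have "real (card (sep_funs (pm q) ({1..l} - {1} - {l}) F)) = (\<Prod>i<l - 2. real (q - 2) - 2 * real i)"
  proof -
    have "card ({1..l} - {1} - {l}) = l - 2" using l1 by (simp add: card_Diff_singleton)
    then show ?thesis
      using card_pm_free[of "{1..l} - {1} - {l}" F q] card_not_self_opposite(1)[OF assms(2)] assms(1)
      by (simp add: F_def)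
  qed
  moreover have "(\<Prod>i<l - 2. real (q - 2) - 2 * real i) = (\<Prod>i=1..l-2. real q - 2 * real i)"
    unfolding One_nat_def prod.atLeast1_atMost_eq using q2 by (intro prod.cong) (auto simp: of_nat_diff)
  ultimately show ?thesis by simp
qed

end

section \<open>Fixed cosets of \<open>\<omega>\<^sub>l\<close> and its inverse\<close>

lemma double_dvd_double: "2 * n dvd 2 * x \<Longrightarrow> n dvd (x :: int)"
  by simp

context type_D_odd
begin

definition oml_residues :: "nat \<Rightarrow> (nat \<Rightarrow> int) \<Rightarrow> bool" where
  "oml_residues q a \<longleftrightarrow> (\<forall>i\<in>{1..l}. 2 * int q dvd a i + a (l + 1 - i) - int q) \<and> 2 * int q dvd a l - a 1 - int q"

text \<open>
  If the multipliers of \<open>q\<close> were even, then \<open>a\<^sub>1 = a\<^sub>l\<close> modulo \<open>2q\<close>. Hence they are odd, and the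
  congruences hold with \<open>q\<close> itself modulo \<open>2q\<close>.
\<close>

lemma oml_fixed_iff:
  assumes a: "a \<in> res_vectors q" and q: "q > 0"
  shows "oml (half_vec a) - half_vec a \<in> qZ q \<longleftrightarrow> oml_residues q a"
proof -
  have l1: "1 \<in> {1..l}" "l \<in> {1..l}" "l \<noteq> 1" using l_ge by auto
  define c where "c i = (if i = 1 then a l else - a (l + 1 - i))" for i
  have "oml (half_vec a) = half_vec c"
  proof (rule coord_eqI)
    fix i assume i: "i \<in> {1..l}"
    show "e i \<bullet> oml (half_vec a) = e i \<bullet> half_vec c"
      using i l1 coord_half_vec[OF rev_index(1)[OF i]] by (auto simp: c_def)
  qed
  then have iff: "oml (half_vec a) - half_vec a \<in> qZ q \<longleftrightarrow> (\<exists>b. same_parity b \<and> (\<forall>i\<in>{1..l}. c i - a i = int q * b i))"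
    by (simp only: half_vec_diff_qZ)
  show ?thesis
    unfolding iff
  proof
    assume "\<exists>b. same_parity b \<and> (\<forall>i\<in>{1..l}. c i - a i = int q * b i)"
    then obtain b where b: "same_parity b" "\<And>i. i \<in> {1..l} \<Longrightarrow> c i - a i = int q * b i" by blast
    \<comment> \<open>The entries \<open>1\<close> and \<open>l\<close> are exchanged up to sign, and they must stay different
      modulo \<open>2q\<close>.\<close>
    have "odd (b 1)"
    proof
      assume "even (b 1)"
      then obtain k where "b 1 = 2 * k" by (rule evenE)
      then have "a l - a 1 = 2 * int q * k" using b(2)[OF l1(1)] by (simp add: c_def)
      then have "2 * int q dvd a l - a 1" by simp
      then show False using res_vectors_sep(1)[OF a l1(2,1,3)] by simp
    qed
    then have odd: "odd (b i)" if "i \<in> {1..l}" for i using same_parityD[OF b(1) that] by simp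
    have ge2: "2 * int q dvd a i + a (l + 1 - i) - int q" if i: "i \<in> {1..l}" "i \<noteq> 1" for i
    proof -
      obtain k where "b i = 2 * k + 1" using odd[OF i(1)] by (rule oddE)
      then have "a i + a (l + 1 - i) - int q = 2 * int q * (- k - 1)"
        using b(2)[OF i(1)] i(2) by (simp add: c_def algebra_simps)
      then show ?thesis by simp
    qed
    have "2 * int q dvd a 1 + a (l + 1 - 1) - int q"
      using ge2[OF l1(2,3)] by (simp add: add.commute)
    then have "\<forall>i\<in>{1..l}. 2 * int q dvd a i + a (l + 1 - i) - int q" using ge2 by metis
    moreover have "2 * int q dvd a l - a 1 - int q"
    proof -
      obtain k where "b 1 = 2 * k + 1" using odd[OF l1(1)] by (rule oddE)
      then have "a l - a 1 - int q = 2 * int q * k"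
        using b(2)[OF l1(1)] by (simp add: c_def algebra_simps)
      then show ?thesis by simp
    qed
    ultimately show "oml_residues q a" unfolding oml_residues_def by blast
  next
    assume *: "oml_residues q a"
    have "\<forall>i\<in>{1..l}. \<exists>k. c i - a i = int q * (2 * k + 1)"
    proof
      fix i assume i: "i \<in> {1..l}"
      show "\<exists>k. c i - a i = int q * (2 * k + 1)"
      proof (cases "i = 1")
        case True
        obtain k where "a l - a 1 - int q = 2 * int q * k" using * unfolding oml_residues_def by (auto elim: dvdE)
        then have "c i - a i = int q * (2 * k + 1)" by (simp add: c_def True algebra_simps)
        then show ?thesis ..
      next
        case False
        obtain k where "a i + a (l + 1 - i) - int q = 2 * int q * k"
          using * i unfolding oml_residues_def by (blast elim: dvdE)
        then have "c i - a i = int q * (2 * (- k - 1) + 1)" using False by (simp add: c_def algebra_simps)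
        then show ?thesis ..
      qed
    qed
    then obtain k where k: "\<forall>i\<in>{1..l}. c i - a i = int q * (2 * k i + 1)" by (rule bchoice [THEN exE])
    show "\<exists>b. same_parity b \<and> (\<forall>i\<in>{1..l}. c i - a i = int q * b i)"
      by (rule exI [of _ "\<lambda>i. 2 * k i + 1"]) (use k in \<open>auto simp: same_parity_def\<close>)
  qed
qed

definition mid :: nat where "mid = (l + 1) div 2"

lemma mid: "l = 2 * mid - 1" "3 \<le> mid" "mid < l" "l + 1 - mid = mid"
  using odd_l l_ge by (auto simp: mid_def elim!: oddE)

lemma oml_residues_ends:
  assumes "oml_residues q a"
  shows "int q dvd a 1" "2 * int q dvd 2 * a mid - int q"
proof -
  have l: "l \<in> {1..l}" "mid \<in> {1..l}" using mid by auto
  have "2 * int q dvd a l + a (l + 1 - l) - int q" "2 * int q dvd a l - a 1 - int q"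
    using assms l(1) unfolding oml_residues_def by blast+
  then have "2 * int q dvd (a l + a (l + 1 - l) - int q) - (a l - a 1 - int q)" by (rule dvd_diff)
  then have "2 * int q dvd 2 * a 1" by simp
  then show "int q dvd a 1" by simp
  have "2 * int q dvd a mid + a (l + 1 - mid) - int q"
    using assms l(2) unfolding oml_residues_def by blast
  then show "2 * int q dvd 2 * a mid - int q" unfolding mid(4) by simp
qed

text \<open>
  The middle entry satisfies \<open>2 a = q\<close> modulo \<open>2q\<close>, so \<open>q\<close> is even. Then \<open>a\<^sub>1\<close>, a multiple of
  \<open>q\<close>, is even, so the middle entry is even too and \<open>4\<close> divides \<open>2 a - q\<close> as well as \<open>2 a\<close>.
\<close>

lemma oml_residues_imp_4_dvd:
  assumes a: "a \<in> res_vectors q" and C: "oml_residues q a"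
  shows "4 dvd q" "even (a 1)"
proof -
  note ends = oml_residues_ends[OF C]
  have "2 dvd 2 * a mid - int q" using ends(2) by (rule dvd_trans [rotated]) simp
  then have ev: "even q" by simp
  then show e1: "even (a 1)" using ends(1) by (meson dvd_trans even_of_nat_iff)
  have "even (a mid)" using same_parityD[OF res_vectors_parity[OF a], of mid] mid(2,3) e1 by simp
  then have "4 dvd 2 * a mid" by (auto elim!: evenE)
  moreover have "4 dvd 2 * a mid - int q"
  proof -
    have "4 dvd 2 * int q" using ev by (auto elim!: evenE)
    then show ?thesis using ends(2) by (rule dvd_trans)
  qed
  ultimately have "4 dvd int q" using dvd_diff[of 4 "2 * a mid" "2 * a mid - int q"] by simp
  then show "4 dvd q" by presburger
qed

lemma chi_oml_not_4: assumes "\<not> 4 dvd q" "q > 0" shows "chi l e q oml = 0"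
proof -
  have "{a \<in> res_vectors q. oml (half_vec a) - half_vec a \<in> qZ q} = {}"
    using oml_fixed_iff[OF _ assms(2)] oml_residues_imp_4_dvd(1) assms(1) by blast
  then have "2 * chi l e q oml = 0" unfolding chi_double[OF om_signed_perm(2) assms(2)] by (simp only: card.empty)
  then show ?thesis by simp
qed

definition reflect :: "nat \<Rightarrow> (nat \<Rightarrow> int) \<Rightarrow> nat \<Rightarrow> int" where
  "reflect q g i = (if i \<in> {1..l} then if i \<le> mid then g i else (int q - g (l + 1 - i)) mod (2 * int q) else undefined)"

text \<open>
  The possible first halves of fixed vectors. The end entry is \<open>0\<close> or \<open>q\<close>, and the middle entry
  is \<open>q/2\<close> or \<open>3q/2\<close>.
\<close>

definition half_residues :: "nat \<Rightarrow> (nat \<Rightarrow> int) set" where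
  "half_residues q = {g \<in> sep_funs (pm_half q) {1..mid} (evens q). g 1 \<in> pm_half q 0 \<and> g mid \<in> pm_half q (int (q div 2))}"

text \<open>
  Every entry of the extended vector lies in the class of an entry of the half vector. Two
  entries from different classes are different up to sign even modulo \<open>q\<close>. Two entries at mirror
  places have the sum \<open>q\<close> modulo \<open>2q\<close>, so they are not opposite, and if they were equal, they
  would lie in the class of \<open>q/2\<close>, which is taken by the middle place.
\<close>

lemma reflect_fixed:
  assumes q: "4 dvd q" "q > 0" and g: "g \<in> half_residues q"
  shows "reflect q g \<in> res_vectors q \<and> oml_residues q (reflect q g)"
proof -
  define h where "h = q div 2"
  have h: "q = 2 * h" "even h" using q(1) by (auto simp: h_def elim!: dvdE)
  have g1: "g \<in> sep_funs (pm_half q) {1..mid} (evens q)" "g 1 \<in> pm_half q 0" "g mid \<in> pm_half q (int h)"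
    using g by (auto simp: half_residues_def h_def)
  have gE: "g i \<in> evens q" if "i \<in> {1..mid}" for i using g1(1) that by (rule sep_funs_mem)
  define a where "a = reflect q g"
  define r where "r i = (if i \<le> mid then i else l + 1 - i)" for i
  have r: "r i \<in> {1..mid}" if "i \<in> {1..l}" for i using that mid by (auto simp: r_def)
  have low: "a i = g i" if "i \<in> {1..mid}" for i using that mid by (simp add: a_def reflect_def)
  have high: "2 * int q dvd a i - (int q - g (l + 1 - i))" if "i \<in> {1..l}" "mid < i" for i
  proof -
    have "a i = (int q - g (l + 1 - i)) mod (2 * int q)" using that by (simp add: a_def reflect_def)
    then have "a i mod (2 * int q) = (int q - g (l + 1 - i)) mod (2 * int q)" by simp
    then show ?thesis by (simp only: mod_eq_dvd_iff)
  qed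
  have aE: "a i \<in> evens q" if i: "i \<in> {1..l}" for i
  proof (cases "i \<le> mid")
    case True
    then show ?thesis using low gE i by simp
  next
    case False
    then have "a i = (int q - g (l + 1 - i)) mod (2 * int q)" using i by (simp add: a_def reflect_def)
    moreover have "even (g (l + 1 - i))" using gE[OF r[OF i]] False by (simp add: r_def evens_def)
    ultimately show ?thesis using h q by (simp add: evens_def dvd_mod_iff)
  qed
  have gmid: "2 * int q dvd 2 * g mid - int q"
  proof -
    have "g mid \<in> {int h, 3 * int h}" using g1(3) pm_half_special(2)[OF q(2) h(1)] by simp
    then show ?thesis using h by auto
  qed
  have pair_low: "2 * int q dvd a i + a (l + 1 - i) - int q" if i: "i \<in> {1..<mid}" for i
  proof -
    have j: "l + 1 - i \<in> {1..l}" "mid < l + 1 - i" "l + 1 - (l + 1 - i) = i" using i mid by auto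
    from high[OF j(1,2)] have "2 * int q dvd a (l + 1 - i) - (int q - a i)"
      unfolding j(3) using low[of i] i by simp
    then show ?thesis by (simp add: algebra_simps)
  qed
  have pair: "2 * int q dvd a i + a (l + 1 - i) - int q" if i: "i \<in> {1..l}" for i
  proof -
    consider "i < mid" | "i = mid" | "mid < i" by linarith
    then show ?thesis
    proof cases
      case 1
      then show ?thesis using pair_low i by simp
    next
      case 2
      then show ?thesis using gmid low[of mid] mid by simp
    next
      case 3
      then have "l + 1 - i \<in> {1..<mid}" "l + 1 - (l + 1 - i) = i" using i mid by auto
      then show ?thesis using pair_low[of "l + 1 - i"] by (simp add: add.commute)
    qed
  qed
  have "2 * int q dvd a l - a 1 - int q"
  proof -
    have "2 * int q dvd a l + a 1 - int q" using pair[of l] l_ge by simp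
    moreover have "2 * int q dvd 2 * a 1"
      using g1(2) low[of 1] mid unfolding pm_half_def by simp
    ultimately have "2 * int q dvd (a l + a 1 - int q) - 2 * a 1" by (rule dvd_diff)
    then show ?thesis by (simp add: algebra_simps)
  qed
  then have C: "oml_residues q a" unfolding oml_residues_def using pair by blast
  have same_class: "int q dvd a i - g (r i) \<or> int q dvd a i + g (r i)" if i: "i \<in> {1..l}" for i
  proof (cases "i \<le> mid")
    case True
    then show ?thesis using low i by (simp add: r_def)
  next
    case False
    then have "2 * int q dvd a i - (int q - g (r i))" using high[OF i] by (simp add: r_def)
    then have "int q dvd a i - (int q - g (r i))" by (rule dvd_mult_right)
    then have "int q dvd (a i + g (r i)) - int q" by (simp add: algebra_simps)
    then have "int q dvd a i + g (r i)"
      using dvd_iff_if_dvd_diff[of "int q" "a i + g (r i)" "a i + g (r i) - int q"] by simp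
    then show ?thesis ..
  qed
  have aR: "a i \<in> pm_half q (g (r i))" if i: "i \<in> {1..l}" for i
  proof -
    have "int q dvd g (r i) - a i \<longleftrightarrow> int q dvd a i - g (r i)" by (rule dvd_diff_commute)
    then show ?thesis using same_class[OF i] aE[OF i] by (auto simp: pm_half_def evens_def add.commute)
  qed
  have "a \<in> res_vectors q"
  proof (rule res_vectors_I)
    show "same_parity a" unfolding same_parity_def using aE l_ge by (simp add: evens_def)
    show "a i \<in> {0..<2 * int q}" if "i \<in> {1..l}" for i using aE[OF that] by (simp add: evens_def)
    show "a i = undefined" if "i \<notin> {1..l}" for i unfolding a_def reflect_def using that by (rule if_not_P)
    fix i k assume ik: "i \<in> {1..l}" "k \<in> {1..l}" "i \<noteq> k"
    show "\<not> 2 * int q dvd a i - a k \<and> \<not> 2 * int q dvd a i + a k"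
    proof (cases "r i = r k")
      case False
      have "a k \<notin> pm_half q (a i)"
      proof
        assume "a k \<in> pm_half q (a i)"
        then have "pm_half q (g (r k)) = pm_half q (g (r i))"
          using pm_half_eq aR[OF ik(1)] aR[OF ik(2)] by metis
        then have "g (r k) \<in> pm_half q (g (r i))"
          using pm_half_self[of "g (r k)" q] gE[OF r[OF ik(2)]] by (simp add: evens_def)
        then show False using sep_funs_sep[OF g1(1) r[OF ik(1)] r[OF ik(2)] False] by simp
      qed
      then have "\<not> int q dvd a i - a k" "\<not> int q dvd a i + a k"
        using aE[OF ik(2)] by (auto simp: pm_half_def evens_def)
      then show ?thesis using dvd_mult_right[of 2 "int q"] by blast
    next
      case True
      then have k: "k = l + 1 - i" and ne: "r i \<noteq> mid" using ik mid by (auto simp: r_def split: if_splits)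
      have sum: "2 * int q dvd a i + a k - int q" using pair[OF ik(1)] by (simp add: k)
      have "\<not> 2 * int q dvd a i + a k"
      proof
        assume "2 * int q dvd a i + a k"
        then have "2 * int q dvd (a i + a k) - (a i + a k - int q)" using sum by (rule dvd_diff)
        then show False using q(2) by (auto dest!: zdvd_imp_le)
      qed
      moreover have "\<not> 2 * int q dvd a i - a k"
      proof
        assume d: "2 * int q dvd a i - a k"
        have "2 * int q dvd (a i + a k - int q) + (a i - a k)" using sum d by (rule dvd_add)
        moreover have "2 * int q dvd (a i + a k - int q) - (a i - a k)" using sum d by (rule dvd_diff)
        moreover have "g (r i) = a i \<or> g (r i) = a k"
          using low[of i] low[of k] r[OF ik(1)] mid ik by (auto simp: r_def k)
        ultimately have "2 * int q dvd 2 * g (r i) - int q" by (auto simp: algebra_simps)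
        then have "2 * int q dvd 2 * (g (r i) - int h)" by (simp add: h(1) algebra_simps)
        then have "int q dvd g (r i) - int h" by (rule double_dvd_double)
        then have "int q dvd int h - g (r i)" by (simp only: dvd_diff_commute)
        then have "g (r i) \<in> pm_half q (int h)"
          using gE[OF r[OF ik(1)]] by (simp add: pm_half_def evens_def)
        then have "g (r i) \<in> pm_half q (g mid)" using pm_half_eq[OF g1(3)] by simp
        moreover have "mid \<in> {1..mid}" using mid by simp
        ultimately show False using sep_funs_sep[OF g1(1) _ r[OF ik(1)]] ne by metis
      qed
      ultimately show ?thesis by simp
    qed
  qed
  with C show ?thesis by (simp add: a_def)
qed

text \<open>
  If two entries in the first half agreed up to sign modulo \<open>q\<close> but not modulo \<open>2q\<close>, then one of
  them would agree up to sign modulo \<open>2q\<close> with the mirror image of the other.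
\<close>

lemma fixed_restrict:
  assumes q: "4 dvd q" "q > 0" and a: "a \<in> res_vectors q" and C: "oml_residues q a"
  shows "restrict a {1..mid} \<in> half_residues q"
proof -
  define h where "h = q div 2"
  have h: "q = 2 * h" "even h" using q(1) by (auto simp: h_def elim!: dvdE)
  note ends = oml_residues_ends[OF C]
  have sub: "{1..mid} \<subseteq> {1..l}" using mid by auto
  have aE: "a i \<in> evens q" if "i \<in> {1..l}" for i
    using res_vectors_range[OF a that] same_parityD[OF res_vectors_parity[OF a] that] oml_residues_imp_4_dvd(2)[OF a C]
    by (simp add: evens_def)
  have "restrict a {1..mid} \<in> sep_funs (pm_half q) {1..mid} (evens q)"
  proof (rule sep_funs_I)
    show "restrict a {1..mid} i \<in> evens q" if "i \<in> {1..mid}" for i using aE that sub by auto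
    show "restrict a {1..mid} i = undefined" if "i \<notin> {1..mid}" for i
      unfolding restrict_apply using that by (rule if_not_P)
    fix i k assume ik: "i \<in> {1..mid}" "k \<in> {1..mid}" "i \<noteq> k"
    have il: "i \<in> {1..l}" "k \<in> {1..l}" using ik sub by auto
    define j where "j = l + 1 - k"
    have j: "j \<in> {1..l}" "j \<noteq> i" using ik mid by (auto simp: j_def)
    have kj: "2 * int q dvd a k + a j - int q"
      using C il(2) unfolding oml_residues_def j_def by blast
    have "\<not> int q dvd a i - a k"
    proof
      assume "int q dvd a i - a k"
      then consider "2 * int q dvd a i - a k" | "2 * int q dvd a i - a k - int q"
        using dvd_double by blast
      then show False
      proof cases
        case 1
        then show False using res_vectors_sep(1)[OF a il ik(3)] by simp
      next
        case 2
        then have "2 * int q dvd (a i - a k - int q) + (a k + a j - int q)" using kj by (rule dvd_add)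
        then have "2 * int q dvd (a i + a j) - 2 * int q" by (simp add: algebra_simps)
        then have "2 * int q dvd a i + a j" using dvd_iff_if_dvd_diff[of "2 * int q" "a i + a j" "a i + a j - 2 * int q"] by simp
        then show False using res_vectors_sep(2)[OF a il(1) j(1)] j(2) by simp
      qed
    qed
    moreover have "\<not> int q dvd a i + a k"
    proof
      assume "int q dvd a i + a k"
      then consider "2 * int q dvd a i + a k" | "2 * int q dvd a i + a k - int q"
        using dvd_double by blast
      then show False
      proof cases
        case 1
        then show False using res_vectors_sep(2)[OF a il ik(3)] by simp
      next
        case 2
        then have "2 * int q dvd (a i + a k - int q) - (a k + a j - int q)" using kj by (rule dvd_diff)
        then have "2 * int q dvd a i - a j" by (simp add: algebra_simps)
        then show False using res_vectors_sep(1)[OF a il(1) j(1)] j(2) by simp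
      qed
    qed
    ultimately show "restrict a {1..mid} k \<notin> pm_half q (restrict a {1..mid} i)"
      using ik by (simp add: pm_half_def)
  qed
  moreover have "a 1 \<in> pm_half q 0" using ends(1) aE[of 1] l_ge by (simp add: pm_half_def evens_def)
  moreover have "a mid \<in> pm_half q (int h)"
  proof -
    have "2 * int q dvd 2 * (a mid - int h)" using ends(2) by (simp add: h(1) algebra_simps)
    then have "int q dvd a mid - int h" by (rule double_dvd_double)
    then have "int q dvd int h - a mid" by (simp only: dvd_diff_commute)
    then show ?thesis using aE[of mid] mid by (simp add: pm_half_def evens_def)
  qed
  ultimately show ?thesis using mid unfolding half_residues_def h_def by simp
qed

lemma bij_reflect:
  assumes q: "4 dvd q" "q > 0"
  shows "bij_betw (reflect q) (half_residues q) {a \<in> res_vectors q. oml (half_vec a) - half_vec a \<in> qZ q}"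
proof (rule bij_betw_byWitness [of _ "\<lambda>a. restrict a {1..mid}"])
  have S: "{a \<in> res_vectors q. oml (half_vec a) - half_vec a \<in> qZ q} = {a \<in> res_vectors q. oml_residues q a}"
    using oml_fixed_iff[OF _ q(2)] by blast
  show "reflect q ` half_residues q \<subseteq> {a \<in> res_vectors q. oml (half_vec a) - half_vec a \<in> qZ q}"
    unfolding S using reflect_fixed[OF q] by blast
  show "(\<lambda>a. restrict a {1..mid}) ` {a \<in> res_vectors q. oml (half_vec a) - half_vec a \<in> qZ q} \<subseteq> half_residues q"
    unfolding S using fixed_restrict[OF q] by blast
  show "\<forall>g\<in>half_residues q. restrict (reflect q g) {1..mid} = g"
  proof
    fix g assume "g \<in> half_residues q"
    then have g: "g \<in> sep_funs (pm_half q) {1..mid} (evens q)" by (simp add: half_residues_def)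
    show "restrict (reflect q g) {1..mid} = g"
    proof
      fix i show "restrict (reflect q g) {1..mid} i = g i"
      proof (cases "i \<in> {1..mid}")
        case True
        then show ?thesis using mid by (simp add: reflect_def)
      next
        case False
        then show ?thesis unfolding restrict_apply using sep_funs_undefined[OF g False] by (simp only: if_False)
      qed
    qed
  qed
  show "\<forall>a\<in>{a \<in> res_vectors q. oml (half_vec a) - half_vec a \<in> qZ q}. reflect q (restrict a {1..mid}) = a"
    unfolding S
  proof
    fix a assume "a \<in> {a \<in> res_vectors q. oml_residues q a}"
    then have a: "a \<in> res_vectors q" and C: "oml_residues q a" by auto
    show "reflect q (restrict a {1..mid}) = a"
    proof
      fix i
      consider "i \<notin> {1..l}" | "i \<in> {1..mid}" | "i \<in> {1..l}" "mid < i" by fastforce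
      then show "reflect q (restrict a {1..mid}) i = a i"
      proof cases
        case 1
        then show ?thesis unfolding reflect_def using res_vectors_undefined[OF a 1] by (simp only: if_False)
      next
        case 2
        then show ?thesis using mid by (simp add: reflect_def)
      next
        case 3
        then have j: "l + 1 - i \<in> {1..mid}" using mid by auto
        have "2 * int q dvd a i + a (l + 1 - i) - int q" using C 3(1) unfolding oml_residues_def by blast
        then have "2 * int q dvd a i - (int q - a (l + 1 - i))" by (simp add: algebra_simps)
        then have "a i mod (2 * int q) = (int q - a (l + 1 - i)) mod (2 * int q)" by (simp only: mod_eq_dvd_iff)
        then have "a i = (int q - a (l + 1 - i)) mod (2 * int q)" using res_vectors_range[OF a 3(1)] by simp
        then show ?thesis using 3 j by (simp add: reflect_def)
      qed
    qed
  qed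
qed

text \<open>
  Two choices for each of the end and the middle entry; the remaining \<open>(l - 3) / 2\<close> entries are
  taken from different classes among the other \<open>q - 4\<close> even residues.
\<close>

lemma card_half_residues:
  assumes q: "4 dvd q" "q > 0"
  shows "real (card (half_residues q)) = 4 * (\<Prod>i=1..(l-3) div 2. real q - 4 * real i)"
proof -
  define h where "h = q div 2"
  have h: "q = 2 * h" "even h" using q(1) by (auto simp: h_def elim!: dvdE)
  have h0: "h > 0" using h q(2) by simp
  define T where "T = evens q - pm_half q 0 - pm_half q (int h)"
  define D where "D = sep_funs (pm_half q) {1..mid} (evens q)"
  define X where "X p = {g \<in> D. g 1 = fst p \<and> g mid = snd p}" for p :: "int \<times> int"
  define P where "P = pm_half q 0 \<times> pm_half q (int h)"
  note special = pm_half_special[OF q(2) h(1)]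
  have mm: "1 \<in> {1..mid}" "mid \<in> {1..mid}" "1 \<noteq> mid" using mid by auto
  have finD: "finite D" unfolding D_def by (intro finite_sep_funs finite_evens) simp
  have card: "card (X p) = card (sep_funs (pm_half q) ({1..mid} - {1} - {mid}) T)" if p: "p \<in> P" for p
  proof -
    obtain u v where uv: "p = (u, v)" "u \<in> pm_half q 0" "v \<in> pm_half q (int h)" using p by (auto simp: P_def)
    have U: "pm_half q u = pm_half q 0" and V: "pm_half q v = pm_half q (int h)" using uv pm_half_eq by auto
    have ur: "u \<in> {0..<2 * int q}" and vr: "v \<in> {0..<2 * int q}" using uv by (auto simp: pm_half_def)
    have disj: "pm_half q 0 \<inter> pm_half q (int h) = {}" unfolding special using h h0 by auto
    have "pm_half q 0 \<subseteq> evens q" "pm_half q (int h) \<subseteq> evens q"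
      unfolding special using h h0 by (auto simp: evens_def)
    then have E: "evens q = pm_half q u \<union> (pm_half q v \<union> T)" unfolding U V T_def by blast
    have range: "pm_half q v \<union> T \<subseteq> {0..<2 * int q}" by (auto simp: T_def evens_def pm_half_def)
    have "card {g \<in> sep_funs (pm_half q) {1..mid} (pm_half q u \<union> (pm_half q v \<union> T)). g 1 = u \<and> g mid = v}
        = card (sep_funs (pm_half q) ({1..mid} - {1} - {mid}) T)"
    proof (rule card_sep_funs_pin2 [OF mm])
      show "u \<in> pm_half q u" "v \<in> pm_half q v" using pm_half_self ur vr by auto
      show d: "(pm_half q v \<union> T) \<inter> pm_half q u = {}" unfolding U V using disj by (auto simp: T_def)
      show d': "T \<inter> pm_half q v = {}" unfolding V by (auto simp: T_def)
      show "u \<notin> pm_half q a" if a: "a \<in> pm_half q v \<union> T" for a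
      proof
        assume "u \<in> pm_half q a"
        then have "a \<in> pm_half q u" by (rule pm_half_sym) (use a range in blast)
        then show False using a d by blast
      qed
      show "v \<notin> pm_half q a" if a: "a \<in> T" for a
      proof
        assume "v \<in> pm_half q a"
        then have "a \<in> pm_half q v" by (rule pm_half_sym) (use a range in blast)
        then show False using a d' by blast
      qed
    qed
    then show ?thesis unfolding X_def D_def E uv(1) fst_conv snd_conv .
  qed
  have "half_residues q = (\<Union>p\<in>P. X p)"
    unfolding half_residues_def X_def D_def P_def h_def by auto
  then have "card (half_residues q) = card (\<Union>p\<in>P. X p)" by simp
  also have "\<dots> = (\<Sum>p\<in>P. card (X p))"
  proof (rule card_UN_disjoint)
    show "finite P" unfolding P_def special by simp
    have "X p \<subseteq> D" for p unfolding X_def by blast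
    then show "\<forall>p\<in>P. finite (X p)" using finite_subset finD by blast
    show "\<forall>p\<in>P. \<forall>p'\<in>P. p \<noteq> p' \<longrightarrow> X p \<inter> X p' = {}" unfolding X_def by (auto simp: prod_eq_iff)
  qed
  also have "\<dots> = card P * card (sep_funs (pm_half q) ({1..mid} - {1} - {mid}) T)" using card by simp
  also have "card P = 4" unfolding P_def special using h h0 q(2) by (simp add: card_cartesian_product)
  finally have "real (card (half_residues q)) = 4 * real (card (sep_funs (pm_half q) ({1..mid} - {1} - {mid}) T))"
    by simp
  also have "real (card (sep_funs (pm_half q) ({1..mid} - {1} - {mid}) T)) = (\<Prod>i<card ({1..mid} - {1} - {mid}). real q - 4 - 4 * real i)"
    by (rule card_sep_pm_half [OF q(2) h _ T_def]) simp
  also have "card ({1..mid} - {1} - {mid}) = (l - 3) div 2"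
  proof -
    have "card ({1..mid} - {1} - {mid}) = mid - 2" using mm by (simp add: card_Diff_singleton)
    then show ?thesis using mid(1,2) by simp
  qed
  also have "(\<Prod>i<(l - 3) div 2. real q - 4 - 4 * real i) = (\<Prod>i=1..(l-3) div 2. real q - 4 * real i)"
    unfolding One_nat_def prod.atLeast1_atMost_eq by (simp add: algebra_simps)
  finally show ?thesis .
qed

lemma chi_oml_4:
  assumes "4 dvd q" "q > 0"
  shows "real (chi l e q oml) = 2 * (\<Prod>i=1..(l-3) div 2. real q - 4 * real i)"
proof -
  have "2 * chi l e q oml = card (half_residues q)"
    unfolding chi_double[OF om_signed_perm(2) assms(2)] using bij_betw_same_card[OF bij_reflect[OF assms]] by simp
  then have "2 * real (chi l e q oml) = real (card (half_residues q))"
    by (metis of_nat_mult of_nat_numeral)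
  then show ?thesis unfolding card_half_residues[OF assms] by simp
qed

text \<open>
  The two elements are inverse to each other, so they fix the same cosets.
\<close>

lemma chi_oml': assumes "q > 0" shows "chi l e q oml' = chi l e q oml"
proof -
  have inv: "oml' (oml x) = x" for x by (rule coord_eqI) (use l_ge in auto)
  have lin: "oml' (x - y) = oml' x - oml' y" "oml (x - y) = oml x - oml y" for x y
    using om_signed_perm(2,3) signed_perm_linear linear_diff by blast+
  have neg: "- x \<in> qZ q" if "x \<in> qZ q" for x using qZ_diff[OF qZ_0 that] by simp
  have "oml' x - x \<in> qZ q \<longleftrightarrow> oml x - x \<in> qZ q" for x
  proof
    assume "oml' x - x \<in> qZ q"
    then have "oml (oml' x - x) \<in> qZ q" by (rule qZ_signed_perm [OF om_signed_perm(2)])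
    then have "x - oml x \<in> qZ q" by (simp add: lin om_relations(4))
    then show "oml x - x \<in> qZ q" using neg by fastforce
  next
    assume "oml x - x \<in> qZ q"
    then have "oml' (oml x - x) \<in> qZ q" by (rule qZ_signed_perm [OF om_signed_perm(3)])
    then have "x - oml' x \<in> qZ q" by (simp add: lin inv)
    then show "oml' x - x \<in> qZ q" using neg by fastforce
  qed
  then have "2 * chi l e q oml' = 2 * chi l e q oml"
    unfolding chi_double[OF om_signed_perm(2) assms] chi_double[OF om_signed_perm(3) assms] by (simp only:)
  then show ?thesis by simp
qed

end

theorem theorem5p7:
  fixes e :: "nat \<Rightarrow> 'a::euclidean_space" and l q :: nat and \<omega> :: "'a \<Rightarrow> 'a"
  assumes "bij_betw e {1..l} Basis"
    and "l \<ge> 5" and "odd l"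
    and "\<omega> \<in> alcove_stabilizer l e"
    and "q > 0"
  shows "alcove_stabilizer l e = {id, omega l e 1, omega l e (l - 1), omega l e l} \<and>
    (\<omega> = id \<and> odd q \<longrightarrow>
       real (chi l e q \<omega>) = (\<Prod>i=1..l-1. real q - (2 * real i - 1)) * (real q - (real l - 1))) \<and>
    (\<omega> = id \<and> even q \<longrightarrow>
       real (chi l e q \<omega>) = (\<Prod>i=1..l-2. real q - 2 * real i) *
         (real q ^ 2 - 2 * (real l - 1) * real q + real l * (real l - 1) / 2)) \<and>
    (\<omega> = omega l e 1 \<and> odd q \<longrightarrow> chi l e q \<omega> = 0) \<and>
    (\<omega> = omega l e 1 \<and> even q \<longrightarrow>
       real (chi l e q \<omega>) = (\<Prod>i=1..l-2. real q - 2 * real i)) \<and>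
    (\<omega> \<in> {omega l e (l - 1), omega l e l} \<and> \<not> 4 dvd q \<longrightarrow> chi l e q \<omega> = 0) \<and>
    (\<omega> \<in> {omega l e (l - 1), omega l e l} \<and> 4 dvd q \<longrightarrow>
       real (chi l e q \<omega>) = 2 * (\<Prod>i=1..(l-3) div 2. real q - 4 * real i))"
proof -
  interpret type_D_odd e l using assms(1-3) by unfold_locales
  have oml: "chi l e q \<omega> = chi l e q oml" if "\<omega> \<in> {oml', oml}"
    using that chi_oml'[OF assms(5)] by blast
  show ?thesis
    unfolding omega_eq
  proof (intro conjI impI; (elim conjE)?)
    show "alcove_stabilizer l e = {id, om1, oml', oml}" by (rule alcove_stabilizer_eq)
  next
    assume "\<omega> = id" "odd q"
    then show "real (chi l e q \<omega>) = (\<Prod>i=1..l-1. real q - (2 * real i - 1)) * (real q - (real l - 1))"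
      using chi_id_odd by (simp only:)
  next
    assume "\<omega> = id" "even q"
    then show "real (chi l e q \<omega>) = (\<Prod>i=1..l-2. real q - 2 * real i) *
         (real q ^ 2 - 2 * (real l - 1) * real q + real l * (real l - 1) / 2)"
      using chi_id_even assms(5) by (simp only:)
  next
    assume "\<omega> = om1" "odd q"
    then show "chi l e q \<omega> = 0" using chi_om1_odd by (simp only:)
  next
    assume "\<omega> = om1" "even q"
    then show "real (chi l e q \<omega>) = (\<Prod>i=1..l-2. real q - 2 * real i)"
      using chi_om1_even assms(5) by (simp only:)
  next
    assume "\<omega> \<in> {oml', oml}" "\<not> 4 dvd q"
    then show "chi l e q \<omega> = 0" using chi_oml_not_4 oml assms(5) by metis
  next
    assume "\<omega> \<in> {oml', oml}" "4 dvd q"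
    then show "real (chi l e q \<omega>) = 2 * (\<Prod>i=1..(l-3) div 2. real q - 4 * real i)"
      using chi_oml_4 oml assms(5) by metis
  qed
qed

end
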